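(* Let $k\geq 1$ be an integer and let $\alpha,\beta>0$ satisfy $\alpha\beta=1$. Then \begin{align*} &\alpha^{\frac{k}{2}-1}\sum_{n=1}^{\infty}r_{k}(n)\left\{ \frac{e^{\frac{\pi n\alpha^{2}}{2}}}{\sqrt{n}}W_{\frac{1-k}{2},0}\left(\pi n\alpha^{2}\right)-\frac{\pi^{\frac{1-k}{2}}}{n^{\frac{k}{2}}\alpha^{k-1}}\right\} +\pi^{\frac{1-k}{2}}\alpha^{-\frac{k}{2}}\zeta_{k-1}\left(\tfrac{k}{2}\right)\\ &\quad+\frac{\sqrt{\pi}}{\Gamma\left(\frac{k}{2}\right)\alpha^{\frac{k}{2}}}\left(2\gamma+\psi\left(\tfrac{k}{2}\right)-2\log\Phi_k -\log\left(4\pi\alpha^{2}\right)\right)\\ &=\beta^{\frac{k}{2}-1}\sum_{n=1}^{\infty}r_{k}(n)\left\{ \frac{e^{\frac{\pi n\beta^{2}}{2}}}{\sqrt{n}}W_{\frac{1-k}{2},0}\left(\pi n\beta^{2}\right)-\frac{\pi^{\frac{1-k}{2}}}{n^{\frac{k}{2}}\beta^{k-1}}\right\} +\pi^{\frac{1-k}{2}}\beta^{-\frac{k}{2}}\zeta_{k-1}\left(\tfrac{k}{2}\right)\\ &\quad+\frac{\sqrt{\pi}}{\Gamma\left(\frac{k}{2}\right)\beta^{\frac{k}{2}}}\left(2\gamma+\psi\left(\tfrac{k}{2}\right)-2\log\Phi_k-\log\left(4\pi\beta^{2}\right)\right), \end{align*} where $\Phi_k:=\prod_{\mathbf{m}\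in\mathbb{Z}^{k-1}\setminus\{\mathbf{0}\}}\left(1-e^{-2\pi|\mathbf{m}|}\right)$.
   Context: For integers $j\geq1$ and $n\geq 0$, $r_j(n)$ is the number of $(n_1,\dots,n_j)\in\mathbb{Z}^j$ with $n_1^2+\dots+n_j^2=n$, and $\zeta_j(s)=\sum_{n=1}^\infty r_j(n)n^{-s}$ for $\mathrm{Re}(s)>j/2$ (so $\zeta_{k-1}(k/2)$ is given by an absolutely convergent series when $k\ge2$). Conventions for $k=1$: $\zeta_0:=0$ and the empty product $\Phi_1:=1$. $|\mathbf{m}|$ is the Euclidean norm. $\gamma$ is the Euler–Mascheroni constant, $\psi=\Gamma'/\Gamma$ the digamma function, and $W_{\mu,\nu}(x)$ is the Whittaker function, i.e. the solution of $u''+\left(\frac{\mu}{x}+\frac{1-\nu^2}{4x^2}-\frac14\right)u=0$ characterized by $W_{\mu,\nu}(x)\sim x^{\mu}e^{-x/2}$ as $x\to\infty$. *)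

theory Defs
  imports "HOL-Analysis.Analysis"
begin

definition lattice :: "nat \<Rightarrow> int list set" where
  "lattice j = {xs. length xs = j}"

definition r :: "nat \<Rightarrow> nat \<Rightarrow> nat" where
  "r j n = card {xs \<in> lattice j. (\<Sum>x\<leftarrow>xs. x ^ 2) = int n}"

text \<open>zeta_j(s) = sum_{n>=1} r_j(n) n^(-s) (for j = 0 this is 0, as r_0(n) = 0 for n >= 1).\<close>
definition zeta_r :: "nat \<Rightarrow> real \<Rightarrow> real" where
  "zeta_r j s = (\<Sum>n. real (r j (Suc n)) / real (Suc n) powr s)"

definition lnorm :: "int list \<Rightarrow> real" where
  "lnorm xs = sqrt (\<Sum>x\<leftarrow>xs. real_of_int x ^ 2)"

text \<open>Phi_k = prod over m in Z^(k-1) minus 0 of (1 - exp(-2 pi |m|)); an unconditionally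
  (absolutely) convergent product of positive factors, written as exp of the unordered sum of logs.
  For k = 1 the index set is empty and Phi_1 = 1.\<close>
definition Phi :: "nat \<Rightarrow> real" where
  "Phi k = exp (\<Sum>\<^sub>\<infinity>m\<in>lattice (k - 1) - {replicate (k - 1) 0}.
                   ln (1 - exp (- 2 * pi * lnorm m)))"

text \<open>Whittaker function W_{mu,nu}(x) for x > 0: the solution of
  u'' + (mu/x + (1 - nu^2)/(4 x^2) - 1/4) u = 0 with u(x) ~ x^mu e^(-x/2) as x \<rightarrow> \<infinity>.
  (Set to 0 for x \<le> 0 to make the description unique.)\<close>
definition whittaker_W :: "real \<Rightarrow> real \<Rightarrow> real \<Rightarrow> real" where
  "whittaker_W \<mu> \<nu> = (THE u.
      (\<forall>x. x \<le> 0 \<longrightarrow> u x = 0) \<and>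
      (\<exists>u'. \<forall>x>0. (u has_real_derivative u' x) (at x) \<and>
            (u' has_real_derivative
               (- (\<mu> / x + (1 - \<nu>\<^sup>2) / (4 * x\<^sup>2) - 1/4) * u x)) (at x)) \<and>
      ((\<lambda>x. u x / (x powr \<mu> * exp (- x / 2))) \<longlongrightarrow> 1) at_top)"

definition side :: "nat \<Rightarrow> real \<Rightarrow> real" where
  "side k a =
     a powr (real k / 2 - 1) *
       (\<Sum>n. real (r k (Suc n)) *
          (exp (pi * real (Suc n) * a\<^sup>2 / 2) / sqrt (real (Suc n))
             * whittaker_W ((1 - real k) / 2) 0 (pi * real (Suc n) * a\<^sup>2)
           - pi powr ((1 - real k) / 2) / (real (Suc n) powr (real k / 2) * a powr (real k - 1))))
     + pi powr ((1 - real k) / 2) * a powr (- real k / 2) * zeta_r (k - 1) (real k / 2)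
     + sqrt pi / (Gamma (real k / 2) * a powr (real k / 2)) *
         (2 * euler_mascheroni + Digamma (real k / 2) - 2 * ln (Phi k) - ln (4 * pi * a\<^sup>2))"

end

theory Submission
  imports Defs "HOL-Real_Asymp.Real_Asymp"
begin

text \<open>
  Put \<open>a = k/2\<close>. The Whittaker function is a Laplace integral,
  \<open>exp (x/2) W(x) / sqrt x = \<integral>\<^sub>0\<^sup>\<infinity> exp (- x t) t\<^sup>a\<^sup>-\<^sup>1 (1 + t)\<^sup>-\<^sup>a dt / Gamma a\<close>, so the series on either
  side is, up to a constant factor, the integral of \<open>(theta s ^ k - 1) s\<^sup>a\<^sup>-\<^sup>1\<close> against
  \<open>\<alpha>\<^sup>a (\<alpha>\<^sup>2 + s)\<^sup>-\<^sup>a - \<alpha>\<^sup>-\<^sup>a\<close>, where \<open>theta s\<close> is the sum of \<open>exp (- pi n\<^sup>2 s)\<close> over all integers \<open>n\<close>.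
  Splitting the integral at \<open>s = 1\<close> and using \<open>theta (1/s) = sqrt s theta s\<close> makes the first kernel
  symmetric under \<open>\<alpha> \<mapsto> 1/\<alpha>\<close>; the second contributes \<open>\<alpha>\<^sup>-\<^sup>a\<close> times the constant term at \<open>s = k/2\<close> of the
  Epstein zeta function. Kronecker's limit formula evaluates this constant term through
  \<open>zeta_r (k - 1) (k/2)\<close> and \<open>ln (Phi k)\<close>, and the elementary integrals that are left over
  produce the digamma and logarithm terms.
\<close>

section \<open>The transformation formula of the theta function\<close>

text \<open>The two parts of the kernel cannot be integrated separately: near \<open>s = 0\<close>
  the function \<open>theta s ^ k\<close> grows like s^(-k/2), so each part alone diverges
  logarithmically and only their difference, which is O(s), is harmless. The splitting is therefore
  done on \<open>{1..}\<close> after the inversion, where the divergent pieces appear combined as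
  \<open>(1 - (1 + X/s) powr (- a)) / s\<close>. This integral is the source of the digamma value,
  of one \<open>euler_mascheroni\<close> and of the logarithm of \<alpha>; the other
  \<open>euler_mascheroni\<close> and ln (4 pi) come from Kronecker's formula. There one coordinate
  is kept apart: inverting the other k - 1 theta factors leaves the weight s^(-1/2), and the Bessel
  integral of order one half is elementary. Hence the dimension k - 1 in \<open>zeta_r\<close> and
  \<open>Phi\<close>. Signs are arranged so that integrands summed termwise are nonnegative:
  monotone convergence gives the interchange and the convergence of the series together. The
  inversion of theta comes from a finite identity between cosine powers and binomial
  coefficients.\<close>

lemma sin_times_dirichlet_kernel:
  fixes x :: real
  shows "sin (x/2) * (1 + 2 * (\<Sum>v=1..p. cos (real v * x))) = sin ((real p + 1/2) * x)"
proof (induction p)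
  case 0
  then show ?case by simp
next
  case (Suc p)
  have "2 * sin (x/2) * cos (real (Suc p) * x)
          = sin ((real (Suc p) + 1/2) * x) - sin ((real p + 1/2) * x)"
    by (subst sin_diff_sin) (simp add: algebra_simps add_divide_distrib)
  with Suc show ?case by (simp add: algebra_simps)
qed

text \<open>Orthogonality of characters modulo the odd number \<open>l\<close>: conjugate pairs of
  \<open>l\<close>-th roots of unity are grouped, which leaves only the root 1 unpaired. If
  \<open>l\<close> does not divide \<open>j\<close>, the Dirichlet kernel at x = 2 pi j / l vanishes
  because (p + 1/2) x = j pi.\<close>

lemma sum_cos_roots_of_unity:
  fixes j p :: nat
  defines "l \<equiv> 2 * p + 1"
  shows "1 + 2 * (\<Sum>v=1..p. cos (2 * pi * real v * real j / real l)) = (if l dvd j then real l else 0)"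
proof (cases "l dvd j")
  case True
  then obtain i where "j = l * i" by auto
  have l_pos: "real l > 0" by (simp add: l_def)
  have "cos (2 * pi * real v * real j / real l) = 1" for v
  proof -
    have "2 * pi * real v * real j / real l = 2 * pi * real (v * i)"
      using l_pos by (simp add: \<open>j = l * i\<close>)
    then show ?thesis by (metis cos_2npi mult.assoc mult.commute)
  qed
  then show ?thesis using True by (simp add: l_def)
next
  case False
  define x where "x = 2 * pi * real j / real l"
  have l: "real l > 0" by (simp add: l_def)
  have "sin (x/2) \<noteq> 0"
  proof
    assume "sin (x/2) = 0"
    then obtain i :: int where "x/2 = of_int i * pi" by (auto simp: sin_zero_iff_int2)
    then have "real j = real_of_int i * real l" using l by (simp add: x_def field_simps)
    then have "int j = i * int l" by (metis of_int_eq_iff of_int_mult of_int_of_nat_eq)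
    then have "int l dvd int j" by simp
    with False show False by simp
  qed
  moreover have "sin ((real p + 1/2) * x) = 0"
  proof -
    have "(real p + 1/2) * x = real j * pi" using l by (simp add: x_def l_def field_simps)
    then show ?thesis by (metis sin_npi)
  qed
  ultimately have "1 + 2 * (\<Sum>v=1..p. cos (real v * x)) = 0"
    using sin_times_dirichlet_kernel[of x p] by simp
  then show ?thesis using False by (simp add: x_def mult_ac)
qed

text \<open>Binomial theorem for cis x + cis (-x); the terms at \<open>m + j\<close> and
  \<open>m - j\<close> have equal coefficients and opposite frequencies.\<close>

lemma cos_even_power_expansion:
  fixes x :: real
  shows "(2 * cos x) ^ (2 * m) = real ((2*m) choose m)
           + 2 * (\<Sum>j=1..m. real ((2*m) choose (m + j)) * cos (2 * real j * x))"
proof -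
  define f where "f i = real ((2*m) choose i) * cos ((2 * real i - 2 * real m) * x)" for i
  have "cis x + cis (-x) = complex_of_real (2 * cos x)" by (simp add: complex_eq_iff)
  then have "complex_of_real ((2 * cos x) ^ (2 * m)) = (cis x + cis (-x)) ^ (2*m)" by simp
  also have "\<dots> = (\<Sum>i\<le>2*m. of_nat ((2*m) choose i) * cis x ^ i * cis (-x) ^ (2*m - i))"
    by (rule binomial_ring)
  also have "\<dots> = (\<Sum>i\<le>2*m. of_nat ((2*m) choose i) * cis ((2 * real i - 2 * real m) * x))"
    by (intro sum.cong refl) (simp add: Complex.DeMoivre cis_mult of_nat_diff algebra_simps)
  finally have "Re (complex_of_real ((2 * cos x) ^ (2 * m)))
      = Re (\<Sum>i\<le>2*m. of_nat ((2*m) choose i) * cis ((2 * real i - 2 * real m) * x))"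
    by (rule arg_cong)
  then have "(2 * cos x) ^ (2 * m) = (\<Sum>i\<le>2*m. f i)" by (simp add: f_def)
  also have "{..2*m} = {..<m} \<union> ({m} \<union> {m+1..2*m})" by auto
  also have "sum f \<dots> = sum f {..<m} + (f m + sum f {m+1..2*m})"
    by (subst sum.union_disjoint) (auto simp: sum.union_disjoint)
  also have "sum f {m+1..2*m} = (\<Sum>j=1..m. real ((2*m) choose (m + j)) * cos (2 * real j * x))"
    by (rule sum.reindex_bij_witness[of _ "\<lambda>j. m + j" "\<lambda>i. i - m"]) (auto simp: f_def of_nat_diff)
  also have "sum f {..<m} = (\<Sum>j=1..m. real ((2*m) choose (m + j)) * cos (2 * real j * x))"
  proof (rule sum.reindex_bij_witness[of _ "\<lambda>j. m - j" "\<lambda>i. m - i"])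
    fix i assume "i \<in> {..<m}"
    then have "(2*m) choose (m + (m - i)) = (2*m) choose i"
      by (subst binomial_symmetric) auto
    moreover have "cos (2 * real (m - i) * x) = cos ((2 * real i - 2 * real m) * x)"
      using \<open>i \<in> {..<m}\<close> by (subst cos_minus[symmetric]) (simp add: of_nat_diff algebra_simps)
    ultimately show "real ((2*m) choose (m + (m - i))) * cos (2 * real (m - i) * x) = f i"
      by (simp add: f_def)
  qed auto
  finally show ?thesis by (simp add: f_def)
qed

text \<open>A finite form of Poisson summation: after expanding the cosine powers and summing over
  \<open>v\<close> first, orthogonality retains exactly the binomial coefficients whose distance
  from the centre is a multiple of \<open>l\<close>. Even powers contain only even frequencies, so
  the points pi v / l produce the angles 2 pi v j / l.\<close>

lemma finite_theta_identity:
  fixes m p :: nat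
  defines "l \<equiv> 2 * p + 1"
  shows "1 + 2 * (\<Sum>v=1..p. cos (pi * real v / real l) ^ (2*m))
       = (real l * real ((2*m) choose m) / 4 ^ m)
         * (1 + 2 * (\<Sum>i=1..m. real ((2*m) choose (m + l * i)) / real ((2*m) choose m)))"
proof -
  define B where "B j = real ((2*m) choose (m + j))" for j
  have B0: "B 0 > 0" by (simp add: B_def)
  have "4 ^ m * (1 + 2 * (\<Sum>v=1..p. cos (pi * real v / real l) ^ (2*m)))
      = (2 * cos 0) ^ (2*m) + 2 * (\<Sum>v=1..p. (2 * cos (pi * real v / real l)) ^ (2*m))"
  proof -
    have "(2 * y) ^ (2*m) = 4 ^ m * y ^ (2*m)" for y :: real
      by (simp add: power_mult power_mult_distrib)
    then show ?thesis by (simp only:) (simp add: sum_distrib_left distrib_left mult.left_commute)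
  qed
  also have "\<dots> = (B 0 + 2 * (\<Sum>j=1..m. B j))
      + 2 * (\<Sum>v=1..p. B 0 + 2 * (\<Sum>j=1..m. B j * cos (2 * real j * (pi * real v / real l))))"
    unfolding cos_even_power_expansion by (simp add: B_def)
  also have "\<dots> = B 0 * (1 + 2 * real p) + 2 * ((\<Sum>j=1..m. B j)
      + 2 * (\<Sum>v=1..p. (\<Sum>j=1..m. B j * cos (2 * real j * (pi * real v / real l)))))"
    by (simp add: sum.distrib sum_distrib_left algebra_simps)
  also have "(\<Sum>v=1..p. (\<Sum>j=1..m. B j * cos (2 * real j * (pi * real v / real l))))
     = (\<Sum>j=1..m. B j * (\<Sum>v=1..p. cos (2 * pi * real v * real j / real l)))"
    by (subst sum.swap) (simp add: sum_distrib_left mult_ac)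
  also have "(\<Sum>j=1..m. B j) + 2 * \<dots>
     = (\<Sum>j=1..m. B j * (1 + 2 * (\<Sum>v=1..p. cos (2 * pi * real v * real j / real l))))"
    by (simp add: sum.distrib sum_distrib_left algebra_simps)
  also have "\<dots> = (\<Sum>j=1..m. B j * (if l dvd j then real l else 0))"
    unfolding l_def sum_cos_roots_of_unity ..
  also have "\<dots> = real l * (\<Sum>j\<in>{j\<in>{1..m}. l dvd j}. B j)"
    by (subst sum.inter_filter) (auto simp: sum_distrib_left intro!: sum.cong)
  \<comment> \<open>The range \<open>{1..m}\<close> for \<open>i\<close> overshoots: multiples
    \<open>l * i > m\<close> contribute zero because the binomial coefficient vanishes there. The
    index set thereby becomes independent of \<open>l\<close>.\<close>
  also have "(\<Sum>j\<in>{j\<in>{1..m}. l dvd j}. B j) = (\<Sum>j\<in>(\<lambda>i. l * i) ` {1..m}. B j)"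
  proof (rule sum.mono_neutral_left)
    show "{j \<in> {1..m}. l dvd j} \<subseteq> (\<lambda>i. l * i) ` {1..m}"
    proof
      fix j assume j: "j \<in> {j \<in> {1..m}. l dvd j}"
      then obtain i where i: "j = l * i" by auto
      have "i \<noteq> 0" using i j by (cases i) auto
      moreover have "i \<le> j" by (simp add: i l_def)
      ultimately have "i \<ge> 1" "i \<le> m" using j by auto
      with i show "j \<in> (\<lambda>i. l * i) ` {1..m}" by auto
    qed
    show "\<forall>i\<in>(\<lambda>i. l * i) ` {1..m} - {j \<in> {1..m}. l dvd j}. B i = 0"
    proof
      fix j assume "j \<in> (\<lambda>i. l * i) ` {1..m} - {j \<in> {1..m}. l dvd j}"
      then have "j > m" by (auto simp: l_def simp del: mult_Suc)
      then show "B j = 0" by (simp add: B_def)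
    qed
  qed auto
  also have "\<dots> = (\<Sum>i=1..m. B (l * i))"
    by (subst sum.reindex) (auto intro!: inj_onI simp: l_def simp del: mult_Suc)
  also have "B 0 * (1 + 2 * real p) + 2 * (real l * \<dots>)
     = real l * B 0 * (1 + 2 * (\<Sum>i=1..m. B (l * i) / B 0))"
    using B0 by (simp add: l_def field_simps flip: sum_divide_distrib)
  finally show ?thesis by (simp add: B_def field_simps)
qed

section \<open>Bounds and asymptotics of central binomial coefficients\<close>

text \<open>The ratio is the product over i = 1..j of (m - i + 1)/(m + i) = 1 - (2 i - 1)/(m + i).
  The inequality 1 + y <= exp y, applied to the factors and to their inverses, bounds it from both
  sides, and the odd numbers 2 i - 1 sum to j^2. For j of order sqrt m both exponents behave like -
  j^2/m, the Gaussian profile.\<close>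

lemma central_binomial_ratio_bounds:
  fixes m j :: nat
  shows "real ((2*m) choose (m + j)) / real ((2*m) choose m) \<le> exp (- (real j ^ 2) / real (m + j))"
    and "j \<le> m \<Longrightarrow> exp (- (real j ^ 2) / real (m - j + 1))
            \<le> real ((2*m) choose (m + j)) / real ((2*m) choose m)"
proof -
  define q where "q j = real ((2*m) choose (m + j)) / real ((2*m) choose m)" for j
  have sq: "(\<Sum>i=1..j. - (2 * real i - 1) / M) = - (real j ^ 2) / M" for j M
  proof (induction j)
    case (Suc j)
    then show ?case by (simp add: power2_eq_square add_divide_distrib diff_divide_distrib algebra_simps)
  qed simp
  have step: "q (Suc i) = q i * ((real m - real i) / (real m + real i + 1))" if "i \<le> m" for i
  proof -
    have "Suc (m+i) * ((2*m) choose Suc (m+i)) = (2*m - (m+i)) * ((2*m) choose (m+i))"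
      by (metis binomial_absorb_comp binomial_absorption)
    then have "real (Suc (m+i)) * real ((2*m) choose Suc (m+i)) = real (m - i) * real ((2*m) choose (m+i))"
      by (metis (no_types, lifting) diff_diff_left mult_2 diff_add_inverse of_nat_mult)
    then have "real ((2*m) choose Suc (m+i))
        = (real m - real i) * real ((2*m) choose (m+i)) / (real m + real i + 1)"
      using that by (simp add: field_simps of_nat_diff)
    then show ?thesis
      by (simp add: q_def mult.commute)
  qed
  have q_prod: "q j = (\<Prod>i=1..j. (real m - real i + 1) / (real m + real i))" if "j \<le> m" for j
    using that
  proof (induction j)
    case 0
    then show ?case by (simp add: q_def)
  next
    case (Suc j)
    then show ?case using step[of j] by (simp add: algebra_simps)
  qed
  show "q j \<le> exp (- (real j ^ 2) / real (m + j))" for j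
  proof (cases "j \<le> m")
    case True
    have "q j \<le> (\<Prod>i=1..j. exp (- (2 * real i - 1) / real (m + j)))"
      unfolding q_prod[OF True]
    proof (intro prod_mono conjI)
      fix i assume i: "i \<in> {1..j}"
      then show "0 \<le> (real m - real i + 1) / (real m + real i)" using True by simp
      have "(real m - real i + 1) / (real m + real i) = 1 + - (2 * real i - 1) / real (m + i)"
        using i by (simp add: field_simps)
      also have "\<dots> \<le> exp (- (2 * real i - 1) / real (m + i))"
        by (rule exp_ge_add_one_self)
      also have "\<dots> \<le> exp (- (2 * real i - 1) / real (m + j))"
      proof -
        have "(2 * real i - 1) / real (m + j) \<le> (2 * real i - 1) / real (m + i)"
          using i by (intro divide_left_mono) auto
        then show ?thesis by (simp only: minus_divide_left[symmetric] exp_le_cancel_iff neg_le_iff_le)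
      qed
      finally show "(real m - real i + 1) / (real m + real i) \<le> exp (- (2 * real i - 1) / real (m + j))" .
    qed
    also have "\<dots> = exp (- (real j ^ 2) / real (m + j))"
      by (subst exp_sum[symmetric]) (simp_all only: sq finite_atLeastAtMost)
    finally show ?thesis .
  next
    case False
    then show ?thesis by (simp add: q_def binomial_eq_0)
  qed
  show "exp (- (real j ^ 2) / real (m - j + 1)) \<le> q j" if "j \<le> m" for j
  proof -
    have "exp (- (real j ^ 2) / real (m - j + 1)) = (\<Prod>i=1..j. exp (- (2 * real i - 1) / real (m - j + 1)))"
      by (subst exp_sum[symmetric]) (simp_all only: sq finite_atLeastAtMost)
    also have "\<dots> \<le> q j"
      unfolding q_prod[OF that]
    proof (intro prod_mono conjI)
      fix i assume i: "i \<in> {1..j}"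
      have pos: "real m - real i + 1 > 0" using i that by simp
      have "(real m + real i) / (real m - real i + 1) = 1 + (2 * real i - 1) / (real m - real i + 1)"
        using pos by (simp add: field_simps)
      also have "\<dots> \<le> exp ((2 * real i - 1) / (real m - real i + 1))"
        by (rule exp_ge_add_one_self)
      also have "\<dots> \<le> exp ((2 * real i - 1) / real (m - j + 1))"
        using i that pos by (auto intro!: divide_left_mono simp: of_nat_diff)
      finally have "inverse (exp ((2 * real i - 1) / real (m - j + 1)))
          \<le> inverse ((real m + real i) / (real m - real i + 1))"
        using i pos by (intro le_imp_inverse_le) auto
      then show "exp (- (2 * real i - 1) / real (m - j + 1)) \<le> (real m - real i + 1) / (real m + real i)"
        by (simp only: exp_minus[symmetric] minus_divide_left inverse_divide)
    qed auto
    finally show ?thesis .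
  qed
qed

text \<open>With \<open>b m\<close> the normalised central binomial coefficient, the Wallis product
  up to \<open>m\<close> equals exactly 1 / ((2 m + 1) (b m)^2); its limit pi/2 thus determines the
  limit of m (b m)^2.\<close>

lemma central_binomial_asymptotics:
  "(\<lambda>m. sqrt (real m) * real ((2*m) choose m) / 4 ^ m) \<longlonglongrightarrow> 1 / sqrt pi"
proof -
  define b where "b m = real ((2*m) choose m) / 4 ^ m" for m
  have b0: "b m > 0" for m by (simp add: b_def)
  have bS: "b (Suc m) = b m * ((2 * real m + 1) / (2 * real m + 2))" for m
  proof -
    have "Suc m * ((2 * Suc m) choose Suc m) = 2 * (2*m+1) * ((2*m) choose m)"
    proof -
      have "Suc m * ((2 * Suc m) choose Suc m) = (2 * Suc m) * ((2*m+1) choose m)"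
        by (metis Suc_times_binomial_eq add.commute add_Suc_right mult_2 mult_Suc_right plus_1_eq_Suc binomial_absorption diff_Suc_1 mult.commute)
      moreover have "Suc m * ((2*m+1) choose m) = (2*m+1) * ((2*m) choose m)"
        using binomial_absorb_comp[of "2*m+1" m] by simp
      ultimately show ?thesis by (metis mult.assoc mult.left_commute)
    qed
    then have "real (Suc m) * real ((2 * Suc m) choose Suc m) = 2 * (2 * real m + 1) * real ((2*m) choose m)"
      by (metis (mono_tags, lifting) of_nat_1 of_nat_add of_nat_mult of_nat_numeral)
    then have "real ((2 * Suc m) choose Suc m) = 2 * (2 * real m + 1) * real ((2*m) choose m) / (real m + 1)"
      by (simp add: field_simps del: binomial_Suc_Suc mult_Suc_right)
    moreover have "2 * (2 * real m + 1) * B / (real m + 1) / 4 ^ Suc m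
        = B / 4 ^ m * ((2 * real m + 1) / (2 * real m + 2))" for B
      by (simp add: divide_simps) (simp add: algebra_simps)
    ultimately show ?thesis unfolding b_def by presburger
  qed
  have prod: "(\<Prod>k=1..m. (4*real k^2) / (4*real k^2 - 1)) = 1 / ((2 * real m + 1) * b m ^ 2)" for m
  proof (induction m)
    case 0
    then show ?case by (simp add: b_def)
  next
    case (Suc m)
    have *: "4 * real (Suc m) ^ 2 - 1 = (2 * real m + 1) * (2 * real m + 3)"
            "4 * real (Suc m) ^ 2 = (2 * real m + 2) ^ 2"
      by (simp_all add: power2_eq_square algebra_simps)
    show ?case
      using Suc b0[of m] by (simp add: bS * field_simps power2_eq_square)
  qed
  have "(\<lambda>m. sqrt ((real m / (2 * real m + 1)) * inverse (1 / ((2 * real m + 1) * b m ^ 2))))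
          \<longlonglongrightarrow> sqrt (1/2 * inverse (pi/2))"
  proof (intro tendsto_real_sqrt tendsto_mult tendsto_inverse)
    show "(\<lambda>m. 1 / ((2 * real m + 1) * b m ^ 2)) \<longlonglongrightarrow> pi / 2"
      using wallis unfolding prod .
    show "(\<lambda>m. real m / (2 * real m + 1)) \<longlonglongrightarrow> 1/2" by real_asymp
  qed simp
  moreover have "sqrt ((real m / (2 * real m + 1)) * inverse (1 / ((2 * real m + 1) * b m ^ 2)))
      = sqrt (real m) * b m" for m
  proof -
    have "(real m / (2 * real m + 1)) * inverse (1 / ((2 * real m + 1) * b m ^ 2)) = real m * b m ^ 2"
      by (simp add: field_simps)
    then show ?thesis using b0[of m] by (simp add: real_sqrt_mult)
  qed
  ultimately show ?thesis by (simp add: b_def real_sqrt_divide inverse_eq_divide)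
qed

text \<open>\<open>exp (x^2/2) * cos x\<close> decreases because x cos x <= sin x. The bound serves
  to dominate cosine powers uniformly while their exponents tend to infinity.\<close>

lemma cos_le_exp_quadratic:
  fixes x :: real
  assumes "0 \<le> x" "x \<le> pi/2"
  shows "cos x \<le> exp (- (x^2) / 2)"
proof -
  have sin_ge: "y * cos y \<le> sin y" if "0 \<le> y" "y \<le> pi/2" for y :: real
  proof -
    have "sin 0 - 0 * cos 0 \<le> sin y - y * cos y"
    proof (rule DERIV_nonneg_imp_nondecreasing[OF that(1)])
      fix t assume t: "0 \<le> t" "t \<le> y"
      have "((\<lambda>y. sin y - y * cos y) has_real_derivative t * sin t) (at t)"
        by (auto intro!: derivative_eq_intros)
      moreover have "sin t \<ge> 0" using t that pi_gt_zero by (intro sin_ge_zero) linarith+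
      ultimately show "\<exists>y. ((\<lambda>y. sin y - y * cos y) has_real_derivative y) (at t) \<and> y \<ge> 0"
        using t by (intro exI[of _ "t * sin t"]) auto
    qed
    then show ?thesis by simp
  qed
  have "exp (x^2/2) * cos x \<le> exp (0^2/2) * cos 0"
  proof (rule DERIV_nonpos_imp_nonincreasing[OF assms(1)])
    fix t assume t: "0 \<le> t" "t \<le> x"
    have "((\<lambda>x. exp (x^2/2) * cos x) has_real_derivative exp (t^2/2) * (t * cos t - sin t)) (at t)"
      by (auto intro!: derivative_eq_intros simp: algebra_simps)
    moreover have "exp (t^2/2) * (t * cos t - sin t) \<le> 0"
      using sin_ge[of t] t assms by (intro mult_nonneg_nonpos) auto
    ultimately show "\<exists>y. ((\<lambda>x. exp (x^2/2) * cos x) has_real_derivative y) (at t) \<and> y \<le> 0" by blast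
  qed
  then show ?thesis by (simp add: exp_minus field_simps)
qed

lemma summable_exp_linear:
  fixes c :: real
  assumes "c > 0"
  shows "summable (\<lambda>n. exp (- (c * real (n + 1))))"
proof -
  have "summable (\<lambda>n. exp (-c) * exp (-c) ^ n)"
    using assms by (intro summable_mult summable_geometric) simp
  moreover have "exp (-c) * exp (-c) ^ n = exp (- (c * real (n + 1)))" for n
    by (simp add: exp_of_nat_mult[symmetric] exp_add[symmetric] algebra_simps flip: exp_minus)
  ultimately show ?thesis by simp
qed

lemma exp_square_le_linear:
  fixes c :: real
  assumes "c \<ge> 0"
  shows "exp (- (c * real (n + 1) ^ 2)) \<le> exp (- (c * real (n + 1)))"
  using assms by (auto intro!: mult_left_mono simp: power2_eq_square)

text \<open>Summing \<open>(2 cos x)^(2m)\<close> over the \<open>l\<close>-th roots of unity and letting \<open>m / l\<^sup>2 \<rightarrow> c\<close>.\<close>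

lemma jacobi_theta_transformation_limit:
  fixes c :: real
  assumes c: "c > 0"
  shows "1 + 2 * (\<Sum>v. exp (- (pi^2 * c * real (v+1)^2)))
       = 1 / sqrt (pi * c) * (1 + 2 * (\<Sum>i. exp (- (real (i+1)^2 / c))))"
proof -
  define l where "l n = 2 * n + (1::nat)" for n
  \<comment> \<open>This is the scale on which cosine powers and binomial ratios become Gaussian
    simultaneously.\<close>
  define m where "m n = nat \<lfloor>c * real (l n)^2\<rfloor>" for n
  have l0: "real (l n) > 0" for n by (simp add: l_def)
  have m_le: "real (m n) \<le> c * real (l n)^2" for n
    using c by (simp add: m_def of_nat_nat)
  have lim_m: "(\<lambda>n. real (m n) / real (l n)^2) \<longlonglongrightarrow> c"
  proof -
    have "(\<lambda>n. real_of_int \<lfloor>c * (2 * real n + 1)^2\<rfloor> / (2 * real n + 1)^2) \<longlonglongrightarrow> c"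
      using c by real_asymp
    moreover have "real (m n) = real_of_int \<lfloor>c * (2 * real n + 1)^2\<rfloor>" for n
      using c by (simp add: m_def l_def of_nat_nat add.commute)
    ultimately show ?thesis by (simp add: l_def add.commute)
  qed
  have ev_m: "\<forall>\<^sub>F n in sequentially. c/2 * real (l n)^2 \<le> real (m n)"
    using order_tendstoD(1)[OF lim_m, of "c/2"] c
    by (auto elim!: eventually_mono simp: field_simps l_def)

  \<comment> \<open>Truncation at \<open>v < n\<close> turns the finite sum into a series over a
    fixed index set, as Tannery's theorem requires; \<open>n\<close> is the \<open>p\<close> of the
    finite identity.\<close>
  define A where "A v n = (if v < n then cos (pi * real (v+1) / real (l n)) ^ (2 * m n) else 0)" for v n
  have A_lim: "(\<lambda>n. A v n) \<longlonglongrightarrow> exp (- (pi^2 * c * real (v+1)^2))" for v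
  proof -
    define y where "y = pi * real (v+1)"
    have y: "y > 0" by (simp add: y_def)
    \<comment> \<open>ln (cos h) = - h^2/2 + o(h^2) at h = y / l; the exponent
      \<open>2 * m n\<close> turns this into the limit - c y^2.\<close>
    have "(\<lambda>n. ln (cos (y / (2 * real n + 1))) * (2 * real n + 1)^2) \<longlonglongrightarrow> - (y^2) / 2"
      using y by (real_asymp simp: power2_eq_square)
    then have "(\<lambda>n. exp (2 * (real (m n) / real (l n)^2 * (ln (cos (y / real (l n))) * real (l n)^2))))
       \<longlonglongrightarrow> exp (2 * (c * (- (y^2) / 2)))"
      by (intro tendsto_intros lim_m) (simp add: l_def add.commute)
    moreover have "\<forall>\<^sub>F n in sequentially.
       exp (2 * (real (m n) / real (l n)^2 * (ln (cos (y / real (l n))) * real (l n)^2))) = A v n"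
      using eventually_gt_at_top[of v]
    proof eventually_elim
      case (elim n)
      have "pi * (2 * real (v+1)) < pi * real (l n)"
        using elim by (intro mult_strict_left_mono) (auto simp: l_def)
      then have "y / real (l n) < pi / 2" "y / real (l n) > 0"
        using y l0[of n] by (auto simp: y_def field_simps)
      then have "cos (y / real (l n)) > 0" by (intro cos_gt_zero) auto
      then have "exp (real (2 * m n) * ln (cos (y / real (l n)))) = cos (y / real (l n)) ^ (2 * m n)"
        by (simp only: exp_of_nat_mult exp_ln)
      then show ?case using elim l0[of n] by (simp add: A_def y_def mult.assoc)
    qed
    ultimately have "(\<lambda>n. A v n) \<longlonglongrightarrow> exp (2 * (c * (- (y^2) / 2)))"
      using Lim_transform_eventually by blast
    then show ?thesis by (simp add: y_def power_mult_distrib mult_ac)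
  qed
  have A_bound: "\<forall>\<^sub>F (v, n) in at_top \<times>\<^sub>F sequentially. norm (A v n) \<le> exp (- ((c * pi^2/2) * real (v+1)))"
  proof (rule eventually_mono[OF eventually_prodI[OF always_eventually ev_m]])
    fix x :: "nat \<times> nat"
    assume x: "True \<and> c/2 * real (l (snd x))^2 \<le> real (m (snd x))"
    obtain v n where vn: "x = (v, n)" by force
    have "norm (A v n) \<le> exp (- ((c * pi^2/2) * real (v+1)))"
    proof (cases "v < n")
      case True
      define z where "z = pi * real (v+1) / real (l n)"
      \<comment> \<open>2 (v + 1) <= l keeps the angle in [0, pi/2], where the Gaussian bound for
        the cosine holds.\<close>
      have "pi * (2 * real (v+1)) \<le> pi * real (l n)"
        using True by (intro mult_left_mono) (auto simp: l_def)
      then have z: "0 \<le> z" "z \<le> pi/2" using l0[of n] by (auto simp: z_def field_simps)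
      have cz: "cos z \<ge> 0" using z by (intro cos_ge_zero) auto
      have "A v n = cos z ^ (2 * m n)" using True by (simp add: A_def z_def)
      also have "\<dots> \<le> exp (- (z^2) / 2) ^ (2 * m n)"
        by (intro power_mono cos_le_exp_quadratic z cz)
      also have "\<dots> = exp (- (real (m n) * z^2))"
        by (simp flip: exp_of_nat_mult)
      also have "\<dots> \<le> exp (- ((c/2 * real (l n)^2) * z^2))"
      proof -
        have "(c/2 * real (l n)^2) * z^2 \<le> real (m n) * z^2"
          using x vn by (intro mult_right_mono) auto
        then show ?thesis by simp
      qed
      also have "(c/2 * real (l n)^2) * z^2 = (c * pi^2/2) * real (v+1)^2"
        using l0[of n] by (simp add: z_def field_simps power2_eq_square)
      also have "exp (- \<dots>) \<le> exp (- ((c * pi^2/2) * real (v+1)))"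
        using c by (intro exp_square_le_linear) auto
      finally show ?thesis using cz True by (simp add: A_def z_def)
    qed (simp add: A_def)
    then show "case x of (v, n) \<Rightarrow> norm (A v n) \<le> exp (- ((c * pi^2/2) * real (v+1)))"
      by (simp add: vn)
  qed simp
  have A_sum: "(\<lambda>n. \<Sum>v. A v n) \<longlonglongrightarrow> (\<Sum>v. exp (- (pi^2 * c * real (v+1)^2)))"
    using tannerys_theorem[OF A_lim A_bound summable_exp_linear] c by simp
  have A_fin: "(\<Sum>v. A v n) = (\<Sum>v=1..n. cos (pi * real v / real (l n)) ^ (2 * m n))" for n
  proof -
    have "(\<Sum>v. A v n) = (\<Sum>v<n. A v n)"
      by (rule suminf_finite) (auto simp: A_def)
    also have "\<dots> = (\<Sum>v=1..n. cos (pi * real v / real (l n)) ^ (2 * m n))"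
      by (rule sum.reindex_bij_witness[of _ "\<lambda>v. v - 1" "\<lambda>v. v + 1"]) (auto simp: A_def)
    finally show ?thesis .
  qed

  define q where "q n j = real ((2 * m n) choose (m n + j)) / real ((2 * m n) choose m n)" for n j
  define B where "B i n = q n (l n * (i+1))" for i n
  have B_lim: "(\<lambda>n. B i n) \<longlonglongrightarrow> exp (- (real (i+1)^2 / c))" for i
  proof -
    define w where "w = real (i+1)"
    have w: "w > 0" by (simp add: w_def)
    define t where "t n = real (m n) / real (l n)^2" for n
    have t: "t \<longlonglongrightarrow> c" using lim_m by (simp add: t_def[abs_def])
    define u where "u n = 1 / real (l n)" for n
    have u: "u \<longlonglongrightarrow> 0" unfolding u_def[abs_def] l_def by real_asymp
    have ev_j: "\<forall>\<^sub>F n in sequentially. l n * (i+1) \<le> m n"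
    proof -
      have "\<forall>\<^sub>F n in sequentially. w * u n < c/2"
        using c by (intro order_tendstoD(2)[OF tendsto_mult_right_zero[OF u]]) auto
      with ev_m show ?thesis
      proof eventually_elim
        case (elim n)
        have "real (l n * (i+1)) = w * u n * real (l n)^2"
          using l0[of n] by (simp add: u_def w_def power2_eq_square field_simps)
        also have "\<dots> \<le> c/2 * real (l n)^2" using elim by (intro mult_right_mono) auto
        also have "\<dots> \<le> real (m n)" by fact
        finally show ?case by linarith
      qed
    qed
    \<comment> \<open>Divided by (l n)^2, the denominators \<open>m n + j\<close> and
      \<open>m n - j + 1\<close> of the two binomial bounds both tend to c, while the numerator
      becomes w^2.\<close>
    show ?thesis
    proof (rule tendsto_sandwich)
      show "(\<lambda>n. exp (- (w^2 / (t n - w * u n + u n^2)))) \<longlonglongrightarrow> exp (- (real (i+1)^2 / c))"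
        using c by (auto intro!: tendsto_eq_intros t u simp: w_def)
      show "(\<lambda>n. exp (- (w^2 / (t n + w * u n)))) \<longlonglongrightarrow> exp (- (real (i+1)^2 / c))"
        using c by (auto intro!: tendsto_eq_intros t u simp: w_def)
      show "\<forall>\<^sub>F n in sequentially. B i n \<le> exp (- (w^2 / (t n + w * u n)))"
      proof (rule always_eventually, rule allI)
        fix n
        have "B i n \<le> exp (- (real (l n * (i+1)) ^ 2) / real (m n + l n * (i+1)))"
          unfolding B_def q_def by (rule central_binomial_ratio_bounds)
        also have "real (l n * (i+1)) ^ 2 = w^2 * real (l n)^2"
          unfolding w_def of_nat_mult power_mult_distrib by (rule mult.commute)
        also have "real (m n + l n * (i+1)) = (t n + w * u n) * real (l n)^2"
          using l0[of n] by (simp add: u_def t_def w_def field_simps power2_eq_square)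
        finally show "B i n \<le> exp (- (w^2 / (t n + w * u n)))"
          using l0[of n] by simp
      qed
      show "\<forall>\<^sub>F n in sequentially. exp (- (w^2 / (t n - w * u n + u n^2))) \<le> B i n"
        using ev_j
      proof eventually_elim
        case (elim n)
        have "real (l n * (i+1)) ^ 2 = w^2 * real (l n)^2"
          unfolding w_def of_nat_mult power_mult_distrib by (rule mult.commute)
        moreover have "real (m n - l n * (i+1) + 1) = (t n - w * u n + u n^2) * real (l n)^2"
        proof -
          have "real (m n - l n * (i+1) + 1) = real (m n) - real (l n) * w + 1"
            using elim by (simp only: of_nat_add of_nat_diff[OF elim] of_nat_mult w_def of_nat_1)
          also have "real (m n) = t n * real (l n)^2" using l0[of n] by (simp add: t_def)
          also have "t n * real (l n)^2 - real (l n) * w + 1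
              = (t n - w * u n + u n^2) * real (l n)^2"
          proof -
            have ul: "u n * real (l n) = 1" using l0[of n] by (simp add: u_def)
            have "(t n - w * u n + u n^2) * real (l n)^2
              = t n * real (l n)^2 - w * (u n * real (l n)) * real (l n) + (u n * real (l n))^2"
              by (simp add: algebra_simps power2_eq_square)
            then show ?thesis by (simp only: ul) simp
          qed
          finally show ?thesis .
        qed
        ultimately show ?case
          using central_binomial_ratio_bounds(2)[OF elim] l0[of n] by (simp add: B_def q_def)
      qed
    qed
  qed
  \<comment> \<open>Domination for the dual series rests on the upper bound for \<open>m n\<close>:
    if j <= m, then m + j <= 2 m <= 2 c l^2; larger j contribute nothing.\<close>
  have B_le: "norm (B i n) \<le> exp (- ((1/(2*c)) * real (i+1)))" for i n
  proof (cases "l n * (i+1) \<le> m n")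
    case True
    have m0: "real (m n) > 0" using True l0[of n] by (cases "m n") auto
    have "norm (B i n) = B i n" by (simp add: B_def q_def)
    also have "\<dots> \<le> exp (- (real (l n * (i+1)) ^ 2) / real (m n + l n * (i+1)))"
      unfolding B_def q_def by (rule central_binomial_ratio_bounds)
    also have "\<dots> \<le> exp (- (real (l n * (i+1)) ^ 2) / (2 * real (m n)))"
    proof -
      have "real (m n + l n * (i+1)) \<le> 2 * real (m n)" using True by linarith
      then have "real (l n * (i+1)) ^ 2 / (2 * real (m n)) \<le> real (l n * (i+1)) ^ 2 / real (m n + l n * (i+1))"
        using m0 by (intro divide_left_mono mult_pos_pos) (auto intro!: add_pos_nonneg)
      then show ?thesis by simp
    qed
    also have "\<dots> \<le> exp (- (real (l n * (i+1)) ^ 2) / (2 * (c * real (l n)^2)))"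
    proof -
      have "real (l n * (i+1)) ^ 2 / (2 * (c * real (l n)^2)) \<le> real (l n * (i+1)) ^ 2 / (2 * real (m n))"
        using m_le[of n] m0 c l0[of n] by (intro divide_left_mono mult_pos_pos) auto
      then show ?thesis by simp
    qed
    also have "- (real (l n * (i+1)) ^ 2) / (2 * (c * real (l n)^2)) = - ((1/(2*c)) * real (i+1)^2)"
      using l0[of n] c by (simp add: field_simps power2_eq_square)
    also have "exp \<dots> \<le> exp (- ((1/(2*c)) * real (i+1)))"
      using c by (intro exp_square_le_linear) auto
    finally show ?thesis .
  next
    case False
    then show ?thesis by (simp add: B_def q_def binomial_eq_0)
  qed
  have B_bound: "\<forall>\<^sub>F (i, n) in at_top \<times>\<^sub>F sequentially. norm (B i n) \<le> exp (- ((1/(2*c)) * real (i+1)))"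
    using B_le by (intro always_eventually) auto
  have B_sum: "(\<lambda>n. \<Sum>i. B i n) \<longlonglongrightarrow> (\<Sum>i. exp (- (real (i+1)^2 / c)))"
    using tannerys_theorem[OF B_lim B_bound summable_exp_linear] c by simp
  have B_fin: "(\<Sum>i. B i n) = (\<Sum>i=1..m n. q n (l n * i))" for n
  proof -
    have "(\<Sum>i. B i n) = (\<Sum>i<m n. B i n)"
    proof (rule suminf_finite)
      fix i assume "i \<notin> {..<m n}"
      then have "m n < l n * (i+1)" by (simp add: l_def)
      then show "B i n = 0" by (simp add: B_def q_def binomial_eq_0)
    qed simp
    also have "\<dots> = (\<Sum>i=1..m n. q n (l n * i))"
      by (rule sum.reindex_bij_witness[of _ "\<lambda>v. v - 1" "\<lambda>v. v + 1"]) (auto simp: B_def)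
    finally show ?thesis .
  qed

  \<comment> \<open>The prefactor is l / sqrt m times sqrt m times the normalised central binomial
    coefficient; the limits are 1 / sqrt c and 1 / sqrt pi.\<close>
  define D where "D n = real (l n) * real ((2 * m n) choose m n) / 4 ^ m n" for n
  have D_lim: "D \<longlonglongrightarrow> 1 / sqrt (pi * c)"
  proof -
    have m_inf: "filterlim m at_top sequentially"
    proof -
      have "filterlim (\<lambda>n. real (m n)) at_top sequentially"
      proof (rule filterlim_at_top_mono[OF _ ev_m])
        show "filterlim (\<lambda>n. c / 2 * real (l n)^2) at_top sequentially"
          unfolding l_def using c by real_asymp
      qed
      then show ?thesis by (simp add: filterlim_sequentially_iff_filterlim_real)
    qed
    have "(\<lambda>n. inverse (sqrt (real (m n) / real (l n)^2)) * (sqrt (real (m n)) * real ((2 * m n) choose m n) / 4 ^ m n))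
        \<longlonglongrightarrow> inverse (sqrt c) * (1 / sqrt pi)"
      using c by (intro tendsto_intros lim_m filterlim_compose[OF central_binomial_asymptotics m_inf]) auto
    moreover have "\<forall>\<^sub>F n in sequentially.
        inverse (sqrt (real (m n) / real (l n)^2)) * (sqrt (real (m n)) * real ((2 * m n) choose m n) / 4 ^ m n) = D n"
      using ev_m
    proof eventually_elim
      case (elim n)
      have "c/2 * real (l n)^2 > 0" using c l0[of n] by simp
      then have "real (m n) > 0" using elim by linarith
      then show ?case using l0[of n] by (simp add: D_def real_sqrt_divide field_simps)
    qed
    ultimately show ?thesis
      using Lim_transform_eventually c by (fastforce simp: real_sqrt_mult field_simps)
  qed

  have id: "1 + 2 * (\<Sum>v. A v n) = D n * (1 + 2 * (\<Sum>i. B i n))" for n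
    unfolding A_fin B_fin D_def q_def l_def by (rule finite_theta_identity)
  have "(\<lambda>n. 1 + 2 * (\<Sum>v. A v n)) \<longlonglongrightarrow> 1 + 2 * (\<Sum>v. exp (- (pi^2 * c * real (v+1)^2)))"
    by (intro tendsto_intros A_sum)
  moreover have "(\<lambda>n. 1 + 2 * (\<Sum>v. A v n)) \<longlonglongrightarrow> 1 / sqrt (pi * c) * (1 + 2 * (\<Sum>i. exp (- (real (i+1)^2 / c))))"
    unfolding id by (intro tendsto_intros D_lim B_sum)
  ultimately show ?thesis by (rule LIMSEQ_unique)
qed

definition theta :: "real \<Rightarrow> real" where
  "theta s = 1 + 2 * (\<Sum>n. exp (- (pi * real (n+1)^2 * s)))"

lemma theta_inverse:
  assumes "s > 0"
  shows "theta (1/s) = sqrt s * theta s"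
proof -
  \<comment> \<open>c = s / pi makes both exponentials those of \<open>theta\<close>, at
    \<open>s\<close> and at \<open>1/s\<close>.\<close>
  have "theta s = 1 / sqrt s * theta (1/s)"
    using jacobi_theta_transformation_limit[of "s/pi"] assms
    by (simp add: theta_def power2_eq_square mult_ac)
  then show ?thesis using assms by (simp add: field_simps)
qed

section \<open>Improper integrals\<close>

text \<open>For nonnegative functions gauge integrability coincides with absolute integrability, so
  the substitution rule for absolute integrals becomes an equivalence that carries existence and
  value in both directions.\<close>

lemma has_integral_change_of_variables_nonneg:
  fixes f g :: "real \<Rightarrow> real"
  assumes S: "S \<in> sets lebesgue"
    and g: "\<And>x. x \<in> S \<Longrightarrow> (g has_field_derivative g' x) (at x within S)"
    and inj: "inj_on g S" and T: "g ` S = T"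
    and nonneg: "\<And>y. y \<in> T \<Longrightarrow> f y \<ge> 0"
  shows "((\<lambda>x. \<bar>g' x\<bar> * f (g x)) has_integral I) S \<longleftrightarrow> (f has_integral I) T"
proof -
  have "((\<lambda>x. \<bar>g' x\<bar> * f (g x)) has_integral I) S \<longleftrightarrow>
     (\<lambda>x. \<bar>g' x\<bar> * f (g x)) absolutely_integrable_on S \<and> integral S (\<lambda>x. \<bar>g' x\<bar> * f (g x)) = I"
    using nonneg T by (auto simp: has_integral_iff set_lebesgue_integral_eq_integral(1)
        intro!: nonnegative_absolutely_integrable_1 mult_nonneg_nonneg)
  also have "\<dots> \<longleftrightarrow> f absolutely_integrable_on T \<and> integral T f = I"
    using has_absolute_integral_change_of_variables_1'[OF S g inj, of f I] T by simp
  also have "\<dots> \<longleftrightarrow> (f has_integral I) T"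
    using nonneg by (auto simp: has_integral_iff set_lebesgue_integral_eq_integral(1)
        intro!: nonnegative_absolutely_integrable_1)
  finally show ?thesis .
qed

lemma has_integral_inversion:
  fixes f :: "real \<Rightarrow> real"
  assumes "\<And>x. 0 < x \<Longrightarrow> x \<le> 1 \<Longrightarrow> f x \<ge> 0"
  shows "((\<lambda>s. f (1/s) / s\<^sup>2) has_integral I) {1..} \<longleftrightarrow> (f has_integral I) {0<..1}"
proof -
  have *: "((\<lambda>x. \<bar>- (1 / x\<^sup>2)\<bar> * f (1/x)) has_integral I) {1..} \<longleftrightarrow> (f has_integral I) {0<..1}"
  proof (rule has_integral_change_of_variables_nonneg)
    fix x :: real assume "x \<in> {1..}"
    then show "((\<lambda>x. 1/x) has_field_derivative - (1 / x\<^sup>2)) (at x within {1..})"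
      by (auto intro!: derivative_eq_intros simp: power2_eq_square field_simps)
  next
    show "(\<lambda>x. 1 / x) ` {1..} = {0<..(1::real)}"
    proof (intro equalityI subsetI)
      fix y :: real assume "y \<in> {0<..1}"
      then have "y = 1 / (1/y)" "1/y \<in> {1..}" by auto
      then show "y \<in> (\<lambda>x. 1 / x) ` {1..}" by blast
    qed auto
  qed (use assms in \<open>auto simp: inj_on_def\<close>)
  show ?thesis unfolding *[symmetric] by (rule has_integral_cong) auto
qed

lemma has_integral_scale:
  fixes f :: "real \<Rightarrow> real"
  assumes c: "c > 0" and f: "\<And>x. x > 0 \<Longrightarrow> f x \<ge> 0"
  shows "((\<lambda>s. c * f (c * s)) has_integral I) {0<..} \<longleftrightarrow> (f has_integral I) {0<..}"
proof -
  have *: "((\<lambda>x. \<bar>c\<bar> * f (c * x)) has_integral I) {0<..} \<longleftrightarrow> (f has_integral I) {0<..}"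
  proof (rule has_integral_change_of_variables_nonneg)
    fix x :: real
    show "((\<lambda>x. c * x) has_field_derivative c) (at x within {0<..})"
      by (auto intro!: derivative_eq_intros)
  next
    show "(\<lambda>x. c * x) ` {0<..} = {0<..}"
    proof (intro equalityI subsetI)
      fix y :: real assume "y \<in> {0<..}"
      then have "y = c * (y/c)" "y/c \<in> {0<..}" using c by auto
      then show "y \<in> (\<lambda>x. c * x) ` {0<..}" by blast
    qed (use c in auto)
  qed (use c f in \<open>auto simp: inj_on_def\<close>)
  then show ?thesis using c by simp
qed

text \<open>The singularity at 0 is moved to infinity by s -> 1/s. For integrands built from theta
  both halves then live on \<open>{1..}\<close>, where theta - 1 decays exponentially.\<close>

lemma has_integral_split_at_1:
  fixes f :: "real \<Rightarrow> real"
  assumes f: "\<And>x. 0 < x \<Longrightarrow> x \<le> 1 \<Longrightarrow> f x \<ge> 0"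
    and I: "((\<lambda>s. f (1/s) / s\<^sup>2) has_integral I) {1..}" and J: "(f has_integral J) {1..}"
  shows "(f has_integral I + J) {0<..}"
proof -
  have "{0<..1} \<inter> {1..} = {1::real}" by auto
  moreover have "{0<..1} \<union> {1..} = {0::real<..}" by auto
  moreover have "(f has_integral I) {0<..1}"
    using I has_integral_inversion[of f I, OF f] by blast
  ultimately show ?thesis
    using has_integral_Un[of f I "{0<..1}" J "{1..}"] J by simp
qed

lemma integrable_on_continuous_dominated:
  fixes f g :: "real \<Rightarrow> real"
  assumes "continuous_on S f" "S \<in> sets lebesgue" "g integrable_on S"
    and "\<And>x. x \<in> S \<Longrightarrow> \<bar>f x\<bar> \<le> g x"
  shows "f integrable_on S"
  using assms
  by (intro measurable_bounded_by_integrable_imp_integrable[of f S g])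
     (auto intro: continuous_imp_measurable_on_sets_lebesgue)

lemma has_integral_sums_nonneg:
  fixes f :: "nat \<Rightarrow> real \<Rightarrow> real"
  assumes f: "\<And>n. (f n has_integral I n) S" and nonneg: "\<And>n x. x \<in> S \<Longrightarrow> f n x \<ge> 0"
    and g: "\<And>x. x \<in> S \<Longrightarrow> (\<lambda>n. f n x) sums g x" and I: "I sums J"
  shows "(g has_integral J) S"
proof (rule has_integral_monotone_convergence_increasing)
  show "((\<lambda>x. \<Sum>n<N. f n x) has_integral (\<Sum>n<N. I n)) S" for N
    by (intro has_integral_sum f) auto
qed (use nonneg g I in \<open>auto simp: sums_def\<close>)

text \<open>A converse of monotone convergence: the integral of the sum bounds all partial sums of
  the integrals, so their convergence is a conclusion. The series for \<open>zeta_r\<close>, for the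
  logarithm of \<open>Phi\<close> and in \<open>side\<close> obtain their convergence from
  here.\<close>

lemma integrable_sums_nonneg:
  fixes f :: "nat \<Rightarrow> real \<Rightarrow> real"
  assumes f: "\<And>n. (f n has_integral I n) S" and nonneg: "\<And>n x. x \<in> S \<Longrightarrow> f n x \<ge> 0"
    and g: "\<And>x. x \<in> S \<Longrightarrow> (\<lambda>n. f n x) sums g x" and J: "(g has_integral J) S"
  shows "I sums J"
proof -
  have I0: "I n \<ge> 0" for n
    using f[of n] nonneg by (meson has_integral_nonneg)
  have partial: "((\<lambda>x. \<Sum>n<N. f n x) has_integral (\<Sum>n<N. I n)) S" for N
    by (intro has_integral_sum f) auto
  have "(\<Sum>n<N. I n) \<le> J" for N
  proof (rule has_integral_le[OF partial J])
    fix x assume x: "x \<in> S"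
    have "(\<Sum>n<N. f n x) \<le> (\<Sum>n. f n x)"
      using g[OF x] nonneg[OF x] by (intro sum_le_suminf) (auto simp: sums_iff)
    then show "(\<Sum>n<N. f n x) \<le> g x" using g[OF x] by (simp add: sums_iff)
  qed
  then have "summable I" by (intro summableI_nonneg_bounded[of I J] I0)
  then have "I sums suminf I" by (rule summable_sums)
  moreover from this have "(g has_integral suminf I) S"
    using has_integral_sums_nonneg f nonneg g by blast
  ultimately show ?thesis using J has_integral_unique by blast
qed

lemma has_integral_FTC_atLeast:
  fixes f F :: "real \<Rightarrow> real"
  assumes F: "\<And>x. x \<ge> a \<Longrightarrow> (F has_real_derivative f x) (at x)"
    and nonneg: "\<And>x. x \<ge> a \<Longrightarrow> f x \<ge> 0" and lim: "(F \<longlongrightarrow> L) at_top"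
  shows "(f has_integral (L - F a)) {a..}"
proof -
  have I: "(f has_integral (F y - F a)) {a..y}" if "y \<ge> a" for y
  proof (rule fundamental_theorem_of_calculus[OF that])
    fix x assume "x \<in> {a..y}"
    then have "(F has_real_derivative f x) (at x within {a..y})"
      by (auto intro: has_field_derivative_at_within[OF F])
    then show "(F has_vector_derivative f x) (at x within {a..y})"
      by (simp only: has_real_derivative_iff_has_vector_derivative)
  qed
  show ?thesis
  proof (rule has_integral_to_inf)
    show "f integrable_on {a..y}" for y
    proof (cases "y \<ge> a")
      case True
      then show ?thesis by (rule has_integral_integrable[OF I])
    qed auto
    have "((\<lambda>y. F y - F a) \<longlongrightarrow> L - F a) at_top" by (intro tendsto_intros lim)
    moreover have "\<forall>\<^sub>F y in at_top. F y - F a = integral {a..y} f"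
      using eventually_ge_at_top[of a]
      by (rule eventually_mono) (rule integral_unique[symmetric, OF I])
    ultimately show "((\<lambda>y. integral {a..y} f) \<longlongrightarrow> L - F a) at_top"
      by (rule Lim_transform_eventually)
  qed (rule nonneg)
qed

lemma has_integral_atLeast_greaterThan:
  fixes f :: "real \<Rightarrow> real"
  shows "(f has_integral I) {a..} \<longleftrightarrow> (f has_integral I) {a<..}"
  by (rule has_integral_spike_set_eq; rule negligible_subset[of "{a}"]) auto

lemma has_integral_Icc_Ioc:
  fixes f :: "real \<Rightarrow> real"
  shows "(f has_integral I) {a..b} \<longleftrightarrow> (f has_integral I) {a<..b}"
  by (rule has_integral_spike_set_eq; rule negligible_subset[of "{a}"]) auto

section \<open>Gamma, Bessel, digamma and exponential integrals\<close>

lemma has_integral_Gamma_scaled: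
  fixes a x :: real
  assumes "a > 0" "x > 0"
  shows "((\<lambda>s. exp (- (x * s)) * s powr (a - 1)) has_integral Gamma a / x powr a) {0<..}"
proof -
  have "((\<lambda>t. t powr (a - 1) / exp t) has_integral Gamma a) {0<..}"
    using Gamma_integral_real[OF assms(1)] by (simp add: has_integral_atLeast_greaterThan)
  then have "((\<lambda>s. x * ((x * s) powr (a - 1) / exp (x * s))) has_integral Gamma a) {0<..}"
    using assms by (subst has_integral_scale) auto
  then have "((\<lambda>s. (x * ((x * s) powr (a - 1) / exp (x * s))) / x powr a) has_integral Gamma a / x powr a) {0<..}"
    by (rule has_integral_divide)
  also have "?this \<longleftrightarrow> ((\<lambda>s. exp (- (x * s)) * s powr (a - 1)) has_integral Gamma a / x powr a) {0<..}"
    using assms by (intro has_integral_cong)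
      (auto simp: powr_mult powr_diff exp_minus field_simps)
  finally show ?thesis .
qed

text \<open>The substitution \<open>u = c (x + 1/x - 2)\<close> on \<open>{1<..}\<close> turns the folded integral into \<open>Gamma (1/2)\<close>.\<close>

lemma has_integral_bessel_half_aux:
  fixes c :: real
  assumes c: "c > 0"
  shows "((\<lambda>x. (x powr (-1/2) + x powr (-3/2)) * exp (- (c * (x + 1/x)))) has_integral
           sqrt (pi / c) * exp (- (2 * c))) {1..}"
    (is "(?h has_integral _) _")
proof -
  define g where "g x = c * (x + 1/x - 2)" for x :: real
  define f where "f u = u powr (-1/2) / exp u" for u :: real
  \<comment> \<open>Completing the square shows that \<open>g\<close> is nonnegative with its zero
    at x = 1, where the substitution starts.\<close>
  have g_eq: "g x = c * (sqrt x - 1 / sqrt x)^2" if "x > 0" for x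
    using that by (simp add: g_def power2_eq_square field_simps)
  have deriv: "(g has_field_derivative c * (1 - 1/x^2)) (at x)" if "x > 1" for x
    using that unfolding g_def
    by (auto intro!: derivative_eq_intros simp: power2_eq_square field_simps)
  have mono: "g x < g y" if "1 < x" "x < y" for x y
  proof (rule DERIV_pos_imp_increasing[OF that(2)])
    fix t assume "x \<le> t" "t \<le> y"
    then have "t > 1" using that by simp
    then have "c * (1 - 1/t^2) > 0" using c by (simp add: field_simps one_less_power)
    with deriv[OF \<open>t > 1\<close>] show "\<exists>y. (g has_real_derivative y) (at t) \<and> 0 < y" by blast
  qed
  have inj: "inj_on g {1<..}"
  proof (rule inj_onI)
    fix x y assume "x \<in> {1<..}" "y \<in> {1<..}" "g x = g y"
    then show "x = y" using mono[of x y] mono[of y x] by (cases x y rule: linorder_cases) auto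
  qed
  have img: "g ` {1<..} = {0<..}"
  proof (intro equalityI subsetI)
    fix u assume "u \<in> g ` {1<..}"
    then obtain x where "x > 1" "u = g x" by auto
    moreover from this have "sqrt x > 1" by simp
    then have "sqrt x - 1 / sqrt x > 0" by (simp add: field_simps less_1_mult)
    ultimately show "u \<in> {0<..}" using c by (simp add: g_eq)
  next
    fix u :: real assume u: "u \<in> {0<..}"
    define y where "y = sqrt (u / c)"
    have y: "y > 0" "y^2 = u / c" using u c by (auto simp: y_def)
    \<comment> \<open>\<open>z\<close> is the positive root of z - 1/z = y, so z^2 is the preimage
      of \<open>u\<close>.\<close>
    define z where "z = (y + sqrt (y^2 + 4)) / 2"
    have "sqrt (y^2 + 4) > 2" using y(1) by (intro real_less_rsqrt) auto
    then have z: "z > 1" using y by (simp add: z_def)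
    have "z^2 = y * z + 1" by (simp add: z_def power2_eq_square field_simps)
    then have "z - 1/z = y" using z by (simp add: field_simps power2_eq_square)
    moreover have "z^2 > 1" using z by (simp add: one_less_power)
    ultimately have "g (z^2) = u" using z y c g_eq[of "z^2"] by simp
    with \<open>z^2 > 1\<close> show "u \<in> g ` {1<..}" by auto
  qed
  have "(f has_integral sqrt pi) {0<..}"
    using Gamma_integral_real[of "1/2"]
    by (simp add: has_integral_atLeast_greaterThan f_def[abs_def] Gamma_one_half_real)
  moreover have "((\<lambda>x. \<bar>c * (1 - 1/x^2)\<bar> * f (g x)) has_integral sqrt pi) {1<..}
      \<longleftrightarrow> (f has_integral sqrt pi) {0<..}"
  proof (rule has_integral_change_of_variables_nonneg[where g' = "\<lambda>x. c * (1 - 1/x^2)"])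
    fix x :: real assume "x \<in> {1<..}"
    then show "(g has_real_derivative c * (1 - 1/x^2)) (at x within {1<..})"
      by (auto intro: has_field_derivative_at_within[OF deriv])
  qed (use inj img in \<open>simp_all add: f_def\<close>)
  ultimately have "((\<lambda>x. \<bar>c * (1 - 1/x^2)\<bar> * f (g x)) has_integral sqrt pi) {1<..}" by blast
  then have "((\<lambda>x. exp (- (2*c)) / sqrt c * (\<bar>c * (1 - 1/x^2)\<bar> * f (g x))) has_integral
      exp (- (2*c)) / sqrt c * sqrt pi) {1<..}"
    by (rule has_integral_mult_right)
  also have "?this \<longleftrightarrow> (?h has_integral
           exp (- (2*c)) / sqrt c * sqrt pi) {1<..}"
  proof (rule has_integral_cong)
    fix x :: real assume "x \<in> {1<..}"
    then have x: "x > 1" by simp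
    \<comment> \<open>In q = sqrt x the algebraic factors are rational, and the factor q - 1/q of
      the Jacobian cancels the one in \<open>f (g x)\<close>, which removes the singularity at x =
      1.\<close>
    define q where "q = sqrt x"
    have q: "q > 1" "x = q^2" using x by (auto simp: q_def)
    have d: "q - 1/q > 0" using q by (simp add: field_simps less_1_mult)
    have "g x = (sqrt c * (q - 1/q))^2" using c x by (simp add: g_eq q_def power_mult_distrib)
    moreover have "(y^2) powr (-1/2) = 1 / y" if "y > 0" for y :: real
      using that by (simp add: powr_minus powr_half_sqrt inverse_eq_divide)
    ultimately have fg: "f (g x) = 1 / (sqrt c * (q - 1/q)) / exp (g x)"
      using c d by (simp add: f_def)
    have powr1: "x powr (-1/2) = 1/q"
      using x by (simp add: powr_minus powr_half_sqrt q_def inverse_eq_divide)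
    have "x powr (-3/2) = x powr (-1/2) * x powr (-1)" by (subst powr_add[symmetric]) simp
    also have "x powr (-1) = 1/q^2" using q x by (simp add: powr_minus_divide)
    also have "x powr (-1/2) * (1/q^2) = 1/q^3"
      unfolding powr1 by (simp add: power2_eq_square power3_eq_cube)
    finally have powr3: "x powr (-3/2) = 1/q^3" .
    have e: "exp (- (c * (x + 1/x))) = exp (- (2*c)) / exp (g x)"
      by (simp add: g_def algebra_simps flip: exp_diff)
    have "\<bar>c * (1 - 1/x^2)\<bar> = sqrt c * sqrt c * ((q - 1/q) * (q + 1/q) / q^2)"
    proof -
      have A: "1 - 1/x^2 = (q - 1/q) * (q + 1/q) / q^2"
        unfolding q(2) using q(1)
        by (simp add: divide_simps) (simp add: algebra_simps power2_eq_square power4_eq_xxxx)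
      have "1 - 1/x^2 > 0"
        unfolding A using d q(1) by (intro divide_pos_pos mult_pos_pos add_pos_pos) auto
      then have "\<bar>c * (1 - 1/x^2)\<bar> = c * (1 - 1/x^2)" using c by simp
      then show ?thesis unfolding A using c by simp
    qed
    also have "(q - 1/q) * (q + 1/q) / q^2 = (q - 1/q) * (1/q + 1/q^3)"
      using q(1) by (simp add: field_simps eval_nat_numeral)
    finally have "\<bar>c * (1 - 1/x^2)\<bar> * f (g x) = (c / sqrt c) * (1/q + 1/q^3) / exp (g x)"
      using c d by (simp add: fg)
    also have "c / sqrt c = sqrt c" using c by (simp add: real_div_sqrt)
    finally have "\<bar>c * (1 - 1/x^2)\<bar> * f (g x) = sqrt c * (1/q + 1/q^3) / exp (g x)" .
    then show "exp (- (2*c)) / sqrt c * (\<bar>c * (1 - 1/x^2)\<bar> * f (g x))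
       = (x powr (-1/2) + x powr (-3/2)) * exp (- (c * (x + 1/x)))"
      unfolding powr1 powr3 e using c by simp
  qed
  also have "exp (- (2*c)) / sqrt c * sqrt pi = sqrt (pi / c) * exp (- (2 * c))"
    by (simp add: real_sqrt_divide)
  finally show ?thesis
    by (simp only: has_integral_atLeast_greaterThan)
qed

text \<open>The closed form of the Bessel function K of order 1/2. Scaling by \<kappa> = sqrt (A /
  B) balances A/s and B s into c (x + 1/x), and folding \<open>{0<..}\<close> onto
  \<open>{1..}\<close> by inversion yields the sum of two powers in the auxiliary integral.\<close>

lemma has_integral_bessel_half:
  fixes A B :: real
  assumes A: "A > 0" and B: "B > 0"
  shows "((\<lambda>s. s powr (-1/2) * exp (- (A/s + B * s))) has_integral
           sqrt (pi / B) * exp (- (2 * sqrt (A * B)))) {0<..}"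
proof -
  define c \<kappa> where "c = sqrt (A * B)" and "\<kappa> = sqrt (A / B)"
  have c: "c > 0" and \<kappa>: "\<kappa> > 0" using A B by (auto simp: c_def \<kappa>_def)
  define T where "T = sqrt (pi / c) * exp (- (2 * c))"
  define f where "f x = x powr (-1/2) * exp (- (c * (x + 1/x)))" for x :: real
  have aux: "((\<lambda>x. (x powr (-1/2) + x powr (-3/2)) * exp (- (c * (x + 1/x)))) has_integral T) {1..}"
    unfolding T_def by (rule has_integral_bessel_half_aux[OF c])
  have "f integrable_on {1..}"
  proof (rule integrable_on_continuous_dominated)
    show "continuous_on {1..} f" unfolding f_def[abs_def] by (auto intro!: continuous_intros)
    show "(\<lambda>x. (x powr (-1/2) + x powr (-3/2)) * exp (- (c * (x + 1/x)))) integrable_on {1..}"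
      using aux by (rule has_integral_integrable)
  qed (auto simp: f_def)
  \<comment> \<open>Only the existence of \<open>J\<close> is known. The other half is obtained as
    \<open>T - J\<close>, so that \<open>J\<close> cancels.\<close>
  then obtain J where J: "(f has_integral J) {1..}" by (auto simp: integrable_on_def)
  have I: "((\<lambda>s. f (1/s) / s\<^sup>2) has_integral (T - J)) {1..}"
  proof (rule has_integral_eq[OF _ has_integral_diff[OF aux J]])
    fix s :: real assume "s \<in> {1..}"
    then have s: "s > 0" by simp
    have "(1/s) powr (-1/2) / s\<^sup>2 = s powr (1/2) * s powr (-2)"
      using s by (simp add: powr_divide powr_minus_divide)
    also have "\<dots> = s powr (-3/2)" by (simp add: powr_add[symmetric])
    finally have "(1/s) powr (-1/2) / s\<^sup>2 = s powr (-3/2)" .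
    moreover have "f (1/s) / s\<^sup>2 = ((1/s) powr (-1/2) / s\<^sup>2) * exp (- (c * (s + 1/s)))"
      using s by (simp add: f_def add.commute)
    ultimately show "(s powr (-1/2) + s powr (-3/2)) * exp (- (c * (s + 1/s))) - f s = f (1/s) / s\<^sup>2"
      by (simp add: f_def distrib_right)
  qed
  have "(f has_integral T) {0<..}"
    using has_integral_split_at_1[of f, OF _ I J] by (simp add: f_def)
  then have "((\<lambda>s. 1/\<kappa> * f (1/\<kappa> * s)) has_integral T) {0<..}"
    using \<kappa> by (subst has_integral_scale[where f = f]) (auto simp: f_def)
  then have "((\<lambda>s. sqrt \<kappa> * (1/\<kappa> * f (1/\<kappa> * s))) has_integral (sqrt \<kappa> * T)) {0<..}"
    by (rule has_integral_mult_right)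
  moreover have "sqrt \<kappa> * T = sqrt (pi / B) * exp (- (2 * sqrt (A * B)))"
  proof -
    have "\<kappa> / c = 1 / B" using A B \<kappa> c
      by (simp add: c_def \<kappa>_def real_sqrt_mult real_sqrt_divide field_simps)
    moreover have "\<kappa> * (pi / c) = pi * (\<kappa> / c)" by simp
    ultimately have "\<kappa> * (pi / c) = pi / B" by simp
    then have "sqrt \<kappa> * sqrt (pi / c) = sqrt (pi / B)" by (simp only: real_sqrt_mult[symmetric])
    then have "sqrt \<kappa> * T = sqrt (pi / B) * exp (- (2 * c))" by (simp only: T_def mult.assoc[symmetric])
    then show ?thesis by (simp only: c_def)
  qed
  moreover have "sqrt \<kappa> * (1/\<kappa> * f (1/\<kappa> * s)) = s powr (-1/2) * exp (- (A/s + B * s))"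
    if s: "s \<in> {0<..}" for s
  proof -
    have "c / \<kappa> = B" "c * \<kappa> = A" using A B
      by (simp_all add: c_def \<kappa>_def real_sqrt_mult real_sqrt_divide field_simps)
    then have "c * (1/\<kappa> * s + 1 / (1/\<kappa> * s)) = A/s + B * s"
      using \<kappa> s by (simp add: field_simps)
    moreover have "(1/\<kappa> * s) powr (-1/2) = sqrt \<kappa> * s powr (-1/2)"
      using \<kappa> s by (simp add: powr_divide powr_minus_divide powr_half_sqrt)
    ultimately have "f (1/\<kappa> * s) = sqrt \<kappa> * s powr (-1/2) * exp (- (A/s + B * s))"
      by (simp only: f_def)
    moreover have "sqrt \<kappa> * (1/\<kappa> * (sqrt \<kappa> * y)) = y" for y using \<kappa> by (simp add: field_simps)
    ultimately show ?thesis by (simp only: mult.assoc)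
  qed
  ultimately show ?thesis by (metis (no_types, lifting) has_integral_eq)
qed

text \<open>The substitutions \<open>u = X/s\<close> and \<open>u = X s\<close> turn the integrals into those of \<open>(1 - (1 + u)\<^sup>-\<^sup>a)/u\<close> over
  \<open>{0<..X}\<close> and of \<open>(1 + u)\<^sup>-\<^sup>a/u\<close> over \<open>{X..}\<close>.\<close>

lemma digamma_half_integer_integrals:
  fixes X :: real and k :: nat
  assumes X: "X > 0" and k: "k \<ge> 1"
  shows "\<exists>J M. ((\<lambda>s. (1 - (1 + X/s) powr (- (real k/2))) / s) has_integral J) {1..} \<and>
     ((\<lambda>s. (1 + X * s) powr (- (real k/2)) / s) has_integral M) {1..} \<and>
     J - M = ln X + Digamma (real k/2) + euler_mascheroni"
proof -
  \<comment> \<open>The property passes from a to a + 1, which reaches every k/2 from 1/2 and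
    1.\<close>
  define P where "P a \<longleftrightarrow> (\<exists>J M. ((\<lambda>s. (1 - (1 + X/s) powr (- a)) / s) has_integral J) {1..} \<and>
     ((\<lambda>s. (1 + X * s) powr (- a) / s) has_integral M) {1..} \<and>
     J - M = ln X + Digamma a + euler_mascheroni)" for a :: real
  have step: "P (a + 1)" if a: "a > 0" and "P a" for a
  proof -
    obtain J M where J: "((\<lambda>s. (1 - (1 + X/s) powr (- a)) / s) has_integral J) {1..}"
      and M: "((\<lambda>s. (1 + X * s) powr (- a) / s) has_integral M) {1..}"
      and JM: "J - M = ln X + Digamma a + euler_mascheroni"
      using \<open>P a\<close> by (auto simp: P_def)
    have pos: "1 + X/s > 0" "1 + X * s > 0" if "s \<ge> 1" for s
      using that X by (auto intro!: add_pos_nonneg)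
    have m: "- (a + 1) = - a - 1" by simp
    have p: "y powr (- (a + 1)) = y powr (-a) / y" if "y > 0" for y :: real
      using that by (simp add: powr_diff)
    \<comment> \<open>Raising the exponent changes each integrand by an exact derivative. The
      boundary terms (1 + X)^(-a)/a occur in both integrals and cancel in \<open>J - M\<close>; what
      remains is 1/a, the increment of the digamma function.\<close>
    have "((\<lambda>s. (1 + X/s) powr (- (a+1)) * (X / s^2)) has_integral 1/a - (1 + X/1) powr (-a) / a) {1..}"
    proof (rule has_integral_FTC_atLeast[where F = "\<lambda>s. (1 + X/s) powr (-a) / a"])
      fix s :: real assume s: "s \<ge> 1"
      show "((\<lambda>s. (1 + X/s) powr (-a) / a) has_real_derivative (1 + X/s) powr (- (a+1)) * (X / s^2)) (at s)"
      proof -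
        have "((\<lambda>s. 1 + X/s) has_real_derivative - (X / s^2)) (at s)"
          using s by (auto intro!: derivative_eq_intros simp: power2_eq_square)
        from DERIV_cdivide[OF DERIV_fun_powr[OF this pos(1)[OF s], of "-a"], of a]
        show ?thesis using a by (simp add: m)
      qed
      show "0 \<le> (1 + X/s) powr (- (a+1)) * (X / s^2)" using X by simp
    next
      show "((\<lambda>s. (1 + X/s) powr (-a) / a) \<longlongrightarrow> 1/a) at_top"
        using X a by real_asymp (simp add: inverse_eq_divide)
    qed
    from has_integral_add[OF J this[unfolded div_by_1]]
    have J': "((\<lambda>s. (1 - (1 + X/s) powr (- (a+1))) / s) has_integral J + (1/a - (1 + X) powr (-a) / a)) {1..}"
    proof (rule has_integral_eq[rotated], goal_cases)
      case (1 s)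
      then have s: "s \<ge> 1" by simp
      have "(1 - y) / s + y / (1 + X/s) * (X / s^2) = (1 - y / (1 + X/s)) / s" for y
      proof -
        define t where "t = 1 + X/s"
        have t: "t > 0" using pos[OF s] by (simp add: t_def)
        have X_eq: "X / s^2 = (t - 1) / s" by (simp add: t_def power2_eq_square)
        show ?thesis unfolding X_eq t_def[symmetric] using s t by (simp add: field_simps)
      qed
      then show ?case using pos[OF s] by (simp only: p)
    qed
    have "((\<lambda>s. (1 + X * s) powr (- (a+1)) * X) has_integral 0 - - ((1 + X * 1) powr (-a) / a)) {1..}"
    proof (rule has_integral_FTC_atLeast[where F = "\<lambda>s. - ((1 + X * s) powr (-a) / a)"])
      fix s :: real assume s: "s \<ge> 1"
      show "((\<lambda>s. - ((1 + X * s) powr (-a) / a)) has_real_derivative (1 + X * s) powr (- (a+1)) * X) (at s)"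
      proof -
        have "((\<lambda>s. 1 + X * s) has_real_derivative X) (at s)"
          by (auto intro!: derivative_eq_intros)
        from DERIV_minus[OF DERIV_cdivide[OF DERIV_fun_powr[OF this pos(2)[OF s], of "-a"], of a]]
        show ?thesis using a by (simp add: m)
      qed
      show "0 \<le> (1 + X * s) powr (- (a+1)) * X" using X by simp
    next
      show "((\<lambda>s. - ((1 + X * s) powr (-a) / a)) \<longlongrightarrow> 0) at_top"
        using X a by real_asymp
    qed
    from has_integral_diff[OF M this[unfolded diff_0 minus_minus mult_1_right]]
    have M': "((\<lambda>s. (1 + X * s) powr (- (a+1)) / s) has_integral M - (1 + X) powr (-a) / a) {1..}"
    proof (rule has_integral_eq[rotated], goal_cases)
      case (1 s)
      then have s: "s \<ge> 1" by simp
      have "y / s - y / (1 + X * s) * X = y / (1 + X * s) / s" for y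
        using s pos[OF s] by (simp add: field_simps)
      then show ?case using pos[OF s] by (simp only: p)
    qed
    have "Digamma (a + 1) = Digamma a + 1/a" using a Digamma_plus1[of a] by simp
    with JM J' M' show ?thesis unfolding P_def
      by (intro exI[of _ "J + (1/a - (1 + X) powr (-a) / a)"] exI[of _ "M - (1 + X) powr (-a) / a"])
         (auto simp: algebra_simps)
  qed
  \<comment> \<open>Both antiderivatives are elementary here. The terms 2 ln (1 + sqrt (1 + X))
    cancel and leave ln X - 2 ln 2, in agreement with the digamma value - gamma - 2 ln 2 at
    1/2.\<close>
  have half: "P (1/2)"
  proof -
    have pw: "y powr (- (1/2)) = 1 / sqrt y" if "y > 0" for y :: real
      using that by (simp add: powr_minus_divide powr_half_sqrt)
    have "((\<lambda>s. 1/s - 1 / (sqrt s * sqrt (s + X))) has_integral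
        - 2 * ln 2 - (ln 1 - 2 * ln (sqrt 1 + sqrt (1 + X)))) {1..}"
    proof (rule has_integral_FTC_atLeast[where F = "\<lambda>s. ln s - 2 * ln (sqrt s + sqrt (s + X))"])
      fix s :: real assume s: "s \<ge> 1"
      define p q where "p = sqrt s" and "q = sqrt (s + X)"
      have pq: "p > 0" "q > 0" using s X by (auto simp: p_def q_def)
      have "(sqrt has_real_derivative 1/(2*p)) (at s)"
        using s by (auto intro!: derivative_eq_intros simp: p_def field_simps)
      moreover have "((\<lambda>s. sqrt (s + X)) has_real_derivative 1/(2*q)) (at s)"
        using s X by (auto intro!: derivative_eq_intros simp: q_def field_simps)
      ultimately have "((\<lambda>s. sqrt s + sqrt (s + X)) has_real_derivative 1/(2*p) + 1/(2*q)) (at s)"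
        by (rule DERIV_add)
      from DERIV_chain2[OF DERIV_ln_divide this]
      have "((\<lambda>s. ln (sqrt s + sqrt (s + X))) has_real_derivative 1/(p + q) * (1/(2*p) + 1/(2*q))) (at s)"
        using pq add_pos_pos[OF pq] by (simp add: p_def q_def)
      from DERIV_diff[OF DERIV_ln_divide DERIV_cmult[OF this, of 2]]
      have "((\<lambda>s. ln s - 2 * ln (sqrt s + sqrt (s + X))) has_real_derivative
         1/s - 2 * ((1/(2*p) + 1/(2*q)) / (p + q))) (at s)"
        using s by simp
      also have "2 * ((1/(2*p) + 1/(2*q)) / (p + q)) = 1 / (p * q)"
      proof -
        have "p + q > 0" using pq by simp
        then show ?thesis using pq by (simp add: divide_simps)
      qed
      finally show "((\<lambda>s. ln s - 2 * ln (sqrt s + sqrt (s + X))) has_real_derivative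
         1/s - 1 / (sqrt s * sqrt (s + X))) (at s)" by (simp add: p_def q_def)
      have "sqrt s * sqrt s \<le> sqrt s * sqrt (s + X)" using s X by (intro mult_left_mono) auto
      then have "s \<le> sqrt s * sqrt (s + X)" using s by simp
      then show "0 \<le> 1/s - 1 / (sqrt s * sqrt (s + X))" using s by (simp add: frac_le)
    next
      show "((\<lambda>s. ln s - 2 * ln (sqrt s + sqrt (s + X))) \<longlongrightarrow> - 2 * ln 2) at_top"
        using X by real_asymp
    qed
    then have J: "((\<lambda>s. (1 - (1 + X/s) powr (- (1/2))) / s) has_integral
        - 2 * ln 2 - (ln 1 - 2 * ln (sqrt 1 + sqrt (1 + X)))) {1..}"
    proof (rule has_integral_eq[rotated], goal_cases)
      case (1 s)
      then have s: "s \<ge> 1" by simp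
      have "1 + X/s = (s + X) / s" using s by (simp add: field_simps)
      then have "(1 + X/s) powr (- (1/2)) = sqrt s / sqrt (s + X)"
        using s X by (simp add: pw real_sqrt_divide)
      then show ?case using s X by (simp add: field_simps)
    qed
    have "((\<lambda>s. 1 / (s * sqrt (1 + X * s))) has_integral
        - ln X - (ln 1 - 2 * ln (1 + sqrt (1 + X * 1)))) {1..}"
    proof (rule has_integral_FTC_atLeast[where F = "\<lambda>s. ln s - 2 * ln (1 + sqrt (1 + X * s))"])
      fix s :: real assume s: "s \<ge> 1"
      define q where "q = sqrt (1 + X * s)"
      have q: "q > 1" using s X by (auto simp: q_def)
      have q2: "X * s = q^2 - 1" using s X by (simp add: q_def)
      have "((\<lambda>s. 1 + sqrt (1 + X * s)) has_real_derivative X/(2*q)) (at s)"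
      proof -
        have "1 + X * s > 0" using s X by (simp add: add_pos_pos)
        then show ?thesis by (auto intro!: derivative_eq_intros simp: q_def field_simps)
      qed
      from DERIV_chain2[OF DERIV_ln_divide this, folded q_def]
      have "((\<lambda>s. ln (1 + sqrt (1 + X * s))) has_real_derivative 1/(1 + q) * (X/(2*q))) (at s)"
        using q by simp
      from DERIV_diff[OF DERIV_ln_divide DERIV_cmult[OF this, of 2]]
      have "((\<lambda>s. ln s - 2 * ln (1 + sqrt (1 + X * s))) has_real_derivative
         1/s - 2 * ((X / (2 * q)) / (1 + q))) (at s)"
        using s by (simp add: mult.commute)
      also have "1/s - 2 * ((X / (2 * q)) / (1 + q)) = 1 / (s * q)"
      proof -
        have "X = (q^2 - 1) / s" using q2 s by (simp add: field_simps)
        moreover have "1/s - 2 * (((q^2-1)/s / (2 * q)) / (1 + q)) = 1/(s*q)"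
          using s q by (simp add: divide_simps add_pos_pos) (simp add: algebra_simps power2_eq_square)
        ultimately show ?thesis by simp
      qed
      finally show "((\<lambda>s. ln s - 2 * ln (1 + sqrt (1 + X * s))) has_real_derivative
         1 / (s * sqrt (1 + X * s))) (at s)" by (simp add: q_def)
      show "0 \<le> 1 / (s * sqrt (1 + X * s))" using s X by simp
    next
      show "((\<lambda>s. ln s - 2 * ln (1 + sqrt (1 + X * s))) \<longlongrightarrow> - ln X) at_top"
        using X by real_asymp
    qed
    then have M: "((\<lambda>s. (1 + X * s) powr (- (1/2)) / s) has_integral
        - ln X - (ln 1 - 2 * ln (1 + sqrt (1 + X * 1)))) {1..}"
    proof (rule has_integral_eq[rotated], goal_cases)
      case (1 s)
      then have "1 + X * s > 0" using X by (simp add: add_pos_pos)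
      then show ?case by (simp add: pw)
    qed
    show ?thesis unfolding P_def
      by (intro exI conjI, rule J, rule M) (simp add: Digamma_one_half)
  qed
  have one: "P 1"
  proof -
    have "((\<lambda>s. 1/s - 1/(s + X)) has_integral 0 - (ln 1 - ln (1 + X))) {1..}"
    proof (rule has_integral_FTC_atLeast[where F = "\<lambda>s. ln s - ln (s + X)"])
      fix s :: real assume s: "s \<ge> 1"
      show "((\<lambda>s. ln s - ln (s + X)) has_real_derivative 1/s - 1/(s + X)) (at s)"
        using s X by (auto intro!: derivative_eq_intros simp: field_simps)
      show "0 \<le> 1/s - 1/(s + X)" using s X by (simp add: frac_le)
    next
      show "((\<lambda>s. ln s - ln (s + X)) \<longlongrightarrow> 0) at_top" using X by real_asymp
    qed
    then have J: "((\<lambda>s. (1 - (1 + X/s) powr (- 1)) / s) has_integral 0 - (ln 1 - ln (1 + X))) {1..}"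
    proof (rule has_integral_eq[rotated], goal_cases)
      case (1 s)
      then have s: "s \<ge> 1" by simp
      have e: "1 + X/s = (s + X) / s" using s by (simp add: field_simps)
      have "(1 + X/s) powr (- 1) = s / (s + X)"
        using s X unfolding e by (simp add: powr_minus_divide)
      then show ?case using s X by (simp add: field_simps)
    qed
    have "((\<lambda>s. 1/s - X/(1 + X * s)) has_integral - ln X - (ln 1 - ln (1 + X * 1))) {1..}"
    proof (rule has_integral_FTC_atLeast[where F = "\<lambda>s. ln s - ln (1 + X * s)"])
      fix s :: real assume s: "s \<ge> 1"
      have p: "1 + X * s > 0" using s X by (simp add: add_pos_pos)
      show "((\<lambda>s. ln s - ln (1 + X * s)) has_real_derivative 1/s - X/(1 + X * s)) (at s)"
        using s X p by (auto intro!: derivative_eq_intros simp: field_simps)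
      show "0 \<le> 1/s - X/(1 + X * s)" using s X p by (simp add: field_simps)
    next
      show "((\<lambda>s. ln s - ln (1 + X * s)) \<longlongrightarrow> - ln X) at_top" using X by real_asymp
    qed
    then have M: "((\<lambda>s. (1 + X * s) powr (- 1) / s) has_integral - ln X - (ln 1 - ln (1 + X * 1))) {1..}"
    proof (rule has_integral_eq[rotated], goal_cases)
      case (1 s)
      then have "1 + X * s > 0" "s > 0" using X by (auto simp: add_pos_pos)
      then show ?case by (simp add: powr_minus_divide field_simps)
    qed
    show ?thesis unfolding P_def
      by (intro exI conjI, rule J, rule M) simp
  qed
  have "P (real (Suc k) / 2)" for k
  proof (induction k rule: induct_nat_012)
    case (ge2 k)
    have "P (real (Suc k) / 2 + 1)" using ge2 by (intro step) auto
    then show ?case by (simp add: add_divide_distrib)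
  qed (use half one in auto)
  from this[of "k - 1"] k show ?thesis by (simp add: P_def)
qed

text \<open>\<open>E\<close> is the exponential integral E_1(x), and E_1(x) + ln x + gamma is the
  integral of (1 - exp (- x s))/s over {0<..1}, whose integrand lies between 0 and \<open>x\<close>.
  As 1/s is not integrable at 0, the power s^(w - 1) is used in place of 1/s and then w ->
  0.\<close>

lemma exponential_integral_bounds:
  fixes x :: real
  assumes x: "x > 0"
  obtains E where "((\<lambda>s. exp (- (x * s)) / s) has_integral E) {1..}"
    and "E + ln x + euler_mascheroni \<ge> 0" and "E + ln x + euler_mascheroni \<le> x"
proof -
  define w where "w n = 1 / (real n + 1)" for n
  have w: "w n > 0" "w n \<le> 1" for n by (auto simp: w_def)
  have w_lim: "w \<longlonglongrightarrow> 0" unfolding w_def by real_asymp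
  define f where "f n s = exp (- (x * s)) * s powr (w n - 1)" for n and s :: real
  have f_int: "(f n has_integral Gamma (w n) / x powr w n) {0<..}" for n
    unfolding f_def by (rule has_integral_Gamma_scaled) (use w x in auto)
  have h: "(\<lambda>s. exp (- (x * s))) integrable_on {1..}"
    using has_integral_exp_minus_to_infinity[OF x, of 1] by (auto simp: integrable_on_def)
  have f_le: "norm (f n s) \<le> exp (- (x * s))" if "s \<in> {1..}" for n s
  proof -
    have "s powr (w n - 1) \<le> s powr 0" using that w[of n] by (intro powr_mono) auto
    then show ?thesis using that by (simp add: f_def)
  qed
  have f1: "f n integrable_on {1..}" for n
    by (rule integrable_on_continuous_dominated[OF _ _ h])
       (use f_le in \<open>auto simp: f_def intro!: continuous_intros\<close>)
  have f_conv: "(\<lambda>n. f n s) \<longlonglongrightarrow> exp (- (x * s)) / s" if "s \<in> {1..}" for s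
  proof -
    have "(\<lambda>n. f n s) \<longlonglongrightarrow> exp (- (x * s)) * s powr (0 - 1)"
      unfolding f_def using that by (intro tendsto_intros w_lim) auto
    then show ?thesis using that by (simp add: powr_minus_divide)
  qed
  note dom = dominated_convergence[OF f1 h f_le f_conv]
  define E where "E = integral {1..} (\<lambda>s. exp (- (x * s)) / s)"
  \<comment> \<open>With \<open>K\<close> the part of the Gamma integral over
    \<open>{0<..1}\<close>, this number is 1/w - K, the regularised integral of (1 - exp (- x s))
    s^(w - 1).\<close>
  have bounds: "integral {1..} (f n) + (1 / w n - Gamma (w n) / x powr w n) \<in> {0..x}" for n
  proof -
    have un: "{0<..1} \<union> {1..} = {0::real<..}" "{0<..1} \<inter> {1..} = {1::real}" by auto
    have s1: "((\<lambda>s. s powr (w n - 1)) has_integral 1 / w n) {0<..1}"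
    proof -
      have "((\<lambda>s. s powr (w n - 1)) has_integral 1 / w n) {0..1}"
        using has_integral_powr_from_0[of "w n - 1" 1] w[of n] by simp
      then show ?thesis by (simp only: has_integral_Icc_Ioc)
    qed
    have "f n integrable_on {0<..1}"
    proof (rule integrable_on_continuous_dominated)
      show "(\<lambda>s. s powr (w n - 1)) integrable_on {0<..1}" using s1 by (rule has_integral_integrable)
    qed (use x in \<open>auto simp: f_def intro!: continuous_intros\<close>)
    then obtain K where K: "(f n has_integral K) {0<..1}" by (auto simp: integrable_on_def)
    have "(f n has_integral K + integral {1..} (f n)) {0<..}"
      using has_integral_Un[OF K integrable_integral[OF f1]] un by simp
    then have K_eq: "K = Gamma (w n) / x powr w n - integral {1..} (f n)"
      using has_integral_unique[OF _ f_int[of n]] by fastforce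
    have D: "((\<lambda>s. s powr (w n - 1) - f n s) has_integral 1 / w n - K) {0<..1}"
      by (intro has_integral_diff s1 K)
    have x1: "((\<lambda>s::real. x) has_integral x) {0<..1}"
    proof -
      have "((\<lambda>s::real. x) has_integral x) {0..1}" using has_integral_const_real[of x 0 1] by simp
      then show ?thesis by (simp only: has_integral_Icc_Ioc)
    qed
    have d: "s powr (w n - 1) - f n s = (1 - exp (- (x * s))) * s powr (w n - 1)" for s
      by (simp add: f_def algebra_simps)
    have "0 \<le> 1 / w n - K"
      by (rule has_integral_nonneg[OF D]) (use x in \<open>auto simp: d\<close>)
    moreover have "1 / w n - K \<le> x"
    proof (rule has_integral_le[OF D x1])
      fix s :: real assume s: "s \<in> {0<..1}"
      have "1 - exp (- (x * s)) \<le> x * s" using exp_ge_add_one_self[of "- (x * s)"] by simp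
      then have "(1 - exp (- (x * s))) * s powr (w n - 1) \<le> (x * s) * s powr (w n - 1)"
        by (intro mult_right_mono) auto
      also have "\<dots> = x * s powr (w n)" using s by (simp add: powr_diff)
      also have "\<dots> \<le> x * 1" using s x w[of n] by (intro mult_left_mono powr_le1) auto
      finally show "s powr (w n - 1) - f n s \<le> x" by (simp add: d)
    qed
    ultimately show ?thesis by (simp add: K_eq)
  qed
  have lim: "(\<lambda>n. 1 / w n - Gamma (w n) / x powr w n) \<longlonglongrightarrow> ln x + euler_mascheroni"
  proof -
    \<comment> \<open>1/w - Gamma w / x^w is minus the difference quotient of \<open>g\<close> at 0,
      so its limit is read off from the derivative Gamma'(1) - ln x = - gamma - ln x.\<close>
    define g where "g h = Gamma (1 + h) * x powr (-h)" for h :: real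
    have "(g has_real_derivative (Gamma 1 * Digamma 1) * x powr (-0) + Gamma (1 + 0) * (- (ln x * x powr (-0)))) (at 0)"
      unfolding g_def using x
      by (auto intro!: derivative_eq_intros)
    then have "(g has_real_derivative - (euler_mascheroni + ln x)) (at 0)" using x by simp
    then have "((\<lambda>h. (g (0 + h) - g 0) / h) \<longlongrightarrow> - (euler_mascheroni + ln x)) (at 0)"
      by (simp only: DERIV_def)
    then have "(\<lambda>n. (g (0 + w n) - g 0) / w n) \<longlonglongrightarrow> - (euler_mascheroni + ln x)"
      by (rule filterlim_compose)
         (use w_lim w in \<open>auto simp: filterlim_at less_imp_neq[OF w(1), symmetric]\<close>)
    from tendsto_minus[OF this]
    have "(\<lambda>n. - ((g (0 + w n) - g 0) / w n)) \<longlonglongrightarrow> euler_mascheroni + ln x"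
      by (simp add: add.commute)
    moreover have "- ((g (0 + w n) - g 0) / w n) = 1 / w n - Gamma (w n) / x powr w n" for n
    proof -
      have "Gamma (1 + w n) = w n * Gamma (w n)"
        using Gamma_plus1[of "w n"] w(1)[of n] nonpos_Ints_nonpos[of "w n"] by (force simp: add.commute)
      then show ?thesis using w(1)[of n] x by (simp add: g_def powr_minus_divide field_simps)
    qed
    ultimately show ?thesis by (simp only: add.commute[of "ln x"])
  qed
  have L: "(\<lambda>n. integral {1..} (f n) + (1 / w n - Gamma (w n) / x powr w n)) \<longlonglongrightarrow> E + (ln x + euler_mascheroni)"
    unfolding E_def by (intro tendsto_add dom(2) lim)
  have "E + (ln x + euler_mascheroni) \<in> {0..x}"
    by (rule closed_sequentially[OF _ _ L]) (use bounds in auto)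
  then show ?thesis
    using that[of E] dom(1) by (auto simp: E_def add.assoc)
qed

section \<open>The Whittaker function\<close>

lemma exp_taylor1_bound:
  fixes v :: real
  shows "\<bar>exp v - 1 - v\<bar> \<le> v^2 * exp \<bar>v\<bar>"
proof -
  have "exp v * (1 - v) \<le> exp v * exp (- v)"
    using exp_ge_add_one_self[of "- v"] by (intro mult_left_mono) auto
  then have "exp v - 1 - v \<le> v * (exp v - 1)" by (simp add: exp_minus algebra_simps)
  also have "v * (exp v - 1) \<le> v^2 * exp \<bar>v\<bar>"
  proof (cases "v \<ge> 0")
    case True
    have "exp v - 1 \<le> v * exp v" using \<open>exp v * (1 - v) \<le> exp v * exp (- v)\<close>
      by (simp add: exp_minus algebra_simps)
    then have "v * (exp v - 1) \<le> v * (v * exp v)" using True by (rule mult_left_mono)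
    then show ?thesis using True by (simp add: power2_eq_square mult.assoc)
  next
    case False
    have "v * (exp v - 1) \<le> v * v"
      by (rule mult_left_mono_neg) (use False exp_ge_add_one_self[of v] in linarith)+
    also have "\<dots> \<le> v^2 * exp \<bar>v\<bar>" by (simp add: power2_eq_square mult_le_cancel_left1)
    finally show ?thesis .
  qed
  finally show ?thesis using exp_ge_add_one_self[of v] by linarith
qed

text \<open>Differentiation under the integral with an explicit remainder: the error is at most (y -
  x)^2 times the second moment at the rate x/2. Halving the rate absorbs the factor exp |v|, as |v|
  <= x t / 2 for |y - x| <= x/2.\<close>

lemma has_real_derivative_laplace:
  fixes \<phi> :: "real \<Rightarrow> real"
  assumes int: "\<And>j x. x > 0 \<Longrightarrow> (\<lambda>t. t^j * \<phi> t * exp (- (x * t))) integrable_on {0<..}"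
    and nonneg: "\<And>t. t > 0 \<Longrightarrow> \<phi> t \<ge> 0" and x: "x > 0"
  shows "((\<lambda>x. integral {0<..} (\<lambda>t. \<phi> t * exp (- (x * t)))) has_real_derivative
           - integral {0<..} (\<lambda>t. t * \<phi> t * exp (- (x * t)))) (at x)"
proof -
  define L where "L x = integral {0<..} (\<lambda>t. \<phi> t * exp (- (x * t)))" for x
  define D where "D = integral {0<..} (\<lambda>t. t * \<phi> t * exp (- (x * t)))"
  define K where "K = integral {0<..} (\<lambda>t. t^2 * \<phi> t * exp (- (x/2 * t)))"
  have L: "((\<lambda>t. \<phi> t * exp (- (x * t))) has_integral L x) {0<..}" if "x > 0" for x
    unfolding L_def using int[OF that, of 0] by (simp add: integrable_integral)
  have D: "((\<lambda>t. t * \<phi> t * exp (- (x * t))) has_integral D) {0<..}"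
    unfolding D_def using int[OF x, of 1] by (simp add: integrable_integral)
  have K: "((\<lambda>t. t^2 * \<phi> t * exp (- (x/2 * t))) has_integral K) {0<..}"
    unfolding K_def using int[of "x/2" 2] x by (simp add: integrable_integral)
  have quad: "\<bar>L y - L x + (y - x) * D\<bar> \<le> (y - x)^2 * K" if y: "\<bar>y - x\<bar> \<le> x/2" for y
  proof -
    have "y > 0" using y x by linarith
    have I: "((\<lambda>t. \<phi> t * exp (- (y * t)) - \<phi> t * exp (- (x * t)) + (y - x) * (t * \<phi> t * exp (- (x * t))))
        has_integral L y - L x + (y - x) * D) {0<..}"
      by (intro has_integral_add has_integral_diff has_integral_mult_right L D x \<open>y > 0\<close>)
    have J: "((\<lambda>t. (y - x)^2 * (t^2 * \<phi> t * exp (- (x/2 * t)))) has_integral (y - x)^2 * K) {0<..}"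
      by (intro has_integral_mult_right K)
    have bound: "\<bar>\<phi> t * exp (- (y * t)) - \<phi> t * exp (- (x * t)) + (y - x) * (t * \<phi> t * exp (- (x * t)))\<bar>
        \<le> (y - x)^2 * (t^2 * \<phi> t * exp (- (x/2 * t)))" if t: "t \<in> {0<..}" for t
    proof -
      define v where "v = - ((y - x) * t)"
      have e: "exp (- (y * t)) = exp (- (x * t)) * exp v"
        by (simp add: v_def algebra_simps flip: exp_add)
      have "\<phi> t * exp (- (y * t)) - \<phi> t * exp (- (x * t)) + (y - x) * (t * \<phi> t * exp (- (x * t)))
          = \<phi> t * exp (- (x * t)) * (exp v - 1 - v)"
        unfolding e by (simp add: v_def algebra_simps)
      also have "\<bar>\<dots>\<bar> = \<phi> t * exp (- (x * t)) * \<bar>exp v - 1 - v\<bar>"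
        using t nonneg[of t] by (simp add: abs_mult)
      also have "\<dots> \<le> \<phi> t * exp (- (x * t)) * (v^2 * exp \<bar>v\<bar>)"
        using t nonneg[of t] by (intro mult_left_mono exp_taylor1_bound) auto
      also have "\<dots> = \<phi> t * v^2 * (exp (- (x * t)) * exp \<bar>v\<bar>)" by simp
      also have "exp (- (x * t)) * exp \<bar>v\<bar> \<le> exp (- (x/2 * t))"
      proof -
        have "\<bar>v\<bar> \<le> x/2 * t" using t y by (simp add: v_def abs_mult)
        then have "- (x * t) + \<bar>v\<bar> \<le> - (x/2 * t)" by simp
        then show ?thesis by (simp add: exp_add[symmetric] del: exp_add)
      qed
      then have "\<phi> t * v^2 * (exp (- (x * t)) * exp \<bar>v\<bar>) \<le> \<phi> t * v^2 * exp (- (x/2 * t))"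
        using t nonneg[of t] by (intro mult_left_mono) auto
      also have "\<phi> t * v^2 * exp (- (x/2 * t)) = (y - x)^2 * (t^2 * \<phi> t * exp (- (x/2 * t)))"
        by (simp add: v_def power_mult_distrib)
      finally show ?thesis by simp
    qed
    have "L y - L x + (y - x) * D \<le> (y - x)^2 * K"
      by (rule has_integral_le[OF I J]) (use bound in \<open>simp add: abs_le_iff\<close>)
    moreover have "- ((y - x)^2 * K) \<le> L y - L x + (y - x) * D"
      by (rule has_integral_le[OF has_integral_neg[OF J] I]) (use bound in \<open>force simp: abs_le_iff\<close>)
    ultimately show ?thesis by linarith
  qed
  have "((\<lambda>y. (L y - L x) / (y - x) - (- D)) \<longlongrightarrow> 0) (at x)"
  proof (rule Lim_null_comparison)
    have "\<forall>\<^sub>F y in at x. y \<in> ball x (x/2) - {x}"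
      using x by (intro eventually_at_in_open) auto
    then show "\<forall>\<^sub>F y in at x. norm ((L y - L x) / (y - x) - (- D)) \<le> \<bar>y - x\<bar> * K"
    proof eventually_elim
      case (elim y)
      then have y: "y \<noteq> x" "\<bar>y - x\<bar> \<le> x/2" by (auto simp: dist_real_def abs_minus_commute)
      have "(L y - L x) / (y - x) - (- D) = (L y - L x + (y - x) * D) / (y - x)"
        using y by (simp add: field_simps)
      then have "norm ((L y - L x) / (y - x) - (- D)) = \<bar>L y - L x + (y - x) * D\<bar> / \<bar>y - x\<bar>"
        by (simp only: real_norm_def abs_divide)
      also have "\<dots> \<le> ((y - x)^2 * K) / \<bar>y - x\<bar>"
        by (intro divide_right_mono quad y) auto
      also have "\<dots> = \<bar>y - x\<bar> * K"
      proof -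
        have sq: "(y - x)^2 = \<bar>y - x\<bar> * \<bar>y - x\<bar>" by (simp add: power2_eq_square)
        have "\<bar>y - x\<bar> \<noteq> 0" using y by simp
        then show ?thesis unfolding sq mult.assoc by (rule nonzero_mult_div_cancel_left)
      qed
      finally show ?case .
    qed
    show "((\<lambda>y. \<bar>y - x\<bar> * K) \<longlongrightarrow> 0) (at x)"
      by (auto intro!: tendsto_eq_intros)
  qed
  then have "((\<lambda>y. (L y - L x) / (y - x)) \<longlongrightarrow> - D) (at x)" by (rule LIM_zero_cancel)
  then have "(L has_real_derivative - D) (at x)" by (simp add: has_field_derivative_iff)
  then show ?thesis by (simp only: L_def[abs_def] D_def)
qed

section \<open>Tricomi's function: derivatives, differential equation and asymptotics\<close>

text \<open>\<open>tricomi a j x\<close> is \<open>Gamma a\<close> times \<open>(-1)\<^sup>j\<close> times the \<open>j\<close>-th derivative of the confluent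
  hypergeometric function \<open>U(a, 1, x)\<close>.\<close>

definition tricomi :: "real \<Rightarrow> nat \<Rightarrow> real \<Rightarrow> real" where
  "tricomi a j x = integral {0<..} (\<lambda>t. t^j * (t powr (a - 1) * (1 + t) powr (- a)) * exp (- (x * t)))"

lemma tricomi_has_integral:
  assumes a: "a > 0" and x: "x > 0"
  shows "((\<lambda>t. t^j * (t powr (a - 1) * (1 + t) powr (- a)) * exp (- (x * t))) has_integral tricomi a j x) {0<..}"
proof -
  have "(\<lambda>t. t^j * (t powr (a - 1) * (1 + t) powr (- a)) * exp (- (x * t))) integrable_on {0<..}"
  proof (rule integrable_on_continuous_dominated)
    show "(\<lambda>t. exp (- (x * t)) * t powr (a + real j - 1)) integrable_on {0<..}"
      using has_integral_Gamma_scaled[of "a + real j" x] a x by (auto intro: has_integral_integrable)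
  next
    fix t :: real assume "t \<in> {0<..}"
    then have t: "t > 0" by simp
    have "(1 + t) powr (- a) \<le> (1 + t) powr 0" using t a by (intro powr_mono) auto
    then have "(1 + t) powr (- a) \<le> 1" using t by simp
    then have "(t^j * t powr (a - 1) * exp (- (x * t))) * (1 + t) powr (- a)
        \<le> (t^j * t powr (a - 1) * exp (- (x * t))) * 1"
      using t by (intro mult_left_mono) auto
    moreover have "t powr (a + real j - 1) = t^j * t powr (a - 1)"
      using t by (simp add: powr_realpow[symmetric] powr_add[symmetric] algebra_simps)
    ultimately show "\<bar>t^j * (t powr (a - 1) * (1 + t) powr (- a)) * exp (- (x * t))\<bar>
        \<le> exp (- (x * t)) * t powr (a + real j - 1)"
      using t by (simp add: mult_ac)
  qed (auto intro!: continuous_intros)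
  then show ?thesis unfolding tricomi_def by (rule integrable_integral)
qed

lemma tricomi_pos:
  assumes a: "a > 0" and x: "x > 0"
  shows "tricomi a 0 x > 0"
proof -
  define f where "f t = t powr (a - 1) * (1 + t) powr (- a) * exp (- (x * t))" for t :: real
  have f: "(f has_integral tricomi a 0 x) {0<..}"
    using tricomi_has_integral[OF a x, of 0] by (simp add: f_def[abs_def])
  \<comment> \<open>A positive lower bound for the integrand on [1, 2], factor by factor; the
    minimum covers both monotonicity types of t^(a - 1).\<close>
  define c where "c = min 1 (2 powr (a - 1)) * 3 powr (- a) * exp (- (x * 2))"
  have c: "c > 0" by (simp add: c_def)
  have "((\<lambda>t. if t \<in> {1..2::real} then c else 0) has_integral c) {0<..}"
  proof -
    have "((\<lambda>t::real. c) has_integral c) {1..2}" using has_integral_const_real[of c 1 2] by simp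
    then show ?thesis by (subst has_integral_restrict) auto
  qed
  then have "c \<le> tricomi a 0 x"
  proof (rule has_integral_le[OF _ f])
    fix t :: real assume "t \<in> {0<..}"
    show "(if t \<in> {1..2} then c else 0) \<le> f t"
    proof (cases "t \<in> {1..2}")
      case True
      have "min 1 (2 powr (a - 1)) \<le> t powr (a - 1)"
      proof (cases "a \<ge> 1")
        case True
        then have "1 \<le> t powr (a - 1)" using \<open>t \<in> {1..2}\<close> by (intro ge_one_powr_ge_zero) auto
        then show ?thesis by linarith
      next
        case False
        then have "2 powr (a - 1) \<le> t powr (a - 1)" using \<open>t \<in> {1..2}\<close> by (intro powr_mono2') auto
        then show ?thesis by linarith
      qed
      moreover have "3 powr (- a) \<le> (1 + t) powr (- a)" using True a by (intro powr_mono2') auto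
      moreover have "exp (- (x * 2)) \<le> exp (- (x * t))" using True x by simp
      ultimately have "c \<le> f t" unfolding c_def f_def by (intro mult_mono) auto
      then show ?thesis using True by simp
    next
      case False
      then show ?thesis using \<open>t \<in> {0<..}\<close> by (auto simp: f_def)
    qed
  qed
  then show ?thesis using c by linarith
qed

lemma tricomi_derivative:
  assumes a: "a > 0" and x: "x > 0"
  shows "(tricomi a j has_real_derivative - tricomi a (Suc j) x) (at x)"
proof -
  have "((\<lambda>x. integral {0<..} (\<lambda>t. (t^j * (t powr (a - 1) * (1 + t) powr (- a))) * exp (- (x * t)))) has_real_derivative
     - integral {0<..} (\<lambda>t. t * (t^j * (t powr (a - 1) * (1 + t) powr (- a))) * exp (- (x * t)))) (at x)"
  proof (rule has_real_derivative_laplace[OF _ _ x])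
    fix i and y :: real assume "y > 0"
    from tricomi_has_integral[OF a this, of "i + j"]
    show "(\<lambda>t. t^i * (t^j * (t powr (a - 1) * (1 + t) powr (- a))) * exp (- (y * t))) integrable_on {0<..}"
      by (auto simp: power_add mult.assoc intro: has_integral_integrable)
  qed auto
  then show ?thesis by (simp add: tricomi_def[abs_def] mult.assoc)
qed

text \<open>Kummer's equation with second parameter 1. The combination of the integrands is the
  derivative of \<open>G\<close>, which vanishes at 0 and at infinity; \<open>h\<close> dominates
  it, so that the integrals over \<open>{0..real n}\<close> converge to the full one.\<close>

lemma tricomi_ode:
  assumes a: "a > 0" and x: "x > 0"
  shows "x * tricomi a 2 x + (x - 1) * tricomi a 1 x - a * tricomi a 0 x = 0"
proof -
  define w where "w t = t powr (a - 1) * (1 + t) powr (- a) * exp (- (x * t))" for t :: real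
  define g where "g t = x * (t^2 * w t) + (x - 1) * (t * w t) - a * w t" for t :: real
  define h where "h t = x * (t^2 * w t) + \<bar>x - 1\<bar> * (t * w t) + a * w t" for t :: real
  define G where "G t = - (exp (- (x * t)) * t powr a * (1 + t) powr (1 - a))" for t :: real
  have w: "((\<lambda>t. t^j * w t) has_integral tricomi a j x) {0<..}" for j
    using tricomi_has_integral[OF a x, of j] by (simp add: w_def mult.assoc)
  note w' = w[of 2] w[of 1, unfolded power_one_right] w[of 0, unfolded power_0 mult_1]
  have g_int: "(g has_integral x * tricomi a 2 x + (x - 1) * tricomi a 1 x - a * tricomi a 0 x) {0<..}"
    unfolding g_def by (intro has_integral_add has_integral_diff has_integral_mult_right w')
  have h_int: "(h has_integral x * tricomi a 2 x + \<bar>x - 1\<bar> * tricomi a 1 x + a * tricomi a 0 x) {0<..}"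
    unfolding h_def by (intro has_integral_add has_integral_mult_right w')
  have deriv: "(G has_real_derivative g t) (at t)" if t: "t > 0" for t
  proof -
    have 1: "((\<lambda>t. exp (- (x * t))) has_real_derivative - x * exp (- (x * t))) (at t)"
      by (auto intro!: derivative_eq_intros)
    have 2: "((\<lambda>t. t powr a) has_real_derivative a * t powr (a - 1)) (at t)"
      using has_real_derivative_powr[OF t, of a] by simp
    have 3: "((\<lambda>t. (1 + t) powr (1 - a)) has_real_derivative (1 - a) * (1 + t) powr (- a)) (at t)"
    proof -
      have "((\<lambda>t. 1 + t) has_real_derivative 1) (at t)" by (auto intro!: derivative_eq_intros)
      from DERIV_fun_powr[OF this, of "1 - a"] show ?thesis using t by simp
    qed
    have p: "t powr a = t * t powr (a - 1)" "(1 + t) powr (1 - a) = (1 + t) * (1 + t) powr (- a)"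
      using t by (simp_all add: powr_diff powr_minus field_simps)
    from DERIV_minus[OF DERIV_mult[OF DERIV_mult[OF 1 2] 3]]
    have "(G has_real_derivative - ((- x * exp (- (x * t)) * t powr a + a * t powr (a - 1) * exp (- (x * t))) * (1 + t) powr (1 - a)
        + (1 - a) * (1 + t) powr (- a) * (exp (- (x * t)) * t powr a))) (at t)"
      unfolding G_def[abs_def] .
    also have "- ((- x * exp (- (x * t)) * t powr a + a * t powr (a - 1) * exp (- (x * t))) * (1 + t) powr (1 - a)
        + (1 - a) * (1 + t) powr (- a) * (exp (- (x * t)) * t powr a)) = g t"
      unfolding p by (simp add: g_def w_def algebra_simps power2_eq_square)
    finally show ?thesis .
  qed
  define f where "f n t = (if t \<in> {0..real n} then g t else 0)" for n t
  have Ioc: "(g has_integral G (real n) - G 0) {0<..real n}" for n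
  proof -
    have "(g has_integral G (real n) - G 0) {0..real n}"
    proof (rule fundamental_theorem_of_calculus_interior)
      show "continuous_on {0..real n} G"
        unfolding G_def[abs_def] using a by (intro continuous_intros continuous_on_powr') auto
    qed (use deriv in \<open>auto simp: has_real_derivative_iff_has_vector_derivative\<close>)
    then show ?thesis by (simp only: has_integral_Icc_Ioc)
  qed
  have set_eq: "{0<..} \<inter> {0..real n} = {0<..real n}" "{0..real n} \<inter> {0<..} = {0<..real n}" for n by auto
  have f_int: "(f n has_integral G (real n) - G 0) {0<..}" for n
    using Ioc[of n] by (simp only: f_def[abs_def] has_integral_restrict_Int set_eq)
  have f_le: "norm (f n t) \<le> h t" if "t \<in> {0<..}" for n t
  proof -
    have "w t \<ge> 0" using that by (simp add: w_def)
    then have "\<bar>g t\<bar> \<le> \<bar>x * (t^2 * w t)\<bar> + \<bar>(x - 1) * (t * w t)\<bar> + \<bar>a * w t\<bar>"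
      unfolding g_def by linarith
    also have "\<dots> = h t" using \<open>w t \<ge> 0\<close> x a that by (simp add: h_def abs_mult)
    finally show ?thesis using abs_ge_zero[of "g t"] by (auto simp: f_def)
  qed
  have "(\<lambda>n. integral {0<..} (f n)) \<longlonglongrightarrow> integral {0<..} g"
  proof (rule dominated_convergence(2)[where h = h])
    fix t :: real assume t: "t \<in> {0<..}"
    have "\<forall>\<^sub>F n in sequentially. t \<le> real n" by real_asymp
    then have "\<forall>\<^sub>F n in sequentially. g t = f n t"
      by eventually_elim (use t in \<open>simp add: f_def\<close>)
    then show "(\<lambda>n. f n t) \<longlonglongrightarrow> g t" by (rule Lim_transform_eventually[OF tendsto_const])
  qed (use f_int h_int f_le in \<open>auto intro: has_integral_integrable\<close>)
  then have "(\<lambda>n. G (real n) - G 0) \<longlonglongrightarrow> integral {0<..} g"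
    by (simp only: integral_unique[OF f_int])
  moreover have "(\<lambda>n. G (real n) - G 0) \<longlonglongrightarrow> 0"
    unfolding G_def using a x by real_asymp
  ultimately have "integral {0<..} g = 0" by (rule LIMSEQ_unique)
  then show ?thesis using integral_unique[OF g_int] by simp
qed

lemma one_minus_powr_bounds:
  fixes a t :: real
  assumes "a > 0" "t > 0"
  shows "0 \<le> 1 - (1 + t) powr (- a)" and "1 - (1 + t) powr (- a) \<le> a * t"
proof -
  have "(1 + t) powr (- a) \<le> (1 + t) powr 0" using assms by (intro powr_mono) auto
  then show "0 \<le> 1 - (1 + t) powr (- a)" using assms by simp
  have "1 + - (a * ln (1 + t)) \<le> exp (- (a * ln (1 + t)))" by (rule exp_ge_add_one_self)
  moreover have "a * ln (1 + t) \<le> a * t" using assms ln_add_one_self_le_self2[of t] by (intro mult_left_mono) auto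
  moreover have "(1 + t) powr (- a) = exp (- (a * ln (1 + t)))" using assms by (simp add: powr_def)
  ultimately show "1 - (1 + t) powr (- a) \<le> a * t" by linarith
qed

text \<open>Up to a negative factor this difference is the brace in \<open>side\<close>: the
  subtracted power is the leading term of Tricomi's function at infinity. The integrand is
  nonnegative, and its additional zero at t = 0 supplies the extra decay by which the series over
  \<open>n\<close> converges.\<close>

lemma tricomi_remainder_has_integral:
  assumes a: "a > 0" and x: "x > 0"
  shows "((\<lambda>t. exp (- (x * t)) * t powr (a - 1) * (1 - (1 + t) powr (- a))) has_integral
           Gamma a / x powr a - tricomi a 0 x) {0<..}"
proof (rule has_integral_eq[OF _ has_integral_diff[OF has_integral_Gamma_scaled[OF a x] tricomi_has_integral[OF a x, of 0]]])
  fix t :: real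
  show "exp (- (x * t)) * t powr (a - 1) - t^0 * (t powr (a - 1) * (1 + t) powr (- a)) * exp (- (x * t))
    = exp (- (x * t)) * t powr (a - 1) * (1 - (1 + t) powr (- a))"
    by (simp add: algebra_simps)
qed

text \<open>The remainder integral is squeezed by 0 <= 1 - (1 + t)^(-a) <= a t, so it is
  O(x^(-a-1)).\<close>

lemma tricomi_asymptotics:
  assumes a: "a > 0"
  shows "((\<lambda>x. x powr a * tricomi a 0 x) \<longlongrightarrow> Gamma a) at_top"
proof (rule tendsto_sandwich)
  show "((\<lambda>x. Gamma a - a * Gamma (a + 1) / x) \<longlongrightarrow> Gamma a) at_top"
    by real_asymp
  show "\<forall>\<^sub>F x in at_top. x powr a * tricomi a 0 x \<le> Gamma a"
    using eventually_gt_at_top[of 0]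
  proof eventually_elim
    case (elim x)
    have "0 \<le> Gamma a / x powr a - tricomi a 0 x"
      by (rule has_integral_nonneg[OF tricomi_remainder_has_integral[OF a elim]])
         (use one_minus_powr_bounds[OF a] in auto)
    then show ?case using elim by (simp add: field_simps)
  qed
  show "\<forall>\<^sub>F x in at_top. Gamma a - a * Gamma (a + 1) / x \<le> x powr a * tricomi a 0 x"
    using eventually_gt_at_top[of 0]
  proof eventually_elim
    case (elim x)
    have "((\<lambda>t. a * (exp (- (x * t)) * t powr (a + 1 - 1))) has_integral a * (Gamma (a + 1) / x powr (a + 1))) {0<..}"
      using a elim by (intro has_integral_mult_right has_integral_Gamma_scaled) auto
    then have "Gamma a / x powr a - tricomi a 0 x \<le> a * (Gamma (a + 1) / x powr (a + 1))"
    proof (rule has_integral_le[OF tricomi_remainder_has_integral[OF a elim]])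
      fix t :: real assume "t \<in> {0<..}"
      then have t: "t > 0" by simp
      have "exp (- (x * t)) * t powr (a - 1) * (1 - (1 + t) powr (- a)) \<le> exp (- (x * t)) * t powr (a - 1) * (a * t)"
        using one_minus_powr_bounds[OF a t] by (intro mult_left_mono) auto
      also have "\<dots> = a * (exp (- (x * t)) * t powr (a + 1 - 1))"
        using t by (simp add: powr_diff)
      finally show "exp (- (x * t)) * t powr (a - 1) * (1 - (1 + t) powr (- a)) \<le> a * (exp (- (x * t)) * t powr (a + 1 - 1))" .
    qed
    then have "x powr a * (Gamma a / x powr a - tricomi a 0 x) \<le> x powr a * (a * (Gamma (a + 1) / x powr (a + 1)))"
      by (intro mult_left_mono) auto
    moreover have "x powr a * (a * (Gamma (a + 1) / x powr (a + 1))) = a * Gamma (a + 1) / x"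
      using elim by (simp add: powr_add)
    moreover have "x powr a * (Gamma a / x powr a - tricomi a 0 x) = Gamma a - x powr a * tricomi a 0 x"
      using elim by (simp add: right_diff_distrib)
    ultimately show ?case by linarith
  qed
qed simp


section \<open>The Whittaker function as a Tricomi function\<close>

text \<open>For \<mu> = 1/2 - a and \<nu> = 0 the function is exp (- x/2) sqrt x U(a, 1, x).
  Differentiation only multiplies the prefactor \<open>f\<close> by 1/(2 x) - 1/2, so the second
  derivative combines \<open>tricomi a 0\<close>, \<open>tricomi a 1\<close> and
  \<open>tricomi a 2\<close>, which Kummer's equation reduces to a multiple of \<open>u\<close>.
  Division by \<open>Gamma a\<close> normalises the behaviour at infinity.\<close>

lemma whittaker_solution:
  fixes a :: real
  assumes a: "a > 0"
    and u_def: "u = (\<lambda>x. if x \<le> 0 then 0 else exp (- x / 2) * sqrt x * tricomi a 0 x / Gamma a)"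
  obtains u' where
    "\<And>x. x > 0 \<Longrightarrow> (u has_real_derivative u' x) (at x)"
    "\<And>x. x > 0 \<Longrightarrow> (u' has_real_derivative - ((1/2 - a) / x + 1 / (4 * x\<^sup>2) - 1/4) * u x) (at x)"
    "((\<lambda>x. u x / (x powr (1/2 - a) * exp (- x / 2))) \<longlongrightarrow> 1) at_top"
proof -
  define f where "f x = exp (- x / 2) * sqrt x / Gamma a" for x :: real
  define v where "v x = (1 / (2 * x) - 1/2) * tricomi a 0 x - tricomi a 1 x" for x
  define u' where "u' x = f x * v x" for x
  have G: "Gamma a > 0" using a by (rule Gamma_real_pos)
  have f': "(f has_real_derivative f x * (1 / (2 * x) - 1/2)) (at x)" if x: "x > 0" for x
  proof -
    have "((\<lambda>x. exp (- x / 2) * sqrt x) has_real_derivative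
        exp (- x / 2) * (-1/2) * sqrt x + (inverse (sqrt x) / 2) * exp (- x / 2)) (at x)"
      using x by (auto intro!: derivative_eq_intros)
    from DERIV_cdivide[OF this, of "Gamma a"]
    have "(f has_real_derivative
        (exp (- x / 2) * (-1/2) * sqrt x + (inverse (sqrt x) / 2) * exp (- x / 2)) / Gamma a) (at x)"
      by (simp only: f_def[abs_def])
    also have "inverse (sqrt x) = sqrt x / x"
      using x by (simp add: divide_simps)
    also have "(exp (- x / 2) * (-1/2) * sqrt x + (sqrt x / x / 2) * exp (- x / 2)) / Gamma a
       = f x * (1 / (2 * x) - 1/2)"
      using x G by (simp add: f_def field_simps)
    finally show ?thesis .
  qed
  have v': "(v has_real_derivative (- 1 / (2 * x^2)) * tricomi a 0 x - (1 / (2 * x) - 1/2) * tricomi a 1 x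
      + tricomi a 2 x) (at x)" if x: "x > 0" for x
  proof -
    have d0: "(tricomi a 0 has_real_derivative - tricomi a 1 x) (at x)"
      using tricomi_derivative[OF a x, of 0] by simp
    have d1: "(tricomi a 1 has_real_derivative - tricomi a 2 x) (at x)"
      using tricomi_derivative[OF a x, of 1] by (simp add: numeral_2_eq_2)
    have "((\<lambda>x. 1 / (2 * x) - 1/2) has_real_derivative - 1 / (2 * x^2)) (at x)"
      using x by (auto intro!: derivative_eq_intros simp: power2_eq_square field_simps)
    from DERIV_diff[OF DERIV_mult[OF this d0] d1]
    show ?thesis by (simp add: v_def[abs_def] algebra_simps)
  qed
  have u_eq: "u x = f x * tricomi a 0 x" if "x > 0" for x
    using that by (simp add: u_def f_def)
  show ?thesis
  proof (rule that[of u'])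
    fix x :: real assume x: "x > 0"
    have ev: "\<forall>\<^sub>F y in nhds x. f y * tricomi a 0 y = u y"
      using eventually_nhds_in_open[of "{0<..}" x] x by (auto elim!: eventually_mono simp: u_eq)
    have d0: "(tricomi a 0 has_real_derivative - tricomi a 1 x) (at x)"
      using tricomi_derivative[OF a x, of 0] by simp
    from DERIV_mult[OF f'[OF x] this]
    have "((\<lambda>x. f x * tricomi a 0 x) has_real_derivative u' x) (at x)"
      by (simp add: u'_def v_def algebra_simps)
    then show "(u has_real_derivative u' x) (at x)"
      using DERIV_cong_ev[OF refl ev refl, of "u' x"] by simp
    have ode: "tricomi a 2 x = (a * tricomi a 0 x - (x - 1) * tricomi a 1 x) / x"
      using tricomi_ode[OF a x] x by (simp add: field_simps)
    from DERIV_mult[OF f'[OF x] v'[OF x]]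
    have "(u' has_real_derivative f x * (1 / (2 * x) - 1/2) * v x
       + ((- 1 / (2 * x^2)) * tricomi a 0 x - (1 / (2 * x) - 1/2) * tricomi a 1 x
      + tricomi a 2 x) * f x) (at x)"
      by (simp only: u'_def[abs_def])
    also have "f x * (1 / (2 * x) - 1/2) * v x
       + ((- 1 / (2 * x^2)) * tricomi a 0 x - (1 / (2 * x) - 1/2) * tricomi a 1 x
      + tricomi a 2 x) * f x = f x * (- ((1/2 - a) / x + 1 / (4 * x\<^sup>2) - 1/4) * tricomi a 0 x)"
      unfolding v_def ode using x by (simp add: divide_simps) (simp add: algebra_simps power2_eq_square)
    finally show "(u' has_real_derivative - ((1/2 - a) / x + 1 / (4 * x\<^sup>2) - 1/4) * u x) (at x)"
      by (simp add: u_eq[OF x] mult_ac)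
  next
    have "((\<lambda>x. x powr a * tricomi a 0 x / Gamma a) \<longlongrightarrow> Gamma a / Gamma a) at_top"
      using G by (intro tendsto_divide tricomi_asymptotics[OF a] tendsto_const) auto
    moreover have "\<forall>\<^sub>F x in at_top. x powr a * tricomi a 0 x / Gamma a = u x / (x powr (1/2 - a) * exp (- x / 2))"
      using eventually_gt_at_top[of 0]
    proof eventually_elim
      case (elim x)
      have "x powr (1/2 - a) = sqrt x / x powr a"
        using elim by (simp add: powr_diff powr_half_sqrt)
      then show ?case using elim by (simp add: u_def)
    qed
    ultimately have "((\<lambda>x. u x / (x powr (1/2 - a) * exp (- x / 2))) \<longlongrightarrow> Gamma a / Gamma a) at_top"
      by (rule Lim_transform_eventually)
    then show "((\<lambda>x. u x / (x powr (1/2 - a) * exp (- x / 2))) \<longlongrightarrow> 1) at_top"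
      using G by simp
  qed
qed

text \<open>The Wronskian with a positive decaying solution \<open>u\<close> is constant; were it nonzero,
  the increments of \<open>v / u\<close> over unit intervals would not tend to zero.\<close>

lemma decaying_solution_unique:
  fixes u v u' v' p :: "real \<Rightarrow> real"
  assumes u: "\<And>x. x > 0 \<Longrightarrow> (u has_real_derivative u' x) (at x)"
      "\<And>x. x > 0 \<Longrightarrow> (u' has_real_derivative p x * u x) (at x)"
    and v: "\<And>x. x > 0 \<Longrightarrow> (v has_real_derivative v' x) (at x)"
      "\<And>x. x > 0 \<Longrightarrow> (v' has_real_derivative p x * v x) (at x)"
    and pos: "\<And>x. x > 0 \<Longrightarrow> u x > 0"
    and u0: "(u \<longlongrightarrow> 0) at_top" and ratio: "((\<lambda>x. v x / u x) \<longlongrightarrow> 1) at_top" and "x > 0"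
  shows "v x = u x"
proof -
  define w where "w x = v' x * u x - v x * u' x" for x
  define q where "q x = v x / u x" for x
  have "(w has_real_derivative 0) (at x within {0<..})" if "x \<in> {0<..}" for x
  proof -
    have "x > 0" using that by simp
    from DERIV_diff[OF DERIV_mult[OF v(2)[OF this] u(1)[OF this]] DERIV_mult[OF v(1)[OF this] u(2)[OF this]]]
    have "(w has_real_derivative 0) (at x)" by (simp add: w_def[abs_def] algebra_simps)
    then show ?thesis by (rule has_field_derivative_at_within)
  qed
  then obtain c where c: "\<And>x. x > 0 \<Longrightarrow> w x = c"
    using has_field_derivative_zero_constant[of "{0<..}" w] by auto
  have q': "(q has_real_derivative c / (u x)^2) (at x)" if x: "x > 0" for x
  proof -
    from DERIV_divide[OF v(1)[OF x] u(1)[OF x]] pos[OF x]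
    have "(q has_real_derivative w x / (u x * u x)) (at x)" by (simp add: q_def[abs_def] w_def)
    then show ?thesis using c[OF x] by (simp add: power2_eq_square)
  qed
  have q_lim: "(q \<longlongrightarrow> 1) at_top" using ratio by (simp add: q_def[abs_def])
  have "c = 0"
  proof (rule ccontr)
    assume "c \<noteq> 0"
    have "((\<lambda>x. q (x + 1) - q x) \<longlongrightarrow> 1 - 1) at_top"
      by (intro tendsto_diff q_lim filterlim_compose[OF q_lim]) real_asymp
    from tendsto_rabs[OF this]
    have "((\<lambda>x. \<bar>q (x + 1) - q x\<bar>) \<longlongrightarrow> 0) at_top" by simp
    then have "\<forall>\<^sub>F x in at_top. \<bar>q (x + 1) - q x\<bar> < \<bar>c\<bar>"
      using \<open>c \<noteq> 0\<close> by (intro order_tendstoD(2)) auto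
    moreover have "\<forall>\<^sub>F x in at_top. \<forall>y\<ge>x. u y < 1"
      using order_tendstoD(2)[OF u0, of 1] by (intro eventually_all_ge_at_top) auto
    ultimately have "\<forall>\<^sub>F x::real in at_top. False"
      using eventually_gt_at_top[of 0]
    proof eventually_elim
      case (elim x)
      obtain z where z: "x < z" "z < x + 1" "q (x + 1) - q x = (x + 1 - x) * (c / (u z)^2)"
        using MVT2[of x "x + 1" q "\<lambda>x. c / (u x)^2", OF _ q'] elim by force
      have "u z < 1" "u z > 0" using elim z pos[of z] by auto
      then have "(u z)^2 \<le> 1" "(u z)^2 > 0" by (auto simp: power_le_one)
      then have "\<bar>c\<bar> \<le> \<bar>c\<bar> / (u z)^2" by (simp add: field_simps mult_left_le)
      also have "\<dots> = \<bar>q (x + 1) - q x\<bar>" using z by (simp add: abs_divide)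
      finally show ?case using elim by simp
    qed
    then show False by simp
  qed
  have "(q has_real_derivative 0) (at x within {0<..})" if "x \<in> {0<..}" for x
  proof (rule has_field_derivative_at_within)
    show "(q has_real_derivative 0) (at x)" using q'[of x] that \<open>c = 0\<close> by simp
  qed
  then obtain d where d: "\<And>x. x > 0 \<Longrightarrow> q x = d"
    using has_field_derivative_zero_constant[of "{0<..}" q] by auto
  have "\<forall>\<^sub>F x in at_top. q x = d" using eventually_gt_at_top[of 0] by (rule eventually_mono) (rule d)
  then have "(q \<longlongrightarrow> d) at_top" by (rule tendsto_eventually)
  with q_lim have "d = 1" using tendsto_unique[of at_top q 1 d] by simp
  then show ?thesis using d[OF \<open>x > 0\<close>] pos[OF \<open>x > 0\<close>] by (simp add: q_def)
qed

text \<open>Resolving the definite description takes uniqueness besides existence: the prescribed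
  asymptotics excludes the growing solutions and fixes the multiple of the decaying one.\<close>

lemma whittaker_W_eq_tricomi:
  fixes a x :: real
  assumes a: "a > 0" and x: "x > 0"
  shows "whittaker_W (1/2 - a) 0 x = exp (- x / 2) * sqrt x * tricomi a 0 x / Gamma a"
proof -
  define u where "u = (\<lambda>x. if x \<le> 0 then 0 else exp (- x / 2) * sqrt x * tricomi a 0 x / Gamma a)"
  obtain u' where u1: "\<And>x. x > 0 \<Longrightarrow> (u has_real_derivative u' x) (at x)"
    and u2: "\<And>x. x > 0 \<Longrightarrow> (u' has_real_derivative - ((1/2 - a) / x + 1 / (4 * x\<^sup>2) - 1/4) * u x) (at x)"
    and u3: "((\<lambda>x. u x / (x powr (1/2 - a) * exp (- x / 2))) \<longlongrightarrow> 1) at_top"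
    by (rule whittaker_solution[OF a u_def]) (rule that, assumption+)
  have pos: "u x > 0" if "x > 0" for x
    using that tricomi_pos[OF a that] Gamma_real_pos[OF a] by (simp add: u_def)
  have u0: "(u \<longlongrightarrow> 0) at_top"
  proof -
    have "((\<lambda>x. u x / (x powr (1/2 - a) * exp (- x / 2)) * (x powr (1/2 - a) * exp (- x / 2))) \<longlongrightarrow> 1 * 0) at_top"
      by (intro tendsto_mult u3) real_asymp
    moreover have "\<forall>\<^sub>F x in at_top. u x / (x powr (1/2 - a) * exp (- x / 2)) * (x powr (1/2 - a) * exp (- x / 2)) = u x"
      using eventually_gt_at_top[of 0] by eventually_elim simp
    from Lim_transform_eventually[OF calculation this] show ?thesis by simp
  qed
  have "whittaker_W (1/2 - a) 0 = u"
    unfolding whittaker_W_def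
  proof (rule the_equality)
    show "(\<forall>x\<le>0. u x = 0) \<and>
      (\<exists>u'. \<forall>x>0. (u has_real_derivative u' x) (at x) \<and>
            (u' has_real_derivative - ((1/2 - a) / x + (1 - 0\<^sup>2) / (4 * x\<^sup>2) - 1/4) * u x) (at x)) \<and>
      ((\<lambda>x. u x / (x powr (1/2 - a) * exp (- x / 2))) \<longlongrightarrow> 1) at_top"
      using u1 u2 u3 by (intro conjI exI[of _ u']) (auto simp: u_def)
  next
    fix v assume v: "(\<forall>x\<le>0. v x = 0) \<and>
      (\<exists>v'. \<forall>x>0. (v has_real_derivative v' x) (at x) \<and>
            (v' has_real_derivative - ((1/2 - a) / x + (1 - 0\<^sup>2) / (4 * x\<^sup>2) - 1/4) * v x) (at x)) \<and>
      ((\<lambda>x. v x / (x powr (1/2 - a) * exp (- x / 2))) \<longlongrightarrow> 1) at_top"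
    then obtain v' where v1: "\<And>x. x > 0 \<Longrightarrow> (v has_real_derivative v' x) (at x)"
      and v2: "\<And>x. x > 0 \<Longrightarrow> (v' has_real_derivative - ((1/2 - a) / x + 1 / (4 * x\<^sup>2) - 1/4) * v x) (at x)"
      by auto
    have "((\<lambda>x. v x / (x powr (1/2 - a) * exp (- x / 2)) / (u x / (x powr (1/2 - a) * exp (- x / 2)))) \<longlongrightarrow> 1 / 1) at_top"
      using v by (intro tendsto_divide u3) auto
    moreover have "\<forall>\<^sub>F x in at_top. v x / (x powr (1/2 - a) * exp (- x / 2)) / (u x / (x powr (1/2 - a) * exp (- x / 2))) = v x / u x"
      using eventually_gt_at_top[of 0] by eventually_elim simp
    from Lim_transform_eventually[OF calculation this]
    have ratio: "((\<lambda>x. v x / u x) \<longlongrightarrow> 1) at_top" by simp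
    show "v = u"
    proof
      fix x
      show "v x = u x"
      proof (cases "x > 0")
        case True
        show ?thesis
          by (rule decaying_solution_unique[OF u1 u2 v1 v2 pos u0 ratio True])
      next
        case False
        then show ?thesis using v by (simp add: u_def)
      qed
    qed
  qed
  then show ?thesis using x by (simp add: u_def)
qed

section \<open>Representations as sums of squares\<close>

abbreviation representations :: "nat \<Rightarrow> nat \<Rightarrow> int list set" where
  "representations d n \<equiv> {xs \<in> lattice d. (\<Sum>x\<leftarrow>xs. x ^ 2) = int n}"

lemma member_square_le_sum_squares:
  fixes xs :: "int list"
  assumes "x \<in> set xs"
  shows "x ^ 2 \<le> (\<Sum>x\<leftarrow>xs. x ^ 2)"
  using assms by (intro member_le_sum_list) auto

lemma finite_representations: "finite (representations d n)"
proof (rule finite_subset)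
  show "representations d n \<subseteq> {xs. set xs \<subseteq> {- int n..int n} \<and> length xs = d}"
  proof
    fix xs assume xs: "xs \<in> representations d n"
    have "\<bar>x\<bar> \<le> int n" if "x \<in> set xs" for x
    proof -
      have "\<bar>x\<bar> \<le> x ^ 2"
      proof (cases "x = 0")
        case False
        then have "\<bar>x\<bar> * 1 \<le> \<bar>x\<bar> * \<bar>x\<bar>" by (intro mult_left_mono) auto
        then show ?thesis by (simp add: power2_eq_square)
      qed simp
      also have "x ^ 2 \<le> int n" using member_square_le_sum_squares[OF that] xs by simp
      finally show ?thesis .
    qed
    then show "xs \<in> {xs. set xs \<subseteq> {- int n..int n} \<and> length xs = d}"
      using xs by (force simp: lattice_def abs_le_iff)
  qed
qed (auto intro: finite_lists_length_eq)

lemma r_0: "r 0 n = (if n = 0 then 1 else 0)"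
proof -
  have "representations 0 n = (if n = 0 then {[]} else {})" by (auto simp: lattice_def)
  then show ?thesis by (simp add: r_def)
qed

lemma representations_1: "representations 1 n = (\<lambda>x. [x]) ` {x. x ^ 2 = int n}"
proof (intro equalityI subsetI)
  fix xs assume xs: "xs \<in> representations 1 n"
  then obtain x where "xs = [x]" by (auto simp: lattice_def length_Suc_conv)
  with xs show "xs \<in> (\<lambda>x. [x]) ` {x. x ^ 2 = int n}" by simp
qed (auto simp: lattice_def)

lemma r_1: "r 1 n = card {x::int. x ^ 2 = int n}"
  unfolding r_def representations_1 by (rule card_image) (simp add: inj_on_def)

lemma r_1_square: "r 1 (n ^ 2) = (if n = 0 then 1 else 2)"
proof -
  have "{x::int. x ^ 2 = int (n ^ 2)} = {int n, - int n}" by (auto simp: power2_eq_iff)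
  then show ?thesis by (simp only: r_1) auto
qed

lemma r_1_nonsquare:
  assumes "n \<notin> range (\<lambda>m. m ^ 2)"
  shows "r 1 n = 0"
proof -
  have "x ^ 2 \<noteq> int n" for x :: int
  proof
    assume "x ^ 2 = int n"
    then have "int (nat \<bar>x\<bar> ^ 2) = int n" by simp
    then have "nat \<bar>x\<bar> ^ 2 = n" by (simp only: of_nat_eq_iff)
    then show False using assms rangeI[of "\<lambda>m. m ^ 2" "nat \<bar>x\<bar>"] by simp
  qed
  then show ?thesis by (simp only: r_1) simp
qed

text \<open>The first coordinate, with square \<open>i\<close>, is split off. The convolution has
  the shape of the Cauchy product by which powers of \<open>theta\<close> are expanded.\<close>

lemma r_Suc: "r (Suc d) n = (\<Sum>i\<le>n. r 1 i * r d (n - i))"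
proof -
  define A where "A = (SIGMA i:{..n}. {x::int. x ^ 2 = int i} \<times> representations d (n - i))"
  have fin: "finite {x::int. x ^ 2 = int i}" for i
  proof -
    have "finite ((\<lambda>x. [x]) ` {x::int. x ^ 2 = int i})"
      using finite_representations[of 1 i] by (simp only: representations_1)
    then show ?thesis by (rule finite_imageD) (simp add: inj_on_def)
  qed
  have "bij_betw (\<lambda>(i, x, ys). x # ys) A (representations (Suc d) n)"
  proof (rule bij_betwI')
    fix p q assume "p \<in> A" "q \<in> A"
    then show "((\<lambda>(i, x, ys). x # ys) p = (\<lambda>(i, x, ys). x # ys) q) = (p = q)"
      by (auto simp: A_def)
  next
    fix p assume "p \<in> A"
    then show "(\<lambda>(i, x, ys). x # ys) p \<in> representations (Suc d) n"
      by (auto simp: A_def lattice_def of_nat_diff)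
  next
    fix xs assume xs: "xs \<in> representations (Suc d) n"
    then obtain x ys where x: "xs = x # ys" "length ys = d" by (auto simp: lattice_def length_Suc_conv)
    have nonneg: "(\<Sum>y\<leftarrow>ys. y ^ 2) \<ge> 0" by (rule sum_list_nonneg) auto
    have sum: "x ^ 2 + (\<Sum>y\<leftarrow>ys. y ^ 2) = int n" using xs x by simp
    define i where "i = nat (x ^ 2)"
    have i: "int i = x ^ 2" by (simp add: i_def)
    have "i \<le> n" using sum nonneg i by linarith
    then have "(i, x, ys) \<in> A"
      using x i sum by (simp add: A_def lattice_def of_nat_diff)
    then show "\<exists>p\<in>A. xs = (\<lambda>(i, x, ys). x # ys) p" using x by (intro bexI[of _ "(i, x, ys)"]) auto
  qed
  from bij_betw_same_card[OF this] have "card A = r (Suc d) n" by (simp only: r_def)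
  moreover have "card A = (\<Sum>i\<le>n. card ({x::int. x ^ 2 = int i} \<times> representations d (n - i)))"
    unfolding A_def
  proof (rule card_SigmaI)
    show "\<forall>i\<in>{..n}. finite ({x::int. x ^ 2 = int i} \<times> representations d (n - i))"
      by (rule ballI) (rule finite_cartesian_product[OF fin finite_representations])
  qed simp
  moreover have "\<dots> = (\<Sum>i\<le>n. r 1 i * r d (n - i))"
    unfolding r_1 r_def[of d] card_cartesian_product ..
  ultimately show ?thesis by simp
qed

lemma r_zero: "r d 0 = 1"
proof (induction d)
  case (Suc d)
  have "r 1 0 = 1" using r_1_square[of 0] by simp
  moreover have "r (Suc d) 0 = r 1 0 * r d 0" by (subst r_Suc) simp
  ultimately show ?case using Suc by simp
qed (simp add: r_0)

section \<open>Powers of theta as generating functions\<close>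

lemma summable_theta:
  assumes "s > 0"
  shows "summable (\<lambda>n. exp (- (pi * real (n + 1) ^ 2 * s)))"
proof (rule summable_comparison_test')
  show "summable (\<lambda>n. exp (- ((pi * s) * real (n + 1))))"
    using assms by (intro summable_exp_linear) simp
  fix n
  show "norm (exp (- (pi * real (n + 1) ^ 2 * s))) \<le> exp (- ((pi * s) * real (n + 1)))"
    using exp_square_le_linear[of "pi * s" n] assms by (simp add: mult_ac)
qed

text \<open>The sum over squares becomes a series over all \<open>n\<close> by reindexing, since
  \<open>r 1\<close> vanishes off the squares; the leading 1 of \<open>theta\<close> is the term at
  0 and the factor 2 counts both signs.\<close>

lemma theta_sums:
  assumes "s > 0"
  shows "(\<lambda>n. real (r 1 n) * exp (- (pi * real n * s))) sums theta s"
proof -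
  have "(\<lambda>n. real (r 1 (n ^ 2)) * exp (- (pi * real (n ^ 2) * s))) sums theta s
    \<longleftrightarrow> (\<lambda>n. real (r 1 n) * exp (- (pi * real n * s))) sums theta s"
    by (rule sums_mono_reindex)
       (auto simp: strict_mono_def r_1_nonsquare simp del: One_nat_def intro: power_strict_mono)
  moreover have "(\<lambda>n. 2 * exp (- (pi * real (n + 1) ^ 2 * s))) sums (2 * (\<Sum>n. exp (- (pi * real (n + 1) ^ 2 * s))))"
    by (intro sums_mult summable_sums summable_theta assms)
  then have "(\<lambda>n. real (r 1 (Suc n ^ 2)) * exp (- (pi * real (Suc n ^ 2) * s))) sums
      (2 * (\<Sum>n. exp (- (pi * real (n + 1) ^ 2 * s))))"
    by (simp only: r_1_square) (simp add: add.commute)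
  then have "(\<lambda>n. real (r 1 (n ^ 2)) * exp (- (pi * real (n ^ 2) * s))) sums
      (2 * (\<Sum>n. exp (- (pi * real (n + 1) ^ 2 * s))) + real (r 1 (0 ^ 2)) * exp (- (pi * real (0 ^ 2) * s)))"
    by (rule sums_Suc)
  then have "(\<lambda>n. real (r 1 (n ^ 2)) * exp (- (pi * real (n ^ 2) * s))) sums theta s"
    by (simp only: r_1_square) (simp add: theta_def add.commute)
  ultimately show ?thesis by simp
qed

lemma theta_power_sums:
  assumes "s > 0"
  shows "(\<lambda>n. real (r d n) * exp (- (pi * real n * s))) sums theta s ^ d"
proof (induction d)
  case 0
  have "(\<lambda>n. real (r 0 n) * exp (- (pi * real n * s))) sums (\<Sum>n\<in>{0}. real (r 0 n) * exp (- (pi * real n * s)))"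
    by (rule sums_finite) (auto simp: r_0)
  then show ?case by (simp add: r_0)
next
  case (Suc d)
  define a b where "a n = real (r 1 n) * exp (- (pi * real n * s))"
    and "b n = real (r d n) * exp (- (pi * real n * s))" for n
  have a: "a sums theta s" and b: "b sums theta s ^ d"
    using theta_sums[OF assms] Suc by (auto simp: a_def[abs_def] b_def[abs_def])
  have "(\<lambda>n. \<Sum>i\<le>n. a i * b (n - i)) sums ((\<Sum>n. a n) * (\<Sum>n. b n))"
  proof (rule Cauchy_product_sums)
    have "norm (a n) = a n" "norm (b n) = b n" for n by (simp_all add: a_def b_def)
    then show "summable (\<lambda>n. norm (a n))" "summable (\<lambda>n. norm (b n))"
      using a b by (simp_all add: sums_iff)
  qed
  moreover have "(\<Sum>i\<le>n. a i * b (n - i)) = real (r (Suc d) n) * exp (- (pi * real n * s))" for n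
  proof -
    have "a i * b (n - i) = real (r 1 i * r d (n - i)) * exp (- (pi * real n * s))" if "i \<le> n" for i
    proof -
      have "exp (- (pi * real i * s)) * exp (- (pi * real (n - i) * s)) = exp (- (pi * real n * s))"
        unfolding exp_add[symmetric] using that by (simp add: of_nat_diff algebra_simps)
      then show ?thesis
        by (simp only: a_def b_def of_nat_mult) (metis mult.assoc mult.left_commute)
    qed
    then have "(\<Sum>i\<le>n. a i * b (n - i)) = (\<Sum>i\<le>n. real (r 1 i * r d (n - i)) * exp (- (pi * real n * s)))"
      by (intro sum.cong) auto
    also have "\<dots> = real (\<Sum>i\<le>n. r 1 i * r d (n - i)) * exp (- (pi * real n * s))"
      by (simp only: of_nat_sum sum_distrib_right)
    finally show ?thesis by (simp only: r_Suc[of d n])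
  qed
  ultimately show ?case using a b by (simp add: sums_iff)
qed

lemma theta_power_minus_1_sums:
  assumes "s > 0"
  shows "(\<lambda>n. real (r d (Suc n)) * exp (- (pi * real (Suc n) * s))) sums (theta s ^ d - 1)"
  using theta_power_sums[OF assms, of d]
  by (subst sums_Suc_iff) (simp add: r_zero)

lemma theta_ge_1: "s > 0 \<Longrightarrow> theta s \<ge> 1"
  unfolding theta_def using summable_theta by (simp add: suminf_nonneg)

text \<open>Termwise comparison with s = 1: passing from 1 to \<open>s\<close> multiplies each term
  by at most exp (- pi (s - 1)), because its index is at least 1.\<close>

lemma theta_power_minus_1_le:
  assumes "s \<ge> 1"
  shows "theta s ^ d - 1 \<le> (theta 1 ^ d - 1) * exp pi * exp (- (pi * s))"
proof -
  have 1: "(\<lambda>n. real (r d (Suc n)) * exp (- (pi * real (Suc n) * 1)) * (exp pi * exp (- (pi * s)))) sums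
      ((theta 1 ^ d - 1) * (exp pi * exp (- (pi * s))))"
    by (intro sums_mult2 theta_power_minus_1_sums) simp
  have 2: "real (r d (Suc n)) * exp (- (pi * real (Suc n) * s))
      \<le> real (r d (Suc n)) * exp (- (pi * real (Suc n) * 1)) * (exp pi * exp (- (pi * s)))" for n
  proof -
    have "0 \<le> pi * (real n * (s - 1))" using assms by simp
    then have "- (pi * real (Suc n) * s) \<le> - (pi * real (Suc n) * 1) + (pi + - (pi * s))"
      by (simp add: algebra_simps)
    then have "exp (- (pi * real (Suc n) * s)) \<le> exp (- (pi * real (Suc n) * 1)) * (exp pi * exp (- (pi * s)))"
      by (simp only: exp_add[symmetric] exp_le_cancel_iff)
    then show ?thesis by (simp only: mult.assoc) (intro mult_left_mono, auto)
  qed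
  have "s > 0" using assms by simp
  from sums_le[OF 2 theta_power_minus_1_sums[OF this] 1] show ?thesis by (simp only: mult.assoc)
qed

text \<open>In the variable q = exp (- pi s), \<open>theta\<close> is a power series with
  coefficients \<open>r 1 n\<close>, summable at every point of (0, 1).\<close>

lemma continuous_on_theta: "continuous_on {0<..} theta"
proof -
  have pw: "isCont (\<lambda>q. \<Sum>n. real (r 1 n) * q ^ n) q" if "0 < q" "q < 1" for q :: real
  proof -
    define p where "p = (1 + q) / 2"
    define s where "s = - ln p / pi"
    have p: "0 < p" "p < 1" "q < p" using that by (auto simp: p_def)
    have s: "s > 0" "exp (- (pi * s)) = p" using p by (auto simp: s_def divide_neg_pos)
    have "real (r 1 n) * exp (- (pi * real n * s)) = real (r 1 n) * p ^ n" for n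
    proof -
      have "exp (- (pi * real n * s)) = exp (real n * - (pi * s))" by (simp add: mult_ac)
      then show ?thesis by (simp only: exp_of_nat_mult s(2))
    qed
    then have "summable (\<lambda>n. real (r 1 n) * p ^ n)"
      using theta_sums[OF s(1)] by (simp only: sums_iff)
    then show ?thesis by (rule isCont_powser) (use p that in auto)
  qed
  show ?thesis
  proof (rule continuous_at_imp_continuous_on, rule ballI)
    fix s :: real assume "s \<in> {0<..}"
    then have s: "s > 0" by simp
    have "isCont (\<lambda>s. \<Sum>n. real (r 1 n) * exp (- (pi * s)) ^ n) s"
      by (rule isCont_o2[where f = "\<lambda>s. exp (- (pi * s))", OF _ pw]) (use s in auto)
    moreover have "\<forall>\<^sub>F t in nhds s. (\<Sum>n. real (r 1 n) * exp (- (pi * t)) ^ n) = theta t"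
    proof -
      have "\<forall>\<^sub>F t in nhds s. t \<in> {0<..}" using s by (intro eventually_nhds_in_open) auto
      then show ?thesis
      proof eventually_elim
        case (elim t)
        have "real (r 1 n) * exp (- (pi * t)) ^ n = real (r 1 n) * exp (- (pi * real n * t))" for n
          unfolding exp_of_nat_mult[symmetric] by (simp add: mult_ac)
        moreover have "(\<lambda>n. real (r 1 n) * exp (- (pi * real n * t))) sums theta t"
          by (rule theta_sums) (use elim in simp)
        ultimately show ?case by (simp only: sums_iff)
      qed
    qed
    ultimately show "isCont theta s" by (rule isCont_cong[THEN iffD1, rotated])
  qed
qed

section \<open>Lattice vectors grouped by norm, and the product \<open>Phi\<close>\<close>

lemma lnorm_eq_0_iff: "lnorm m = 0 \<longleftrightarrow> m = replicate (length m) 0"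
proof -
  have "lnorm m = 0 \<longleftrightarrow> (\<Sum>x\<leftarrow>m. real_of_int x ^ 2) = 0" by (simp add: lnorm_def)
  also have "\<dots> \<longleftrightarrow> (\<forall>x\<in>set m. x = 0)"
    by (subst sum_list_nonneg_eq_0_iff) auto
  also have "\<dots> \<longleftrightarrow> m = replicate (length m) 0" by (auto simp: replicate_eqI dest: in_set_replicate[THEN iffD1, rotated])
     (metis in_set_replicate)
  finally show ?thesis .
qed

text \<open>Lattice vectors are grouped into shells of norm sqrt (n + 1), each with
  \<open>r (k - 1) (n + 1)\<close> members. The negated logarithms are nonnegative, so convergence
  over the shells gives unconditional summability over the lattice. This has to be established
  because \<open>infsum\<close> takes the value 0 on families that are not summable.\<close>

lemma ln_Phi:
  assumes "(\<lambda>n. real (r (k - 1) (Suc n)) * - ln (1 - exp (- (2 * pi * sqrt (real (Suc n)))))) sums Y"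
  shows "ln (Phi k) = - Y"
proof -
  define d where "d = k - 1"
  define A where "A n = representations d (Suc n)" for n
  define g where "g x = - ln (1 - exp (- (2 * pi * x)))" for x :: real
  have g_nonneg: "g x \<ge> 0" if "x > 0" for x using that by (simp add: g_def)
  have norm: "lnorm m = sqrt (real (Suc n))" if "m \<in> A n" for m n
  proof -
    have "(\<Sum>x\<leftarrow>m. real_of_int x ^ 2) = real_of_int (\<Sum>x\<leftarrow>m. x ^ 2)"
      by (induction m) auto
    then show ?thesis using that by (simp add: lnorm_def A_def)
  qed
  have bij: "bij_betw snd (Sigma UNIV A) (lattice d - {replicate d 0})"
  proof (rule bij_betwI')
    fix p q assume "p \<in> Sigma UNIV A" "q \<in> Sigma UNIV A"
    then show "(snd p = snd q) = (p = q)" by (auto simp: A_def)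
  next
    fix p assume p: "p \<in> Sigma UNIV A"
    then obtain n m where "p = (n, m)" "m \<in> A n" by auto
    moreover from this have "lnorm m \<noteq> 0" using norm by simp
    ultimately show "snd p \<in> lattice d - {replicate d 0}"
      by (auto simp: A_def lattice_def lnorm_eq_0_iff)
  next
    fix m assume m: "m \<in> lattice d - {replicate d 0}"
    then have "lnorm m \<noteq> 0" by (auto simp: lattice_def lnorm_eq_0_iff)
    have nonneg: "(\<Sum>x\<leftarrow>m. x ^ 2) \<ge> 0" by (rule sum_list_nonneg) auto
    have "(\<Sum>x\<leftarrow>m. real_of_int x ^ 2) = real_of_int (\<Sum>x\<leftarrow>m. x ^ 2)"
      by (induction m) auto
    with \<open>lnorm m \<noteq> 0\<close> have "(\<Sum>x\<leftarrow>m. x ^ 2) \<noteq> 0" by (simp add: lnorm_def)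
    with nonneg have "(\<Sum>x\<leftarrow>m. x ^ 2) = int (Suc (nat (\<Sum>x\<leftarrow>m. x ^ 2) - 1))" by simp
    then have "(nat (\<Sum>x\<leftarrow>m. x ^ 2) - 1, m) \<in> Sigma UNIV A" using m by (auto simp: A_def)
    then show "\<exists>p\<in>Sigma UNIV A. m = snd p" by (rule bexI[rotated]) simp
  qed
  have inner: "((\<lambda>m. g (lnorm (snd (n, m)))) has_sum real (r d (Suc n)) * g (sqrt (real (Suc n)))) (A n)" for n
  proof -
    have "finite (A n)" unfolding A_def by (rule finite_representations)
    from has_sum_finite[OF this, of "\<lambda>m. g (lnorm m)"]
    have "((\<lambda>m. g (lnorm m)) has_sum (\<Sum>m\<in>A n. g (lnorm m))) (A n)" .
    also have "(\<Sum>m\<in>A n. g (lnorm m)) = (\<Sum>m\<in>A n. g (sqrt (real (Suc n))))"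
      by (intro sum.cong refl) (simp only: norm)
    finally show ?thesis by (simp add: A_def r_def)
  qed
  have outer: "((\<lambda>n. real (r d (Suc n)) * g (sqrt (real (Suc n)))) has_sum Y) UNIV"
  proof (rule sums_nonneg_imp_has_sum)
    show "(\<lambda>n. real (r d (Suc n)) * g (sqrt (real (Suc n)))) sums Y"
      using assms by (simp only: g_def d_def)
    show "real (r d (Suc n)) * g (sqrt (real (Suc n))) \<ge> 0" for n
      by (intro mult_nonneg_nonneg g_nonneg) auto
  qed
  have "((\<lambda>p. g (lnorm (snd p))) has_sum Y) (Sigma UNIV A)"
  proof (rule has_sum_SigmaI[OF inner outer])
    show "(\<lambda>p. g (lnorm (snd p))) summable_on Sigma UNIV A"
    proof (rule summable_on_SigmaI[OF inner])
      show "(\<lambda>n. real (r d (Suc n)) * g (sqrt (real (Suc n)))) summable_on UNIV"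
        using outer by (auto simp: summable_on_def)
      show "0 \<le> g (lnorm (snd (n, m)))" if "m \<in> A n" for n m
        using norm[OF that] g_nonneg by simp
    qed
  qed
  then have "((\<lambda>m. g (lnorm m)) has_sum Y) (lattice d - {replicate d 0})"
    using has_sum_reindex_bij_betw[OF bij, of "\<lambda>m. g (lnorm m)" Y] by simp
  then have "((\<lambda>m. ln (1 - exp (- 2 * pi * lnorm m))) has_sum (- Y)) (lattice d - {replicate d 0})"
    unfolding g_def by (subst has_sum_uminus[symmetric]) simp
  from infsumI[OF this] show ?thesis by (simp add: Phi_def d_def)
qed

section \<open>Kronecker's limit formula\<close>

lemma integrable_on_subset_nonneg:
  fixes f :: "real \<Rightarrow> real"
  assumes "f integrable_on T" "\<And>x. x \<in> T \<Longrightarrow> f x \<ge> 0" "S \<subseteq> T" "S \<in> sets lebesgue"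
  shows "f integrable_on S"
proof -
  have "f absolutely_integrable_on T"
    using assms(1,2) by (rule nonnegative_absolutely_integrable_1)
  then have "f absolutely_integrable_on S" using assms(4,3) by (rule set_integrable_subset)
  then show ?thesis by (rule set_lebesgue_integral_eq_integral)
qed

lemma powr_inverse_divide_square:
  fixes s b :: real
  assumes "s > 0"
  shows "(1/s) powr b / s\<^sup>2 = s powr (- b - 2)"
  using assms by (simp add: powr_divide powr_diff powr_minus_divide)

lemma theta_power_ge_1: "s > 0 \<Longrightarrow> theta s ^ d \<ge> 1"
  by (simp add: theta_ge_1)

lemma theta_power_inverse:
  assumes "s > 0"
  shows "theta (1/s) ^ d = s powr (real d / 2) * theta s ^ d"
proof -
  have "sqrt s ^ d = s powr (real d / 2)"
    using assms by (simp add: powr_half_sqrt[symmetric] powr_powr flip: powr_realpow)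
  then show ?thesis using assms by (simp add: theta_inverse power_mult_distrib)
qed

lemma continuous_on_theta_power:
  assumes "S \<subseteq> {0<..}"
  shows "continuous_on S (\<lambda>s. theta s ^ d)"
  by (intro continuous_on_power continuous_on_subset[OF continuous_on_theta assms])

text \<open>One half of a Mellin transform; the restriction to \<open>{1..}\<close> makes it finite
  for every real \<open>p\<close>.\<close>

definition theta_moment :: "nat \<Rightarrow> real \<Rightarrow> real" where
  "theta_moment d p = integral {1..} (\<lambda>s. (theta s ^ d - 1) * s powr p)"

lemma theta_moment_has_integral:
  "((\<lambda>s. (theta s ^ d - 1) * s powr p) has_integral theta_moment d p) {1..}"
proof -
  \<comment> \<open>\<open>b\<close> is chosen so that the Gamma exponent is positive and b - 1 >=
    p.\<close>
  define b where "b = max 1 (p + 1)"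
  define C where "C = (theta 1 ^ d - 1) * exp pi"
  have C: "C \<ge> 0" using theta_power_ge_1[of 1 d] by (simp add: C_def)
  have "(\<lambda>s. exp (- (pi * s)) * s powr (b - 1)) integrable_on {0<..}"
    by (rule has_integral_integrable, rule has_integral_Gamma_scaled) (auto simp: b_def)
  then have "(\<lambda>s. exp (- (pi * s)) * s powr (b - 1)) integrable_on {1..}"
    by (rule integrable_on_subset_nonneg) auto
  then have int: "(\<lambda>s. C * (exp (- (pi * s)) * s powr (b - 1))) integrable_on {1..}"
    by (rule integrable_on_mult_right)
  have "(\<lambda>s. (theta s ^ d - 1) * s powr p) integrable_on {1..}"
  proof (rule integrable_on_continuous_dominated[OF _ _ int])
    show "continuous_on {1..} (\<lambda>s. (theta s ^ d - 1) * s powr p)"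
      by (intro continuous_intros continuous_on_theta_power) auto
    fix s :: real assume "s \<in> {1..}"
    then have s: "s \<ge> 1" by simp
    have "(theta s ^ d - 1) * s powr p \<le> (C * exp (- (pi * s))) * s powr (b - 1)"
      using theta_power_minus_1_le[OF s, of d] C s
      by (intro mult_mono powr_mono) (auto simp: C_def b_def)
    moreover have "(theta s ^ d - 1) * s powr p \<ge> 0" using theta_power_ge_1[of s d] s by simp
    ultimately show "\<bar>(theta s ^ d - 1) * s powr p\<bar> \<le> C * (exp (- (pi * s)) * s powr (b - 1))"
      by (simp add: mult.assoc)
  qed simp
  then show ?thesis unfolding theta_moment_def by (rule integrable_integral)
qed

lemma minus_ln_one_minus_sums:
  fixes q :: real
  assumes "0 < q" "q < 1"
  shows "(\<lambda>n. q ^ Suc n / real (Suc n)) sums (- ln (1 - q))"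
proof -
  have "(\<lambda>n. - ((- (- q)) ^ n) / real n) sums ln (1 + - q)" using assms by (intro ln_series') auto
  then have "(\<lambda>n. - (- (q ^ n) / real n)) sums - ln (1 - q)" by (intro sums_minus) simp
  \<comment> \<open>The term of index 0 is q^0/0 = 0 by the convention for division, so the index
    can be shifted without changing the sum.\<close>
  then have "(\<lambda>n. q ^ n / real n) sums (- ln (1 - q) + q ^ 0 / real 0)" by simp
  then show ?thesis using sums_Suc_iff[of "\<lambda>n. q ^ n / real n" "- ln (1 - q)"] by blast
qed

text \<open>Expanding theta - 1 into exponentials gives Bessel integrals with A = pi \<delta>^2 and
  B = pi n^2. Their values exp (- 2 pi \<delta> n)/n, each counted twice, add up to a logarithm;
  this is how the factors of \<open>Phi\<close> arise.\<close>

lemma theta_bessel_has_integral: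
  fixes \<delta> :: real
  assumes "\<delta> > 0"
  shows "((\<lambda>s. s powr (-1/2) * exp (- (pi * \<delta>\<^sup>2 / s)) * (theta s - 1)) has_integral
           - 2 * ln (1 - exp (- (2 * pi * \<delta>)))) {0<..}"
proof -
  define q where "q = exp (- (2 * pi * \<delta>))"
  have q: "0 < q" "q < 1" using assms by (auto simp: q_def)
  define f where "f n s = 2 * (s powr (-1/2) * exp (- (pi * \<delta>\<^sup>2 / s + pi * real (n + 1)^2 * s)))" for n s
  show ?thesis
  proof (rule has_integral_sums_nonneg[where f = f and I = "\<lambda>n. 2 * (q ^ Suc n / real (Suc n))"])
    fix n
    have "((\<lambda>s. 2 * (s powr (-1/2) * exp (- (pi * \<delta>\<^sup>2 / s + pi * real (n + 1)^2 * s)))) has_integral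
       2 * (sqrt (pi / (pi * real (n + 1)^2)) * exp (- (2 * sqrt (pi * \<delta>\<^sup>2 * (pi * real (n + 1)^2)))))) {0<..}"
      using assms by (intro has_integral_mult_right has_integral_bessel_half) auto
    moreover have "sqrt (pi / (pi * real (n + 1)^2)) = 1 / real (Suc n)"
      by (simp add: real_sqrt_divide)
    moreover have "exp (- (2 * sqrt (pi * \<delta>\<^sup>2 * (pi * real (n + 1)^2)))) = q ^ Suc n"
    proof -
      have "pi * \<delta>\<^sup>2 * (pi * real (n + 1)^2) = (pi * \<delta> * real (Suc n))^2"
        by (simp add: power_mult_distrib power2_eq_square)
      then have "sqrt (pi * \<delta>\<^sup>2 * (pi * real (n + 1)^2)) = pi * \<delta> * real (Suc n)"
        using assms by (simp only: real_sqrt_abs) simp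
      then have "- (2 * sqrt (pi * \<delta>\<^sup>2 * (pi * real (n + 1)^2))) = real (Suc n) * (- (2 * pi * \<delta>))" by simp
      then show ?thesis by (simp only: q_def exp_of_nat_mult)
    qed
    ultimately show "(f n has_integral 2 * (q ^ Suc n / real (Suc n))) {0<..}"
      by (simp only: f_def[abs_def]) (simp only: mult.commute[of "1 / real (Suc n)"] times_divide_eq_right mult_1_right)
  next
    fix s :: real assume "s \<in> {0<..}"
    then have s: "s > 0" by simp
    have "(\<lambda>n. exp (- (pi * real (n + 1) ^ 2 * s))) sums ((theta s - 1) / 2)"
      using summable_sums[OF summable_theta[OF s]] by (simp add: theta_def)
    then have "(\<lambda>n. (2 * (s powr (-1/2) * exp (- (pi * \<delta>\<^sup>2 / s)))) * exp (- (pi * real (n + 1) ^ 2 * s))) sums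
        ((2 * (s powr (-1/2) * exp (- (pi * \<delta>\<^sup>2 / s)))) * ((theta s - 1) / 2))"
      by (rule sums_mult)
    moreover have "(2 * (s powr (-1/2) * exp (- (pi * \<delta>\<^sup>2 / s)))) * exp (- (pi * real (n + 1) ^ 2 * s)) = f n s" for n
    proof -
      have "exp (- (pi * \<delta>\<^sup>2 / s + pi * real (n + 1)^2 * s)) = exp (- (pi * \<delta>\<^sup>2 / s)) * exp (- (pi * real (n + 1) ^ 2 * s))"
        unfolding exp_add[symmetric] by simp
      then show ?thesis by (simp only: f_def mult.assoc)
    qed
    moreover have "(2 * (s powr (-1/2) * exp (- (pi * \<delta>\<^sup>2 / s)))) * ((theta s - 1) / 2) =
        s powr (-1/2) * exp (- (pi * \<delta>\<^sup>2 / s)) * (theta s - 1)" by simp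
    ultimately show "(\<lambda>n. f n s) sums (s powr (-1/2) * exp (- (pi * \<delta>\<^sup>2 / s)) * (theta s - 1))"
      by (simp only:)
  next
    have "(\<lambda>n. 2 * (q ^ Suc n / real (Suc n))) sums (2 * - ln (1 - q))"
      by (intro sums_mult minus_ln_one_minus_sums q)
    then show "(\<lambda>n. 2 * (q ^ Suc n / real (Suc n))) sums (- 2 * ln (1 - exp (- (2 * pi * \<delta>))))"
      by (simp only: q_def mult_minus_left mult_minus_right)
  qed (simp add: f_def)
qed

text \<open>The case of dimension one of the Kronecker limit formula below. The Bessel integral is regularised by the factor
  \<open>exp (- pi \<delta>\<^sup>2 / s)\<close>; as \<open>\<delta> \<rightarrow> 0\<close> its value diverges like the exponential integral
  coming from the part near \<open>s = 0\<close>.\<close>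

lemma theta_moment_sum_dim_1:
  "theta_moment 1 (-1/2) + theta_moment 1 (-1) = 2 + euler_mascheroni - ln (4 * pi)"
proof -
  define \<delta> where "\<delta> n = 1 / (real n + 1)" for n
  have \<delta>: "\<delta> n > 0" for n by (simp add: \<delta>_def)
  have \<delta>_lim: "\<delta> \<longlonglongrightarrow> 0" unfolding \<delta>_def[abs_def] by real_asymp
  define P where "P n s = (theta s ^ 1 - 1) * s powr (-1/2) * exp (- (pi * (\<delta> n)\<^sup>2 / s))" for n and s :: real
  define Q where "Q n s = (theta s ^ 1 - 1) * s powr (-1) * exp (- (pi * (\<delta> n)\<^sup>2 * s))" for n and s :: real
  define R where "R n s = s powr (-3/2) * exp (- (pi * (\<delta> n)\<^sup>2 * s))" for n and s :: real
  note h1 = theta_moment_has_integral[of 1 "-1/2"] and h2 = theta_moment_has_integral[of 1 "-1"]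
  have h3: "((\<lambda>s::real. s powr (-3/2)) has_integral 2) {1..}"
    using has_integral_powr_to_inf[of "-3/2" 1] by simp
  have e1: "exp (- (pi * (\<delta> n)\<^sup>2 / s)) \<le> 1" "exp (- (pi * (\<delta> n)\<^sup>2 * s)) \<le> 1" if "s \<in> {1..}" for n and s :: real
    using that by auto
  have nonneg: "theta s ^ 1 - 1 \<ge> 0" if "s \<in> {1..}" for s using theta_power_ge_1[of s 1] that by auto
  have norm_le: "norm (A * e) \<le> A" if "A \<ge> 0" "0 \<le> e" "e \<le> 1" for A e :: real
    using that by (simp add: abs_mult mult_left_le)
  have P_le: "norm (P n s) \<le> (theta s ^ 1 - 1) * s powr (-1/2)" if "s \<in> {1..}" for n s
    unfolding P_def by (rule norm_le) (use nonneg[OF that] e1[OF that, of n] in auto)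
  have Q_le: "norm (Q n s) \<le> (theta s ^ 1 - 1) * s powr (-1)" if "s \<in> {1..}" for n s
    unfolding Q_def by (rule norm_le) (use nonneg[OF that] e1[OF that, of n] in auto)
  have R_le: "norm (R n s) \<le> s powr (-3/2)" if "s \<in> {1..}" for n s
    unfolding R_def by (rule norm_le) (use e1[OF that, of n] in auto)
  have P_int: "P n integrable_on {1..}" for n
  proof (rule integrable_on_continuous_dominated[OF _ _ has_integral_integrable[OF h1]])
    show "continuous_on {1..} (P n)" unfolding P_def
      by (intro continuous_intros continuous_on_theta_power) auto
  qed (use P_le[of _ n] in auto)
  have Q_int: "Q n integrable_on {1..}" for n
  proof (rule integrable_on_continuous_dominated[OF _ _ has_integral_integrable[OF h2]])
    show "continuous_on {1..} (Q n)" unfolding Q_def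
      by (intro continuous_intros continuous_on_theta_power) auto
  qed (use Q_le[of _ n] in auto)
  have R_int: "R n integrable_on {1..}" for n
  proof (rule integrable_on_continuous_dominated[OF _ _ has_integral_integrable[OF h3]])
    show "continuous_on {1..} (R n)" unfolding R_def
      by (intro continuous_intros) auto
  qed (use R_le[of _ n] in auto)
  have P_lim: "(\<lambda>n. integral {1..} (P n)) \<longlonglongrightarrow> integral {1..} (\<lambda>s. (theta s ^ 1 - 1) * s powr (-1/2))"
  proof (rule dominated_convergence(2)[OF P_int has_integral_integrable[OF h1] P_le])
    fix s :: real assume "s \<in> {1..}"
    then have "(\<lambda>n. P n s) \<longlonglongrightarrow> (theta s ^ 1 - 1) * s powr (-1/2) * exp (- (pi * 0\<^sup>2 / s))"
      unfolding P_def by (intro tendsto_intros \<delta>_lim) auto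
    then show "(\<lambda>n. P n s) \<longlonglongrightarrow> (theta s ^ 1 - 1) * s powr (-1/2)" by simp
  qed
  have Q_lim: "(\<lambda>n. integral {1..} (Q n)) \<longlonglongrightarrow> integral {1..} (\<lambda>s. (theta s ^ 1 - 1) * s powr (-1))"
  proof (rule dominated_convergence(2)[OF Q_int has_integral_integrable[OF h2] Q_le])
    fix s :: real assume "s \<in> {1..}"
    have "(\<lambda>n. Q n s) \<longlonglongrightarrow> (theta s ^ 1 - 1) * s powr (-1) * exp (- (pi * 0\<^sup>2 * s))"
      unfolding Q_def by (intro tendsto_intros \<delta>_lim)
    then show "(\<lambda>n. Q n s) \<longlonglongrightarrow> (theta s ^ 1 - 1) * s powr (-1)" by simp
  qed
  have R_lim: "(\<lambda>n. integral {1..} (R n)) \<longlonglongrightarrow> integral {1..} (\<lambda>s. s powr (-3/2))"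
  proof (rule dominated_convergence(2)[OF R_int has_integral_integrable[OF h3] R_le])
    fix s :: real assume "s \<in> {1..}"
    have "(\<lambda>n. R n s) \<longlonglongrightarrow> s powr (-3/2) * exp (- (pi * 0\<^sup>2 * s))"
      unfolding R_def by (intro tendsto_intros \<delta>_lim)
    then show "(\<lambda>n. R n s) \<longlonglongrightarrow> s powr (-3/2)" by simp
  qed

  \<comment> \<open>After the inversion the regularising factor becomes exp (- x s) with this
    rate.\<close>
  define x where "x n = pi * (\<delta> n)\<^sup>2" for n
  have x: "x n > 0" for n using \<delta>[of n] by (simp add: x_def)
  have "\<forall>n. \<exists>E. ((\<lambda>s. exp (- (x n * s)) / s) has_integral E) {1..} \<and>
      E + ln (x n) + euler_mascheroni \<ge> 0 \<and> E + ln (x n) + euler_mascheroni \<le> x n"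
  proof
    fix n
    obtain E where "((\<lambda>s. exp (- (x n * s)) / s) has_integral E) {1..}"
      "E + ln (x n) + euler_mascheroni \<ge> 0" "E + ln (x n) + euler_mascheroni \<le> x n"
      by (rule exponential_integral_bounds[OF x[of n]])
    then show "\<exists>E. ((\<lambda>s. exp (- (x n * s)) / s) has_integral E) {1..} \<and>
        E + ln (x n) + euler_mascheroni \<ge> 0 \<and> E + ln (x n) + euler_mascheroni \<le> x n"
      by (intro exI[of _ E] conjI)
  qed
  from choice[OF this] obtain E where E_all: "\<forall>n. ((\<lambda>s. exp (- (x n * s)) / s) has_integral E n) {1..} \<and>
      E n + ln (x n) + euler_mascheroni \<ge> 0 \<and> E n + ln (x n) + euler_mascheroni \<le> x n" ..
  have E: "((\<lambda>s. exp (- (x n * s)) / s) has_integral E n) {1..}"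
    and E_bounds: "E n + ln (x n) + euler_mascheroni \<ge> 0" "E n + ln (x n) + euler_mascheroni \<le> x n" for n
    using E_all by auto
  have x_lim: "x \<longlonglongrightarrow> 0"
  proof -
    have "x \<longlonglongrightarrow> pi * 0\<^sup>2" unfolding x_def[abs_def] by (intro tendsto_intros \<delta>_lim)
    then show ?thesis by simp
  qed
  have E_lim: "(\<lambda>n. E n + ln (x n) + euler_mascheroni) \<longlonglongrightarrow> 0"
    by (rule tendsto_sandwich[OF _ _ tendsto_const x_lim]) (use E_bounds in auto)

  \<comment> \<open>On the inverted half, \<open>theta (1/s) = sqrt s * theta s\<close> yields three
    pieces: \<open>Q\<close> from theta - 1, the exponential integral \<open>E\<close> from the
    constant term 1 of theta, and \<open>R\<close> from the subtracted 1. Of the integrals on the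
    left only \<open>E\<close> diverges as \<delta> -> 0.\<close>
  have split: "integral {1..} (Q n) + E n - integral {1..} (R n) + integral {1..} (P n)
      = - 2 * ln (1 - exp (- (2 * pi * \<delta> n)))" for n
  proof -
    define f where "f s = s powr (-1/2) * exp (- (pi * (\<delta> n)\<^sup>2 / s)) * (theta s - 1)" for s
    have J: "(f has_integral integral {1..} (P n)) {1..}"
      by (rule has_integral_eq[OF _ integrable_integral[OF P_int[of n]]]) (simp add: f_def P_def)
    have "((\<lambda>s. Q n s + exp (- (x n * s)) / s - R n s) has_integral
        integral {1..} (Q n) + E n - integral {1..} (R n)) {1..}"
      by (intro has_integral_add has_integral_diff integrable_integral Q_int R_int E)
    then have I: "((\<lambda>s. f (1/s) / s\<^sup>2) has_integral integral {1..} (Q n) + E n - integral {1..} (R n)) {1..}"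
    proof (rule has_integral_eq[rotated])
      fix s :: real assume "s \<in> {1..}"
      then have s: "s > 0" by simp
      have p: "(1/s) powr (-1/2) / s\<^sup>2 = s powr (-3/2)"
        using powr_inverse_divide_square[OF s, of "-1/2"] by simp
      have q: "s powr (-3/2) * sqrt s = s powr (-1)"
        using s by (simp add: powr_half_sqrt[symmetric] powr_add[symmetric])
      have "f (1/s) / s\<^sup>2 = ((1/s) powr (-1/2) / s\<^sup>2) * exp (- (x n * s)) * (sqrt s * theta s - 1)"
        using s by (simp add: f_def x_def theta_inverse)
      also have "\<dots> = (s powr (-3/2) * sqrt s * theta s - s powr (-3/2)) * exp (- (x n * s))"
        unfolding p by (simp add: algebra_simps)
      also have "\<dots> = (s powr (-1) * theta s - s powr (-3/2)) * exp (- (x n * s))"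
        unfolding q ..
      finally have f_eq: "f (1/s) / s\<^sup>2 = (s powr (-1) * theta s - s powr (-3/2)) * exp (- (x n * s))" .
      have "(A * t - B) * e = (t - 1) * A * e + e * A - B * e" for A B e t :: real
        by (simp add: algebra_simps)
      then have "(s powr (-1) * theta s - s powr (-3/2)) * exp (- (x n * s))
          = Q n s + exp (- (x n * s)) * s powr (-1) - R n s"
        unfolding Q_def R_def x_def power_one_right .
      moreover have "exp (- (x n * s)) * s powr (-1) = exp (- (x n * s)) / s"
        using s by (simp add: powr_minus_divide)
      ultimately show "Q n s + exp (- (x n * s)) / s - R n s = f (1/s) / s\<^sup>2"
        using f_eq by (simp only:)
    qed
    have "(f has_integral integral {1..} (Q n) + E n - integral {1..} (R n) + integral {1..} (P n)) {0<..}"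
      by (rule has_integral_split_at_1[OF _ I J]) (simp add: f_def theta_ge_1)
    moreover have "(f has_integral - 2 * ln (1 - exp (- (2 * pi * \<delta> n)))) {0<..}"
      unfolding f_def[abs_def] by (rule theta_bessel_has_integral[OF \<delta>])
    ultimately show ?thesis by (rule has_integral_unique)
  qed
  \<comment> \<open>ln (x n) compensates both divergences: that of \<open>E n\<close>, leaving -
    gamma, and that of the logarithm on the right, as 1 - exp (- 2 pi \<delta>) is asymptotic to 2
    pi \<delta>.\<close>
  have "(\<lambda>n. ln (x n) - 2 * ln (1 - exp (- (2 * pi * \<delta> n)))) \<longlonglongrightarrow> ln pi - 2 * ln (2 * pi)"
    unfolding x_def \<delta>_def by real_asymp
  moreover have "ln pi - 2 * ln (2 * pi) = - ln (4 * pi)"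
  proof -
    have "ln (4::real) = 2 * ln 2" using ln_realpow[of 2 2] by simp
    then show ?thesis by (simp add: ln_mult)
  qed
  ultimately have L: "(\<lambda>n. ln (x n) - 2 * ln (1 - exp (- (2 * pi * \<delta> n)))) \<longlonglongrightarrow> - ln (4 * pi)" by simp
  have "(\<lambda>n. integral {1..} (Q n) + integral {1..} (P n)) \<longlonglongrightarrow>
      integral {1..} (\<lambda>s. (theta s ^ 1 - 1) * s powr (-1)) + integral {1..} (\<lambda>s. (theta s ^ 1 - 1) * s powr (-1/2))"
    by (intro tendsto_add P_lim Q_lim)
  moreover have "integral {1..} (Q n) + integral {1..} (P n)
      = (ln (x n) - 2 * ln (1 - exp (- (2 * pi * \<delta> n)))) - (E n + ln (x n) + euler_mascheroni)
        + euler_mascheroni + integral {1..} (R n)" for n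
    using split[of n] by linarith
  moreover have "(\<lambda>n. (ln (x n) - 2 * ln (1 - exp (- (2 * pi * \<delta> n)))) - (E n + ln (x n) + euler_mascheroni)
        + euler_mascheroni + integral {1..} (R n)) \<longlonglongrightarrow> - ln (4 * pi) - 0 + euler_mascheroni + integral {1..} (\<lambda>s. s powr (-3/2))"
    by (intro tendsto_add tendsto_diff L E_lim tendsto_const R_lim)
  ultimately have "theta_moment 1 (-1) + theta_moment 1 (-1/2)
      = - ln (4 * pi) - 0 + euler_mascheroni + integral {1..} (\<lambda>s. s powr (-3/2))"
    unfolding theta_moment_def using LIMSEQ_unique by simp
  then show ?thesis using integral_unique[OF h3] by simp
qed

text \<open>The left-hand side is, up to \<open>1/a\<close>, the constant term of the Epstein zeta function at \<open>s = k/2\<close>. Write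
  \<open>theta ^ k - 1 = (theta ^ d - 1) + theta ^ d (theta - 1)\<close> with \<open>d = k - 1\<close> and apply the inversion to the
  factor \<open>theta ^ d\<close> only; its constant term gives the one-dimensional case, its other terms give
  Bessel integrals of order one half, which sum to \<open>ln (Phi k)\<close>.\<close>

lemma kronecker_limit_formula:
  fixes k :: nat
  assumes k: "k \<ge> 1"
  defines "a \<equiv> real k / 2"
  shows "theta_moment k (a - 1) + theta_moment k (-1)
     = 1 / a + Gamma a * pi powr (- a) * zeta_r (k - 1) a - 2 * ln (Phi k) + euler_mascheroni - ln (4 * pi)"
proof -
  define d where "d = k - 1"
  have k_eq: "k = Suc d" using k by (simp add: d_def)
  have a: "a > 0" "a = real d / 2 + 1/2" by (auto simp: a_def k_eq)
  have T: "theta s ^ k = theta s ^ d * theta s" for s by (simp add: k_eq)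
  note m = theta_moment_has_integral
  have h3: "((\<lambda>s::real. s powr (-3/2)) has_integral 2) {1..}"
    using has_integral_powr_to_inf[of "-3/2" 1] by simp
  have h4: "((\<lambda>s::real. s powr (- a - 1)) has_integral 1/a) {1..}"
    using has_integral_powr_to_inf[of "-a-1" 1] a(1) by simp
  have inv: "theta (1/s) ^ d = s powr (a - 1/2) * theta s ^ d" if "s > 0" for s
    using theta_power_inverse[OF that, of d] a by simp
  have D1: "theta s ^ d - 1 \<ge> 0" "theta s - 1 \<ge> 0" if "s > 0" for s
    using theta_power_ge_1[OF that, of d] theta_ge_1[OF that] by auto

  \<comment> \<open>The full Mellin integral of theta^d - 1 at a = d/2 + 1/2, to the right of the
    abscissa d/2. The constants 2 and - 1/a are the integrals of s^(-3/2) and - s^(-a-1) that the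
    inversion produces from constant terms.\<close>
  define Z where "Z = theta_moment d (-3/2) + 2 - 1/a + theta_moment d (a - 1)"
  have Z: "((\<lambda>s. (theta s ^ d - 1) * s powr (a - 1)) has_integral Z) {0<..}"
    unfolding Z_def
  proof (rule has_integral_split_at_1[OF _ _ m])
    have "((\<lambda>s. (theta s ^ d - 1) * s powr (-3/2) + s powr (-3/2) - s powr (- a - 1)) has_integral
        theta_moment d (-3/2) + 2 - 1/a) {1..}"
      by (intro has_integral_add has_integral_diff m h3 h4)
    then show "((\<lambda>s. (theta (1/s) ^ d - 1) * (1/s) powr (a - 1) / s\<^sup>2) has_integral
        theta_moment d (-3/2) + 2 - 1/a) {1..}"
    proof (rule has_integral_eq[rotated])
      fix s :: real assume "s \<in> {1..}"
      then have s: "s > 0" by simp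
      have p: "(1/s) powr (a - 1) / s\<^sup>2 = s powr (- a - 1)"
      proof -
        have e: "- (a - 1) - 2 = - a - 1" by simp
        show ?thesis using powr_inverse_divide_square[OF s, of "a - 1"] unfolding e .
      qed
      have q: "s powr (a - 1/2) * s powr (- a - 1) = s powr (-3/2)"
        by (simp add: powr_add[symmetric])
      have "(theta (1/s) ^ d - 1) * (1/s) powr (a - 1) / s\<^sup>2
          = (s powr (a - 1/2) * theta s ^ d - 1) * ((1/s) powr (a - 1) / s\<^sup>2)"
        by (simp only: inv[OF s] times_divide_eq_right)
      also have "\<dots> = (s powr (a - 1/2) * s powr (- a - 1)) * theta s ^ d - s powr (- a - 1)"
        unfolding p by (simp add: algebra_simps)
      also have "\<dots> = (theta s ^ d - 1) * s powr (-3/2) + s powr (-3/2) - s powr (- a - 1)"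
        unfolding q by (simp add: algebra_simps)
      finally show "(theta s ^ d - 1) * s powr (-3/2) + s powr (-3/2) - s powr (- a - 1)
          = (theta (1/s) ^ d - 1) * (1/s) powr (a - 1) / s\<^sup>2" by simp
    qed
  qed (use D1 in auto)

  \<comment> \<open>What is left of the full integrand when the zero vector is removed from either
    factor. The first remaining factor decays exponentially as s -> 0 and the second as s ->
    infinity, so the integral converges at both ends.\<close>
  define g where "g s = s powr (-1/2) * (theta (1/s) ^ d - 1) * (theta s - 1)" for s
  define Y where "Y = (theta_moment k (-1) - theta_moment 1 (-1) - theta_moment d (-3/2))
     + (theta_moment k (a - 1) - theta_moment d (a - 1) - theta_moment 1 (-1/2))"
  have Y: "(g has_integral Y) {0<..}"
    unfolding Y_def
  proof (rule has_integral_split_at_1)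
    fix s :: real assume "0 < s"
    then show "g s \<ge> 0" using D1[of "1/s"] D1[of s] by (simp add: g_def)
  next
    have "((\<lambda>s. (theta s ^ k - 1) * s powr (-1) - (theta s ^ 1 - 1) * s powr (-1) - (theta s ^ d - 1) * s powr (-3/2))
      has_integral theta_moment k (-1) - theta_moment 1 (-1) - theta_moment d (-3/2)) {1..}"
      by (intro has_integral_diff m)
    then show "((\<lambda>s. g (1/s) / s\<^sup>2) has_integral theta_moment k (-1) - theta_moment 1 (-1) - theta_moment d (-3/2)) {1..}"
    proof (rule has_integral_eq[rotated])
      fix s :: real assume "s \<in> {1..}"
      then have s: "s > 0" by simp
      have p: "(1/s) powr (-1/2) / s\<^sup>2 = s powr (-3/2)"
        using powr_inverse_divide_square[OF s, of "-1/2"] by simp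
      have q: "s powr (-3/2) * sqrt s = s powr (-1)"
        using s by (simp add: powr_half_sqrt[symmetric] powr_add[symmetric])
      have "g (1/s) / s\<^sup>2 = ((1/s) powr (-1/2) / s\<^sup>2) * (theta s ^ d - 1) * (sqrt s * theta s - 1)"
        using s by (simp add: g_def theta_inverse)
      also have "\<dots> = (s powr (-3/2) * sqrt s) * (theta s ^ d * theta s - theta s) - s powr (-3/2) * (theta s ^ d - 1)"
        unfolding p by (simp add: algebra_simps)
      also have "\<dots> = (theta s ^ k - 1) * s powr (-1) - (theta s ^ 1 - 1) * s powr (-1) - (theta s ^ d - 1) * s powr (-3/2)"
      proof -
        have "B * (U - t) - C * (V - 1) = (U - 1) * B - (t - 1) * B - (V - 1) * C" for B C U V t :: real
          by (simp add: algebra_simps)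
        then show ?thesis unfolding q T power_one_right .
      qed
      finally show "(theta s ^ k - 1) * s powr (-1) - (theta s ^ 1 - 1) * s powr (-1) - (theta s ^ d - 1) * s powr (-3/2)
        = g (1/s) / s\<^sup>2" by simp
    qed
  next
    have "((\<lambda>s. (theta s ^ k - 1) * s powr (a - 1) - (theta s ^ d - 1) * s powr (a - 1) - (theta s ^ 1 - 1) * s powr (-1/2))
      has_integral theta_moment k (a - 1) - theta_moment d (a - 1) - theta_moment 1 (-1/2)) {1..}"
      by (intro has_integral_diff m)
    then show "(g has_integral theta_moment k (a - 1) - theta_moment d (a - 1) - theta_moment 1 (-1/2)) {1..}"
    proof (rule has_integral_eq[rotated])
      fix s :: real assume "s \<in> {1..}"
      then have s: "s > 0" by simp
      have q: "s powr (-1/2) * s powr (a - 1/2) = s powr (a - 1)"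
        by (simp add: powr_add[symmetric])
      have "g s = (s powr (-1/2) * s powr (a - 1/2)) * (theta s ^ d * theta s - theta s ^ d) - s powr (-1/2) * (theta s - 1)"
        unfolding g_def inv[OF s] by (simp add: algebra_simps)
      also have "\<dots> = (theta s ^ k - 1) * s powr (a - 1) - (theta s ^ d - 1) * s powr (a - 1) - (theta s ^ 1 - 1) * s powr (-1/2)"
        unfolding q T by (simp add: algebra_simps)
      finally show "(theta s ^ k - 1) * s powr (a - 1) - (theta s ^ d - 1) * s powr (a - 1) - (theta s ^ 1 - 1) * s powr (-1/2) = g s"
        by simp
    qed
  qed

  have "zeta_r d a = Z * pi powr a / Gamma a"
  proof -
    have "(\<lambda>n. real (r d (Suc n)) * (Gamma a / (pi * real (Suc n)) powr a)) sums Z"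
    proof (rule integrable_sums_nonneg[OF _ _ _ Z])
      fix n
      show "((\<lambda>s. real (r d (Suc n)) * (exp (- (pi * real (Suc n) * s)) * s powr (a - 1))) has_integral
          real (r d (Suc n)) * (Gamma a / (pi * real (Suc n)) powr a)) {0<..}"
        by (rule has_integral_mult_right, rule has_integral_Gamma_scaled) (use a in auto)
    next
      fix s :: real assume "s \<in> {0<..}"
      then have "s > 0" by simp
      from sums_mult2[OF theta_power_minus_1_sums[OF this, of d], of "s powr (a - 1)"]
      show "(\<lambda>n. real (r d (Suc n)) * (exp (- (pi * real (Suc n) * s)) * s powr (a - 1))) sums
          ((theta s ^ d - 1) * s powr (a - 1))" by (simp only: mult.assoc)
    qed simp
    from sums_mult2[OF this, of "pi powr a / Gamma a"]
    have "(\<lambda>n. real (r d (Suc n)) * (Gamma a / (pi * real (Suc n)) powr a) * (pi powr a / Gamma a)) sums (Z * pi powr a / Gamma a)"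
      by simp
    moreover have "real (r d (Suc n)) * (Gamma a / (pi * real (Suc n)) powr a) * (pi powr a / Gamma a)
        = real (r d (Suc n)) / real (Suc n) powr a" for n
    proof -
      have "Gamma a \<noteq> 0" using Gamma_real_pos[OF a(1)] by simp
      moreover have "(pi * real (Suc n)) powr a = pi powr a * real (Suc n) powr a" by (rule powr_mult)
      ultimately show ?thesis by simp
    qed
    ultimately have "(\<lambda>n. real (r d (Suc n)) / real (Suc n) powr a) sums (Z * pi powr a / Gamma a)" by (simp only:)
    then show ?thesis by (simp only: zeta_r_def sums_iff)
  qed
  then have Z_eq: "Z = Gamma a * pi powr (- a) * zeta_r d a"
    using Gamma_real_pos[OF a(1)] by (simp add: powr_minus_divide)

  have "(\<lambda>n. real (r d (Suc n)) * (- 2 * ln (1 - exp (- (2 * pi * sqrt (real (Suc n))))))) sums Y"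
  proof (rule integrable_sums_nonneg[OF _ _ _ Y])
    fix n
    show "((\<lambda>s. real (r d (Suc n)) * (s powr (-1/2) * exp (- (pi * (sqrt (real (Suc n)))\<^sup>2 / s)) * (theta s - 1))) has_integral
       real (r d (Suc n)) * (- 2 * ln (1 - exp (- (2 * pi * sqrt (real (Suc n))))))) {0<..}"
      by (intro has_integral_mult_right theta_bessel_has_integral) simp
  next
    fix n and s :: real assume "s \<in> {0<..}"
    then show "0 \<le> real (r d (Suc n)) * (s powr (-1/2) * exp (- (pi * (sqrt (real (Suc n)))\<^sup>2 / s)) * (theta s - 1))"
      using D1[of s] by (intro mult_nonneg_nonneg) auto
  next
    fix s :: real assume "s \<in> {0<..}"
    then have "1/s > 0" by simp
    from sums_mult[OF theta_power_minus_1_sums[OF this, of d], of "s powr (-1/2) * (theta s - 1)"]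
    have "(\<lambda>n. s powr (-1/2) * (theta s - 1) * (real (r d (Suc n)) * exp (- (pi * real (Suc n) * (1/s))))) sums
      (s powr (-1/2) * (theta s - 1) * (theta (1/s) ^ d - 1))" .
    moreover have "s powr (-1/2) * (theta s - 1) * (theta (1/s) ^ d - 1) = g s" by (simp add: g_def)
    moreover have "s powr (-1/2) * (theta s - 1) * (real (r d (Suc n)) * exp (- (pi * real (Suc n) * (1/s))))
        = real (r d (Suc n)) * (s powr (-1/2) * exp (- (pi * (sqrt (real (Suc n)))\<^sup>2 / s)) * (theta s - 1))" for n
      by simp
    ultimately show "(\<lambda>n. real (r d (Suc n)) * (s powr (-1/2) * exp (- (pi * (sqrt (real (Suc n)))\<^sup>2 / s)) * (theta s - 1))) sums g s"
      by (simp only:)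
  qed
  from sums_divide[OF this, of 2]
  have "(\<lambda>n. real (r (k - 1) (Suc n)) * - ln (1 - exp (- (2 * pi * sqrt (real (Suc n)))))) sums (Y / 2)"
    by (simp add: d_def)
  then have Y_eq: "Y = - 2 * ln (Phi k)" using ln_Phi by force
  \<comment> \<open>In the sum of \<open>Y\<close>, \<open>Z\<close> and the one-dimensional value
    all moments of theta^d and of theta cancel, and so does the 2 in \<open>Z\<close> against the 2
    in the one-dimensional value.\<close>
  show ?thesis
    using theta_moment_sum_dim_1 unfolding Z_eq[unfolded Z_def d_def[symmetric], symmetric]
    using Y_eq Y_def Z_def Z_eq by (simp add: d_def)
qed

section \<open>Symmetry\<close>

definition digamma_upper :: "real \<Rightarrow> real \<Rightarrow> real" where
  "digamma_upper a X = integral {1..} (\<lambda>s. (1 + X * s) powr (- a) / s)"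

text \<open>A generalised Stieltjes transform of the theta weight on \<open>{1..}\<close>, taken at
  x^2. The factor x^a makes the kernels at x and 1/x correspond under s -> 1/s, up to a power of
  s.\<close>

definition theta_stieltjes :: "nat \<Rightarrow> real \<Rightarrow> real" where
  "theta_stieltjes k x = integral {1..} (\<lambda>s. (theta s ^ k - 1) * s powr (real k / 2 - 1) *
      (x powr (real k / 2) * (x\<^sup>2 + s) powr (- (real k / 2))))"

lemma theta_stieltjes_has_integral:
  assumes k: "k \<ge> 1" and x: "x > 0"
  shows "((\<lambda>s. (theta s ^ k - 1) * s powr (real k / 2 - 1) *
      (x powr (real k / 2) * (x\<^sup>2 + s) powr (- (real k / 2)))) has_integral theta_stieltjes k x) {1..}"
proof -
  define a where "a = real k / 2"
  have a: "a > 0" using k by (simp add: a_def)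
  have bound: "x powr a * (x\<^sup>2 + s) powr (- a) \<le> x powr (- a)" if "s > 0" for s
  proof -
    have "(x\<^sup>2 + s) powr (- a) \<le> (x\<^sup>2) powr (- a)"
      using x that a by (intro powr_mono2') auto
    also have "(x\<^sup>2) powr (- a) = x powr (- a) * x powr (- a)"
      using x by (simp add: power2_eq_square powr_mult)
    finally have "x powr a * (x\<^sup>2 + s) powr (- a) \<le> x powr a * (x powr (- a) * x powr (- a))"
      by (intro mult_left_mono) auto
    also have "\<dots> = x powr (- a)" using x by (simp add: powr_add[symmetric])
    finally show ?thesis .
  qed
  have int: "(\<lambda>s. (theta s ^ k - 1) * s powr (a - 1) * x powr (- a)) integrable_on {1..}"
    using theta_moment_has_integral[of k "a - 1"]
    by (intro integrable_on_mult_left) (rule has_integral_integrable)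
  have "(\<lambda>s. (theta s ^ k - 1) * s powr (a - 1) * (x powr a * (x\<^sup>2 + s) powr (- a))) integrable_on {1..}"
  proof (rule integrable_on_continuous_dominated[OF _ _ int])
    show "continuous_on {1..} (\<lambda>s. (theta s ^ k - 1) * s powr (a - 1) * (x powr a * (x\<^sup>2 + s) powr (- a)))"
      using x by (intro continuous_intros continuous_on_theta_power) (auto simp: add_nonneg_eq_0_iff)
    fix s :: real assume "s \<in> {1..}"
    then have s: "s > 0" by simp
    have "(theta s ^ k - 1) * s powr (a - 1) \<ge> 0" using theta_power_ge_1[OF s, of k] by simp
    then show "\<bar>(theta s ^ k - 1) * s powr (a - 1) * (x powr a * (x\<^sup>2 + s) powr (- a))\<bar>
        \<le> (theta s ^ k - 1) * s powr (a - 1) * x powr (- a)"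
      using mult_left_mono[OF bound[OF s], of "(theta s ^ k - 1) * s powr (a - 1)"]
      by (subst abs_of_nonneg) (auto intro: mult_nonneg_nonneg)
  qed simp
  then show ?thesis unfolding theta_stieltjes_def a_def by (rule integrable_integral)
qed

lemma powr_square:
  fixes x b :: real
  assumes "x > 0"
  shows "(x\<^sup>2) powr b = x powr (2 * b)"
proof -
  have "(x\<^sup>2) powr b = x powr b * x powr b" using assms by (simp add: power2_eq_square powr_mult)
  then show ?thesis by (simp add: powr_add[symmetric])
qed

text \<open>\<open>theta_stieltjes k \<beta>\<close> and \<open>digamma_upper a (\<alpha>\<^sup>2)\<close> arise from the part of the theta integral over
  \<open>{0<..1}\<close> by the inversion \<open>s \<mapsto> 1/s\<close>.\<close>

lemma side_eq_symmetric:
  fixes k :: nat and \<alpha> :: real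
  assumes k: "k \<ge> 1" and \<alpha>: "\<alpha> > 0"
  defines "a \<equiv> real k / 2" and "\<beta> \<equiv> 1 / \<alpha>"
  shows "side k \<alpha> = sqrt pi / Gamma a * (theta_stieltjes k \<alpha> + theta_stieltjes k \<beta>
     - \<alpha> powr a * digamma_upper a (\<alpha>\<^sup>2) - \<beta> powr a * digamma_upper a (\<beta>\<^sup>2))"
proof -
  have a: "a > 0" using k by (simp add: a_def)
  have \<beta>: "\<beta> > 0" using \<alpha> by (simp add: \<beta>_def)
  have G: "Gamma a > 0" using a by (rule Gamma_real_pos)
  define A where "A = \<alpha> powr (- a)"
  define h where "h x s = x powr a * (x\<^sup>2 + s) powr (- a)" for x s :: real
  note H = theta_stieltjes_has_integral[OF k, folded a_def, folded h_def]

  \<comment> \<open>This integral is traded for \<open>digamma_upper\<close> at \<beta>^2, which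
    belongs to the symmetric expression; the price is the digamma value,
    \<open>euler_mascheroni\<close> and ln (\<beta>^2) = - 2 ln \<alpha>.\<close>
  obtain J where J: "((\<lambda>s. (1 - (1 + \<beta>\<^sup>2/s) powr (- a)) / s) has_integral J) {1..}"
    and J_eq: "J = digamma_upper a (\<beta>\<^sup>2) - 2 * ln \<alpha> + Digamma a + euler_mascheroni"
  proof -
    have "\<beta>\<^sup>2 > 0" using \<beta> by simp
    from digamma_half_integer_integrals[OF this k]
    obtain J M where J: "((\<lambda>s. (1 - (1 + \<beta>\<^sup>2/s) powr (- a)) / s) has_integral J) {1..}"
      and M: "((\<lambda>s. (1 + \<beta>\<^sup>2 * s) powr (- a) / s) has_integral M) {1..}"
      and JM: "J - M = ln (\<beta>\<^sup>2) + Digamma a + euler_mascheroni"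
      unfolding a_def by metis
    have "ln (\<beta>\<^sup>2) = - 2 * ln \<alpha>" using \<alpha> by (simp add: \<beta>_def ln_div ln_realpow)
    moreover have "M = digamma_upper a (\<beta>\<^sup>2)"
      unfolding digamma_upper_def using M by (rule integral_unique[symmetric])
    ultimately have "J = digamma_upper a (\<beta>\<^sup>2) - 2 * ln \<alpha> + Digamma a + euler_mascheroni"
      using JM by linarith
    with J show ?thesis by (rule that)
  qed
  have M: "((\<lambda>s. (1 + \<alpha>\<^sup>2 * s) powr (- a) / s) has_integral digamma_upper a (\<alpha>\<^sup>2)) {1..}"
  proof -
    have "\<alpha>\<^sup>2 > 0" using \<alpha> by simp
    from digamma_half_integer_integrals[OF this k]
    obtain M where M: "((\<lambda>s. (1 + \<alpha>\<^sup>2 * s) powr (- a) / s) has_integral M) {1..}"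
      unfolding a_def by metis
    then have "M = digamma_upper a (\<alpha>\<^sup>2)"
      unfolding digamma_upper_def by (rule integral_unique[symmetric])
    with M show ?thesis by simp
  qed

  have h_scale: "h \<alpha> s = A * (1 + 1/\<alpha>\<^sup>2 * s) powr (- a)" if "s > 0" for s
  proof -
    have "\<alpha>\<^sup>2 + s = \<alpha>\<^sup>2 * (1 + 1/\<alpha>\<^sup>2 * s)" using \<alpha> by (simp add: field_simps)
    then have "h \<alpha> s = \<alpha> powr a * ((\<alpha>\<^sup>2) powr (- a) * (1 + 1/\<alpha>\<^sup>2 * s) powr (- a))"
      using \<alpha> that by (simp only: h_def) (subst powr_mult, auto)
    also have "\<alpha> powr a * ((\<alpha>\<^sup>2) powr (- a) * y) = A * y" for y
      unfolding powr_square[OF \<alpha>] mult.assoc[symmetric] powr_add[symmetric] by (simp add: A_def)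
    finally show ?thesis .
  qed
  have h_nonneg: "A - h \<alpha> s \<ge> 0" if "s > 0" for s
  proof -
    have "A - h \<alpha> s = A * (1 - (1 + 1/\<alpha>\<^sup>2 * s) powr (- a))"
      unfolding h_scale[OF that] by (simp add: algebra_simps)
    also have "\<dots> \<ge> 0"
      using one_minus_powr_bounds(1)[OF a, of "1/\<alpha>\<^sup>2 * s"] \<alpha> that by (simp add: A_def)
    finally show ?thesis .
  qed

  \<comment> \<open>The sign of the kernel is reversed to make \<open>K\<close> nonnegative. As
    \<open>A - h \<alpha> s\<close> is O(s) at 0, it compensates the singularity 1/s of the
    remaining factors.\<close>
  define K where "K s = (theta s ^ k - 1) * s powr (a - 1) * (A - h \<alpha> s)" for s
  \<comment> \<open>The first bracket is the inverted part over \<open>{0<..1}\<close>: writing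
    theta^k as (theta^k - 1) + 1 separates the moment and Stieltjes terms from elementary
    integrals.\<close>
  define KK where "KK = (A * theta_moment k (-1) - theta_stieltjes k \<beta> + A * J - A * (1/a) + \<alpha> powr a * digamma_upper a (\<alpha>\<^sup>2))
      + (A * theta_moment k (a - 1) - theta_stieltjes k \<alpha>)"
  have K: "(K has_integral KK) {0<..}"
    unfolding KK_def
  proof (rule has_integral_split_at_1)
    fix s :: real assume s: "0 < s"
    show "K s \<ge> 0"
      unfolding K_def using theta_power_ge_1[OF s, of k] h_nonneg[OF s] by (intro mult_nonneg_nonneg) auto
  next
    have "((\<lambda>s. A * ((theta s ^ k - 1) * s powr (a - 1)) - (theta s ^ k - 1) * s powr (a - 1) * h \<alpha> s) has_integral
        A * theta_moment k (a - 1) - theta_stieltjes k \<alpha>) {1..}"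
      by (intro has_integral_diff has_integral_mult_right theta_moment_has_integral H \<alpha>)
    then show "(K has_integral A * theta_moment k (a - 1) - theta_stieltjes k \<alpha>) {1..}"
      by (rule has_integral_eq[rotated]) (simp add: K_def algebra_simps)
  next
    have h4: "((\<lambda>s::real. s powr (- a - 1)) has_integral 1/a) {1..}"
      using has_integral_powr_to_inf[of "-a-1" 1] a by simp
    have "((\<lambda>s. A * ((theta s ^ k - 1) * s powr (-1)) - (theta s ^ k - 1) * s powr (a - 1) * h \<beta> s
        + A * ((1 - (1 + \<beta>\<^sup>2/s) powr (- a)) / s) - A * s powr (- a - 1) + \<alpha> powr a * ((1 + \<alpha>\<^sup>2 * s) powr (- a) / s)) has_integral
        A * theta_moment k (-1) - theta_stieltjes k \<beta> + A * J - A * (1/a) + \<alpha> powr a * digamma_upper a (\<alpha>\<^sup>2)) {1..}"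
      by (intro has_integral_add has_integral_diff has_integral_mult_right theta_moment_has_integral H \<beta> h4 J M)
    then show "((\<lambda>s. K (1/s) / s\<^sup>2) has_integral
        A * theta_moment k (-1) - theta_stieltjes k \<beta> + A * J - A * (1/a) + \<alpha> powr a * digamma_upper a (\<alpha>\<^sup>2)) {1..}"
    proof (rule has_integral_eq[rotated])
      fix s :: real assume "s \<in> {1..}"
      then have s: "s > 0" by simp
      define y where "y = (1 + \<beta>\<^sup>2/s) powr (- a)"
      have hi: "h \<alpha> (1/s) = A * y"
        unfolding y_def using h_scale[of "1/s"] s by (simp add: \<beta>_def power_divide)
      \<comment> \<open>The inversion carries the kernel at \<alpha> to the one at \<beta>: together
        with the preceding identity, \<open>h \<alpha> (1/s) = s powr a * h \<beta> s\<close>. This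
        rests on \<beta> = 1/\<alpha>.\<close>
      have hb: "s powr a * h \<beta> s = A * y"
      proof -
        have "\<beta>\<^sup>2 + s = s * (1 + \<beta>\<^sup>2/s)" using s by (simp add: field_simps)
        then have "(\<beta>\<^sup>2 + s) powr (- a) = s powr (- a) * y"
          using s \<beta> by (simp only: y_def) (subst powr_mult, auto)
        then have "s powr a * h \<beta> s = \<beta> powr a * (s powr a * s powr (- a)) * y" by (simp add: h_def)
        also have "s powr a * s powr (- a) = 1" using s by (simp add: powr_add[symmetric])
        also have "\<beta> powr a = A" using \<alpha> by (simp add: \<beta>_def A_def powr_divide powr_minus_divide)
        finally show ?thesis by simp
      qed
      have hm: "\<alpha> powr a * (1 + \<alpha>\<^sup>2 * s) powr (- a) = h \<beta> s"
      proof -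
        have "\<beta>\<^sup>2 + s = \<beta>\<^sup>2 * (1 + \<alpha>\<^sup>2 * s)" using \<alpha> by (simp add: \<beta>_def field_simps)
        then have "h \<beta> s = \<beta> powr a * ((\<beta>\<^sup>2) powr (- a) * (1 + \<alpha>\<^sup>2 * s) powr (- a))"
          using s \<beta> by (simp only: h_def) (subst powr_mult, auto)
        also have "\<dots> = \<beta> powr (- a) * (1 + \<alpha>\<^sup>2 * s) powr (- a)"
          unfolding powr_square[OF \<beta>] mult.assoc[symmetric] powr_add[symmetric] by simp
        also have "\<beta> powr (- a) = \<alpha> powr a" using \<alpha> by (simp add: \<beta>_def powr_divide powr_minus_divide)
        finally show ?thesis by simp
      qed
      have p: "(1/s) powr (a - 1) / s\<^sup>2 = s powr (- a - 1)"
      proof -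
        have e: "- (a - 1) - 2 = - a - 1" by simp
        show ?thesis using powr_inverse_divide_square[OF s, of "a - 1"] unfolding e .
      qed
      have q: "s powr (- a - 1) * s powr a = 1/s" "s powr (a - 1) = s powr a * (1/s)" "s powr (-1) = 1/s"
        using s by (simp_all add: powr_add[symmetric] powr_minus_divide powr_diff)
      have "K (1/s) / s\<^sup>2 = (s powr a * theta s ^ k - 1) * ((1/s) powr (a - 1) / s\<^sup>2) * (A - A * y)"
        using theta_power_inverse[OF s, of k] by (simp add: K_def hi a_def)
      also have "\<dots> = ((s powr (- a - 1) * s powr a) * theta s ^ k - s powr (- a - 1)) * (A - A * y)"
        unfolding p by (simp add: algebra_simps)
      also have "\<dots> = (1/s * theta s ^ k - s powr (- a - 1)) * (A - A * y)" unfolding q(1) ..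
      also have "\<dots> = A * ((theta s ^ k - 1) * (1/s)) - (theta s ^ k - 1) * (1/s) * (A * y)
          + A * ((1 - y) / s) - A * s powr (- a - 1) + s powr (- a - 1) * (A * y)"
        by (simp add: algebra_simps diff_divide_distrib)
      also have "s powr (- a - 1) * (A * y) = \<alpha> powr a * ((1 + \<alpha>\<^sup>2 * s) powr (- a) / s)"
      proof -
        have "s powr (- a - 1) * (A * y) = (s powr (- a - 1) * s powr a) * h \<beta> s"
          unfolding hb[symmetric] by simp
        also have "\<dots> = \<alpha> powr a * ((1 + \<alpha>\<^sup>2 * s) powr (- a) / s)"
          unfolding q(1) hm[symmetric] by simp
        finally show ?thesis .
      qed
      also have "(theta s ^ k - 1) * (1/s) * (A * y) = (theta s ^ k - 1) * s powr (a - 1) * h \<beta> s"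
        unfolding hb[symmetric] q(2) by simp
      finally show "A * ((theta s ^ k - 1) * s powr (-1)) - (theta s ^ k - 1) * s powr (a - 1) * h \<beta> s
        + A * ((1 - (1 + \<beta>\<^sup>2/s) powr (- a)) / s) - A * s powr (- a - 1) + \<alpha> powr a * ((1 + \<alpha>\<^sup>2 * s) powr (- a) / s)
        = K (1/s) / s\<^sup>2"
        unfolding q(3) y_def by simp
    qed
  qed

  define x where "x n = pi * real (Suc n) * \<alpha>\<^sup>2" for n
  have x: "x n > 0" for n using \<alpha> by (simp add: x_def)
  define t where "t n = real (r k (Suc n)) * (\<alpha> powr a * (Gamma a / x n powr a - tricomi a 0 (x n)))" for n
  have t_sums: "t sums KK"
    unfolding t_def[abs_def]
  proof (rule integrable_sums_nonneg[OF _ _ _ K])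
    fix n
    define f where "f u = exp (- (x n * u)) * u powr (a - 1) * (1 - (1 + u) powr (- a))" for u
    have f: "(f has_integral Gamma a / x n powr a - tricomi a 0 (x n)) {0<..}"
      unfolding f_def[abs_def] by (rule tricomi_remainder_has_integral[OF a x])
    \<comment> \<open>The substitution u = s / \<alpha>^2 turns exp (- x_n u) into the theta
      exponential exp (- pi (n + 1) s), so that the terms add up to \<open>K\<close>.\<close>
    have "((\<lambda>s. 1/\<alpha>\<^sup>2 * f (1/\<alpha>\<^sup>2 * s)) has_integral Gamma a / x n powr a - tricomi a 0 (x n)) {0<..}"
      using f \<alpha> one_minus_powr_bounds(1)[OF a]
      by (subst has_integral_scale[where f = f]) (auto simp: f_def)
    then have "((\<lambda>s. real (r k (Suc n)) * (\<alpha> powr a * (1/\<alpha>\<^sup>2 * f (1/\<alpha>\<^sup>2 * s)))) has_integral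
        real (r k (Suc n)) * (\<alpha> powr a * (Gamma a / x n powr a - tricomi a 0 (x n)))) {0<..}"
      by (intro has_integral_mult_right)
    then show "((\<lambda>s. real (r k (Suc n)) * exp (- (pi * real (Suc n) * s)) * (s powr (a - 1) * (A - h \<alpha> s))) has_integral
        real (r k (Suc n)) * (\<alpha> powr a * (Gamma a / x n powr a - tricomi a 0 (x n)))) {0<..}"
    proof (rule has_integral_eq[rotated])
      fix s :: real assume "s \<in> {0<..}"
      then have s: "s > 0" by simp
      define y where "y = (1 + 1/\<alpha>\<^sup>2 * s) powr (- a)"
      have e: "exp (- (x n * (1/\<alpha>\<^sup>2 * s))) = exp (- (pi * real (Suc n) * s))"
        using \<alpha> by (simp add: x_def del: of_nat_Suc)
      have p: "\<alpha> powr a * (1/\<alpha>\<^sup>2 * (1/\<alpha>\<^sup>2 * s) powr (a - 1)) = A * s powr (a - 1)"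
      proof -
        have "(1/\<alpha>\<^sup>2 * s) powr (a - 1) = (1/\<alpha>\<^sup>2) powr (a - 1) * s powr (a - 1)"
          by (rule powr_mult)
        also have "(1/\<alpha>\<^sup>2) powr (a - 1) = \<alpha> powr (2 * (1 - a))"
          using \<alpha> by (simp add: powr_divide powr_square powr_minus_divide[symmetric])
        also have "1/\<alpha>\<^sup>2 = \<alpha> powr (-2)" using \<alpha> by (simp add: powr_minus_divide)
        finally have "\<alpha> powr a * (1/\<alpha>\<^sup>2 * (1/\<alpha>\<^sup>2 * s) powr (a - 1))
            = \<alpha> powr a * (\<alpha> powr (-2) * (\<alpha> powr (2 * (1 - a)) * s powr (a - 1)))"
          using \<alpha> by (simp add: powr_minus_divide)
        also have "\<dots> = A * s powr (a - 1)"
          unfolding mult.assoc[symmetric] powr_add[symmetric] by (simp add: A_def algebra_simps)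
        finally show ?thesis .
      qed
      have "real (r k (Suc n)) * (\<alpha> powr a * (1/\<alpha>\<^sup>2 * f (1/\<alpha>\<^sup>2 * s)))
         = real (r k (Suc n)) * exp (- (pi * real (Suc n) * s)) * ((\<alpha> powr a * (1/\<alpha>\<^sup>2 * (1/\<alpha>\<^sup>2 * s) powr (a - 1))) * (1 - y))"
        unfolding f_def e y_def[symmetric] by (simp only: mult_ac)
      also have "(\<alpha> powr a * (1/\<alpha>\<^sup>2 * (1/\<alpha>\<^sup>2 * s) powr (a - 1))) * (1 - y) = s powr (a - 1) * (A - A * y)"
        unfolding p by (simp add: algebra_simps)
      also have "A * y = h \<alpha> s" unfolding y_def by (rule h_scale[OF s, symmetric])
      finally show "real (r k (Suc n)) * (\<alpha> powr a * (1/\<alpha>\<^sup>2 * f (1/\<alpha>\<^sup>2 * s)))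
         = real (r k (Suc n)) * exp (- (pi * real (Suc n) * s)) * (s powr (a - 1) * (A - h \<alpha> s))" .
    qed
  next
    fix n and s :: real assume "s \<in> {0<..}"
    then show "0 \<le> real (r k (Suc n)) * exp (- (pi * real (Suc n) * s)) * (s powr (a - 1) * (A - h \<alpha> s))"
      using h_nonneg[of s] by simp
  next
    fix s :: real assume "s \<in> {0<..}"
    then have s: "s > 0" by simp
    from sums_mult2[OF theta_power_minus_1_sums[OF s, of k], of "s powr (a - 1) * (A - h \<alpha> s)"]
    show "(\<lambda>n. real (r k (Suc n)) * exp (- (pi * real (Suc n) * s)) * (s powr (a - 1) * (A - h \<alpha> s))) sums K s"
      by (simp only: K_def mult.assoc)
  qed

  \<comment> \<open>The sign undoes the reversed kernel in \<open>K\<close>; the power \<alpha>^(1 -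
    a) cancels against the \<alpha>^(a - 1) in front of the series.\<close>
  define c where "c = - (sqrt pi * \<alpha> powr (1 - a) / Gamma a)"
  have term_eq: "real (r k (Suc n)) *
          (exp (pi * real (Suc n) * \<alpha>\<^sup>2 / 2) / sqrt (real (Suc n))
             * whittaker_W ((1 - real k) / 2) 0 (pi * real (Suc n) * \<alpha>\<^sup>2)
           - pi powr ((1 - real k) / 2) / (real (Suc n) powr (real k / 2) * \<alpha> powr (real k - 1))) = c * t n" for n
  proof -
    define N where "N = real (Suc n)"
    have N: "N > 0" by (simp add: N_def)
    have k_eq: "(1 - real k) / 2 = 1/2 - a" "real k / 2 = a" "real k - 1 = 2 * a - 1" by (simp_all add: a_def)
    have sx: "sqrt (x n) = sqrt pi * sqrt N * \<alpha>"
      using \<alpha> by (simp add: x_def N_def real_sqrt_mult del: of_nat_Suc)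
    have "exp (x n / 2) / sqrt N * whittaker_W (1/2 - a) 0 (x n)
        = (exp (x n / 2) * exp (- x n / 2)) * (sqrt (x n) / sqrt N) * (tricomi a 0 (x n) / Gamma a)"
      unfolding whittaker_W_eq_tricomi[OF a x] by simp
    also have "exp (x n / 2) * exp (- x n / 2) = 1" by (simp add: exp_add[symmetric])
    also have "sqrt (x n) / sqrt N = sqrt pi * \<alpha>" using N by (simp add: sx)
    finally have 1: "exp (x n / 2) / sqrt N * whittaker_W (1/2 - a) 0 (x n) = sqrt pi * \<alpha> * (tricomi a 0 (x n) / Gamma a)" by simp
    have 2: "pi powr (1/2 - a) / (N powr a * \<alpha> powr (2 * a - 1)) = sqrt pi * \<alpha> * (1 / x n powr a)"
    proof -
      have "x n powr a = pi powr a * N powr a * \<alpha> powr (2 * a)"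
        using \<alpha> N by (simp add: x_def N_def[symmetric] powr_mult powr_square del: of_nat_Suc)
      moreover have "\<alpha> powr (2 * a - 1) = \<alpha> powr (2 * a) / \<alpha>" using \<alpha> by (simp add: powr_diff)
      moreover have "pi powr (1/2 - a) = sqrt pi / pi powr a" by (simp add: powr_diff powr_half_sqrt)
      ultimately show ?thesis by simp
    qed
    have 3: "\<alpha> powr (1 - a) * (\<alpha> powr a * z) = \<alpha> * z" for z
      unfolding mult.assoc[symmetric] powr_add[symmetric] using \<alpha> by simp
    have "sqrt pi * \<alpha> * (tricomi a 0 (x n) / Gamma a) - sqrt pi * \<alpha> * (1 / x n powr a)
        = - (sqrt pi / Gamma a) * (\<alpha> * (Gamma a / x n powr a - tricomi a 0 (x n)))"
      using G by (simp add: field_simps)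
    also have "\<dots> = - (sqrt pi / Gamma a) * (\<alpha> powr (1 - a) * (\<alpha> powr a * (Gamma a / x n powr a - tricomi a 0 (x n))))"
      unfolding 3 ..
    also have "\<dots> = c * (\<alpha> powr a * (Gamma a / x n powr a - tricomi a 0 (x n)))" by (simp add: c_def)
    finally show ?thesis
      unfolding k_eq N_def[symmetric] x_def[of n, folded N_def, symmetric] 1 2 t_def
      by (simp only: N_def[symmetric] mult.left_commute)
  qed
  have series: "(\<Sum>n. real (r k (Suc n)) *
          (exp (pi * real (Suc n) * \<alpha>\<^sup>2 / 2) / sqrt (real (Suc n))
             * whittaker_W ((1 - real k) / 2) 0 (pi * real (Suc n) * \<alpha>\<^sup>2)
           - pi powr ((1 - real k) / 2) / (real (Suc n) powr (real k / 2) * \<alpha> powr (real k - 1)))) = c * KK"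
    unfolding term_eq using sums_mult[OF t_sums, of c] by (simp add: sums_iff)
  have first: "\<alpha> powr (a - 1) * (c * KK) = - (sqrt pi / Gamma a) * KK"
  proof -
    have "\<alpha> powr (a - 1) * \<alpha> powr (1 - a) = 1" using \<alpha> by (simp add: powr_add[symmetric])
    then have "\<alpha> powr (a - 1) * c = - (sqrt pi / Gamma a)" by (simp add: c_def mult.left_commute)
    then show ?thesis by (simp add: mult.assoc[symmetric])
  qed
  have A_eq: "\<alpha> powr (- real k / 2) = A" "1 / \<alpha> powr a = A" "\<beta> powr a = A"
    using \<alpha> by (simp_all add: A_def a_def \<beta>_def powr_minus_divide powr_divide)
  have second: "pi powr ((1 - real k) / 2) * z = sqrt pi / Gamma a * (Gamma a * pi powr (- a) * z)" for z
  proof -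
    have "(1 - real k) / 2 = 1/2 + - a" by (simp add: a_def)
    then have "pi powr ((1 - real k) / 2) = pi powr (1/2) * pi powr (- a)" by (simp only: powr_add)
    then show ?thesis using G by (simp add: powr_half_sqrt)
  qed
  have lnpi: "ln (4 * pi * \<alpha>\<^sup>2) = ln (4 * pi) + 2 * ln \<alpha>"
    using \<alpha> by (subst ln_mult) (auto simp: ln_realpow)
  define B where "B = theta_moment k (a - 1) + theta_moment k (-1)"
  define z where "z = zeta_r (k - 1) a"
  have kron: "B = 1 / a + Gamma a * pi powr (- a) * z - 2 * ln (Phi k) + euler_mascheroni - ln (4 * pi)"
    unfolding B_def z_def a_def by (rule kronecker_limit_formula[OF k])
  have "side k \<alpha> = \<alpha> powr (a - 1) * (c * KK) + pi powr ((1 - real k) / 2) * (A * z)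
      + sqrt pi / Gamma a * (A * (2 * euler_mascheroni + Digamma a - 2 * ln (Phi k) - ln (4 * pi * \<alpha>\<^sup>2)))"
    unfolding side_def series A_eq(1) z_def by (simp add: a_def[symmetric] A_eq(2)[symmetric])
  also have "\<dots> = sqrt pi / Gamma a * (- KK + A * (Gamma a * pi powr (- a) * z
      + (2 * euler_mascheroni + Digamma a - 2 * ln (Phi k) - ln (4 * pi) - 2 * ln \<alpha>)))"
    unfolding first second lnpi by (simp add: algebra_simps)
  also have "- KK + A * (Gamma a * pi powr (- a) * z
      + (2 * euler_mascheroni + Digamma a - 2 * ln (Phi k) - ln (4 * pi) - 2 * ln \<alpha>))
    = theta_stieltjes k \<alpha> + theta_stieltjes k \<beta> - \<alpha> powr a * digamma_upper a (\<alpha>\<^sup>2) - A * digamma_upper a (\<beta>\<^sup>2)"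
  proof -
    \<comment> \<open>Kronecker's formula enters through \<open>B\<close> and the digamma integral
      through \<open>J\<close>. Together they reproduce every explicit constant of
      \<open>side\<close>, 1/a cancels, and only terms that the exchange of \<alpha> and \<beta>
      permutes survive.\<close>
    have "KK = A * B + A * (J - 1/a) - theta_stieltjes k \<alpha> - theta_stieltjes k \<beta> + \<alpha> powr a * digamma_upper a (\<alpha>\<^sup>2)"
      by (simp add: KK_def B_def algebra_simps)
    then show ?thesis unfolding kron J_eq by (simp add: algebra_simps)
  qed
  finally show ?thesis unfolding A_eq(3) .
qed

theorem theorem1:
  fixes k :: nat and \<alpha> \<beta> :: real
  assumes "k \<ge> 1" and "\<alpha> > 0" and "\<beta> > 0" and "\<alpha> * \<beta> = 1"
  shows "side k \<alpha> = side k \<beta>"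
proof -
  have "\<beta> = 1 / \<alpha>" "\<alpha> = 1 / \<beta>" using assms by (auto simp: field_simps)
  then show ?thesis
    using side_eq_symmetric[OF assms(1,2)] side_eq_symmetric[OF assms(1,3)] by (simp add: add.commute)
qed

end
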